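(* Let $n \ge 2$ be an integer, let $\beta_1, \dots, \beta_n$ be positive real numbers, and let $q(x) = \beta_1 x_1^2 + \cdots + \beta_n x_n^2$ for $x \in \mathbf{R}^n$. Let $E = \{x \in \mathbf{R}^n : q(x) < 1\}$, $\partial E = \{x \in \mathbf{R}^n : q(x) = 1\}$ and $\bar{E} = \{x \in \mathbf{R}^n : q(x) \le 1\}$. Suppose $f$ and $g$ are polynomials on $\mathbf{R}^n$ (with real coefficients). Then the following are equivalent: (a) $\displaystyle \int_{\partial E} \frac{f}{\|\nabla q\|} \, dA = \int_E g \, dV$. (b) There exists a polynomial $h$ on $\mathbf{R}^n$ with $\deg h \le \max\{\deg f, 2 + \deg g\}$ such that $\Delta h = g$ on $\mathbf{R}^n$ and $\nabla h \cdot \nabla q = f$ on $\partial E$. (c) There exists a smooth function $h$ on $\bar{E}$ such that $\Delta h = g$ on $\bar{E}$ and $D_{\mathbf{n}} h = \dfrac{f}{\|\nabla q\|}$ on $\partial E$.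
   Context: $dV$ denotes the usual volume (Lebesgue) measure on $\mathbf{R}^n$, $dA$ denotes the usual surface area measure on the ellipsoid $\partial E$, $\|\cdot\|$ is the Euclidean norm, and $\Delta = \sum_{j=1}^n \partial^2/\partial x_j^2$ is the Laplacian. The gradient of $q$ is $(\nabla q)(x) = 2(\beta_1 x_1, \dots, \beta_n x_n)$. The outward-pointing unit normal at $x \in \partial E$ is $\mathbf{n}(x) = \nabla q(x)/\|\nabla q(x)\|$, and for a smooth function $h$ on $\bar{E}$ the outward normal derivative on $\partial E$ is $D_{\mathbf{n}} h = \nabla h \cdot \mathbf{n} = \nabla h \cdot \dfrac{\nabla q}{\|\nabla q\|}$. "Smooth on the closed set $\bar{E}$" means that $h$ extends to a $C^\infty$ function on an open set containing $\bar{E}$. Polynomials have real coefficients, and the degree of the zero polynomial is taken to be $-\infty$. *)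

theory Defs
  imports "HOL-Analysis.Analysis" "HOL-Library.Poly_Mapping"
begin

text \<open>Polynomials in the coordinates \<open>x $ i\<close>: finitely supported families of real coefficients
  indexed by exponent vectors.\<close>

type_synonym 'n mpoly = "('n \<Rightarrow>\<^sub>0 nat) \<Rightarrow>\<^sub>0 real"

definition eval_mpoly :: "'n::finite mpoly \<Rightarrow> real^'n \<Rightarrow> real" where
  "eval_mpoly p x =
     (\<Sum>m\<in>Poly_Mapping.keys p. Poly_Mapping.lookup p m * (\<Prod>i\<in>UNIV. (x $ i) ^ Poly_Mapping.lookup m i))"

definition mdegree :: "'n::finite mpoly \<Rightarrow> ereal" where
  "mdegree p =
     (if p = 0 then - \<infinity>
      else ereal (real (Max ((\<lambda>m. \<Sum>i\<in>UNIV. Poly_Mapping.lookup m i) ` Poly_Mapping.keys p))))"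

definition partial_deriv :: "'n::finite \<Rightarrow> (real^'n \<Rightarrow> real) \<Rightarrow> real^'n \<Rightarrow> real" where
  "partial_deriv i f x = deriv (\<lambda>t. f (x + t *\<^sub>R axis i 1)) 0"

definition gradient :: "(real^'n::finite \<Rightarrow> real) \<Rightarrow> real^'n \<Rightarrow> real^'n" where
  "gradient f x = (\<chi> i. partial_deriv i f x)"

definition laplacian :: "(real^'n::finite \<Rightarrow> real) \<Rightarrow> real^'n \<Rightarrow> real" where
  "laplacian f x = (\<Sum>i\<in>UNIV. partial_deriv i (partial_deriv i f) x)"

text \<open>\<open>C\<^sup>k\<close> functions; only used for open \<open>U\<close>, where the values of \<open>f\<close> outside \<open>U\<close> do not matter.\<close>

primrec Ck_on :: "nat \<Rightarrow> (real^'n::finite \<Rightarrow> real) \<Rightarrow> (real^'n) set \<Rightarrow> bool" where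
  "Ck_on 0 f U \<longleftrightarrow> continuous_on U f"
| "Ck_on (Suc k) f U \<longleftrightarrow> f differentiable_on U \<and> (\<forall>i. Ck_on k (partial_deriv i f) U)"

text \<open>A smooth function on a closed set \<open>S\<close> is represented by a smooth extension, so that its
  derivatives make sense on the boundary as well. When \<open>S\<close> is the closure of its interior, the
  derivatives on \<open>S\<close> do not depend on the extension.\<close>

definition smooth_on_nhd :: "(real^'n::finite \<Rightarrow> real) \<Rightarrow> (real^'n) set \<Rightarrow> bool" where
  "smooth_on_nhd h S \<longleftrightarrow> (\<exists>U. open U \<and> S \<subseteq> U \<and> (\<forall>k. Ck_on k h U))"

text \<open>The \<open>(n-1)\<close>-dimensional Lebesgue measure on the coordinate hyperplane \<open>{y. y $ k = 0}\<close>.\<close>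

definition hyperplane_lborel :: "'n::finite \<Rightarrow> (real^'n) measure" where
  "hyperplane_lborel k =
     distr (Pi\<^sub>M (UNIV - {k}) (\<lambda>_. lborel :: real measure)) borel
       (\<lambda>u. \<chi> i. if i = k then 0 else u i)"

definition graph_map :: "'n::finite \<Rightarrow> (real^'n \<Rightarrow> real) \<Rightarrow> real^'n \<Rightarrow> real^'n" where
  "graph_map k \<phi> y = y + \<phi> y *\<^sub>R axis k 1"

text \<open>The area of a piece of a \<open>C\<^sup>1\<close> graph is the integral of \<open>sqrt (1 + |\<nabla>\<phi>|\<^sup>2)\<close> over
  its projection, where the gradient is that of \<open>\<phi>\<close> on the hyperplane \<open>{y. y $ k = 0}\<close>. Every
  point of an embedded \<open>C\<^sup>1\<close> hypersurface has a neighbourhood in the hypersurface that is such a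
  graph for some \<open>k\<close>, so this property determines the surface area measure. It is taken as a
  Borel measure on the whole space which vanishes off \<open>S\<close>.\<close>

definition is_surface_measure :: "(real^'n::finite) set \<Rightarrow> (real^'n) measure \<Rightarrow> bool" where
  "is_surface_measure S M \<longleftrightarrow>
     space M = UNIV \<and> sets M = sets borel \<and> emeasure M (- S) = 0 \<and>
     (\<forall>k W \<phi> B. open W \<longrightarrow> Ck_on 1 \<phi> W \<longrightarrow>
        graph_map k \<phi> ` (W \<inter> {y. y $ k = 0}) \<subseteq> S \<longrightarrow>
        B \<in> sets borel \<longrightarrow> B \<subseteq> W \<inter> {y. y $ k = 0} \<longrightarrow>
        emeasure M (graph_map k \<phi> ` B) =
          (\<integral>\<^sup>+y\<in>B. ennreal (sqrt (1 + (\<Sum>i\<in>UNIV - {k}. (partial_deriv i \<phi> y)\<^sup>2))) \<partial>hyperplane_lborel k))"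

definition surface_measure :: "(real^'n::finite) set \<Rightarrow> (real^'n) measure" where
  "surface_measure S = (THE M. is_surface_measure S M)"

definition quad :: "real^'n::finite \<Rightarrow> real^'n \<Rightarrow> real" where
  "quad \<beta> x = (\<Sum>i\<in>UNIV. \<beta> $ i * (x $ i)\<^sup>2)"

definition ellipsoid :: "real^'n::finite \<Rightarrow> (real^'n) set" where
  "ellipsoid \<beta> = {x. quad \<beta> x < 1}"

definition ellipsoid_bd :: "real^'n::finite \<Rightarrow> (real^'n) set" where
  "ellipsoid_bd \<beta> = {x. quad \<beta> x = 1}"

definition ellipsoid_cl :: "real^'n::finite \<Rightarrow> (real^'n) set" where
  "ellipsoid_cl \<beta> = {x. quad \<beta> x \<le> 1}"

definition outward_normal :: "real^'n::finite \<Rightarrow> real^'n \<Rightarrow> real^'n" where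
  "outward_normal \<beta> x = gradient (quad \<beta>) x /\<^sub>R norm (gradient (quad \<beta>) x)"

definition normal_deriv :: "real^'n::finite \<Rightarrow> (real^'n \<Rightarrow> real) \<Rightarrow> real^'n \<Rightarrow> real" where
  "normal_deriv \<beta> h x = gradient h x \<bullet> outward_normal \<beta> x"

end

theory Submission
  imports Defs "HOL-Library.Function_Algebras"
begin

text \<open>
  For each coordinate \<open>k\<close> the ellipsoid is the region between two graphs over the hyperplane
  \<open>x\<^sub>k = 0\<close>, so by Fubini the integral of \<open>\<partial>\<^sub>k F\<close> over \<open>E\<close> is the difference \<open>I\<^sub>k F\<close> of the integrals of
  \<open>F\<close> over the upper and the lower cap with respect to the hyperplane measure. The measure
  \<open>\<mu> = dA / \<parallel>\<nabla>q\<parallel>\<close> is constructed as \<open>\<mu>(w) = (\<Sum>k. I\<^sub>k (x\<^sub>k w)) / 2\<close>, a positive functional. That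
  \<open>2 \<beta>\<^sub>j x\<^sub>j \<mu>\<close> restricts to the hyperplane measure on the caps of every direction \<open>j\<close> follows, for polynomial
  \<open>w\<close>, from the vanishing flux of fields with a factor \<open>1 - q\<close>, and in general from Stone-Weierstrass.
  This yields existence of the area measure and the divergence theorem at once. Finally, (a) implies
  (b) because the compatibility condition is one linear condition on the range of a linear operator
  on polynomials of bounded degree whose kernel consists of the constants.
\<close>

subsection \<open>Partial derivatives and polynomial functions\<close>

text \<open>\<open>surface_measure\<close> is a definite description, so nothing is known about it
  until a measure with the chart property has been exhibited and shown to be the only one. The cap
  formula for \<mu> is global: it needs no partition of unity and no change of charts. Its origin is
  x . n = x . \<nabla>q / |\<nabla>q| = 2 q / |\<nabla>q| = 2 / |\<nabla>q| on the boundary, n being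
  the outward normal. What has to be proved is that this sum over all k has the right component in
  each single direction j, namely 2 \<beta>_j x_j \<mu> = n_j dA. Classically this is the
  parallelism of n and \<nabla>q, in the form \<beta>_j x_j n_k = \<beta>_k x_k n_j. Dividing the
  area by |\<nabla>q| makes the densities polynomial, with no square root left, so that the identity
  can be tested on polynomials. In the linear algebra the boundary data see f only up to multiples
  of q - 1. Taking such a multiple as a further unknown makes domain and range the same
  finite-dimensional space, so that solvability follows from injectivity, which is an energy
  argument.\<close>

lemma partial_deriv_eq:
  fixes f :: "real^'n::finite \<Rightarrow> real"
  assumes "(f has_derivative f') (at x)"
  shows "partial_deriv i f x = f' (axis i 1)"
proof -
  have "((\<lambda>t. f (x + t *\<^sub>R axis i 1)) has_derivative (\<lambda>t. f' (t *\<^sub>R axis i 1))) (at 0)"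
    by (rule has_derivative_compose[where g = f]) (auto intro!: derivative_eq_intros simp: assms)
  moreover have "(\<lambda>t. f' (t *\<^sub>R axis i 1)) = (*) (f' (axis i 1))"
    using has_derivative_bounded_linear[OF assms] by (auto simp: linear_simps bounded_linear.linear)
  ultimately show ?thesis
    unfolding partial_deriv_def by (intro DERIV_imp_deriv) (simp add: has_field_derivative_def)
qed

text \<open>The derivative along a coordinate line at an arbitrary parameter, as the fundamental
  theorem of calculus on chords needs it; \<open>partial_deriv\<close> itself only differentiates at
  0.\<close>

lemma DERIV_partial_deriv:
  fixes f :: "real^'n::finite \<Rightarrow> real"
  assumes "f differentiable (at (x + s *\<^sub>R axis i 1))"
  shows "((\<lambda>t. f (x + t *\<^sub>R axis i 1)) has_real_derivative partial_deriv i f (x + s *\<^sub>R axis i 1)) (at s)"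
proof -
  obtain f' where f': "(f has_derivative f') (at (x + s *\<^sub>R axis i 1))"
    using assms by (auto simp: differentiable_def)
  have "((\<lambda>t. f (x + t *\<^sub>R axis i 1)) has_derivative (\<lambda>t. f' (t *\<^sub>R axis i 1))) (at s)"
    by (rule has_derivative_compose[where g = f]) (auto intro!: derivative_eq_intros f')
  moreover have "(\<lambda>t. f' (t *\<^sub>R axis i 1)) = (*) (partial_deriv i f (x + s *\<^sub>R axis i 1))"
    using has_derivative_bounded_linear[OF f'] by (auto simp: linear_simps bounded_linear.linear partial_deriv_eq[OF f'])
  ultimately show ?thesis by (simp add: has_field_derivative_def)
qed

lemma partial_deriv_const [simp]: "partial_deriv i (\<lambda>x. c) x = 0"
  by (simp add: partial_deriv_def)

lemma partial_deriv_linear: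
  "bounded_linear f \<Longrightarrow> partial_deriv i f x = f (axis i 1)"
  by (rule partial_deriv_eq) (rule bounded_linear_imp_has_derivative)

lemma partial_deriv_coord [simp]: "partial_deriv i (\<lambda>x. x $ j) x = (if i = j then 1 else 0)"
  by (subst partial_deriv_linear) (auto simp: bounded_linear_vec_nth axis_def)

lemma partial_deriv_add:
  assumes "f differentiable at x" "g differentiable at x"
  shows "partial_deriv i (\<lambda>x. f x + g x) x = partial_deriv i f x + partial_deriv i g x"
proof -
  obtain f' g' where d: "(f has_derivative f') (at x)" "(g has_derivative g') (at x)"
    using assms by (auto simp: differentiable_def)
  show ?thesis
    by (simp add: partial_deriv_eq[OF has_derivative_add[OF d]] partial_deriv_eq[OF d(1)] partial_deriv_eq[OF d(2)])
qed

lemma partial_deriv_diff: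
  assumes "f differentiable at x" "g differentiable at x"
  shows "partial_deriv i (\<lambda>x. f x - g x) x = partial_deriv i f x - partial_deriv i g x"
proof -
  obtain f' g' where d: "(f has_derivative f') (at x)" "(g has_derivative g') (at x)"
    using assms by (auto simp: differentiable_def)
  show ?thesis
    by (simp add: partial_deriv_eq[OF has_derivative_diff[OF d]] partial_deriv_eq[OF d(1)] partial_deriv_eq[OF d(2)])
qed

lemma partial_deriv_mult:
  assumes "f differentiable at x" "g differentiable at x"
  shows "partial_deriv i (\<lambda>x. f x * g x) x = partial_deriv i f x * g x + f x * partial_deriv i g x"
proof -
  obtain f' g' where d: "(f has_derivative f') (at x)" "(g has_derivative g') (at x)"
    using assms by (auto simp: differentiable_def)
  show ?thesis
    by (simp add: partial_deriv_eq[OF has_derivative_mult[OF d]] partial_deriv_eq[OF d(1)] partial_deriv_eq[OF d(2)])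
qed

lemma partial_deriv_cmult:
  assumes "f differentiable at x"
  shows "partial_deriv i (\<lambda>x. c * f x) x = c * partial_deriv i f x"
  by (simp add: partial_deriv_mult assms)

lemma partial_deriv_sum:
  assumes "\<And>a. a \<in> A \<Longrightarrow> f a differentiable at x"
  shows "partial_deriv i (\<lambda>x. \<Sum>a\<in>A. f a x) x = (\<Sum>a\<in>A. partial_deriv i (f a) x)"
  using assms
proof (induction A rule: infinite_finite_induct)
  case (insert a A)
  then show ?case by (simp add: partial_deriv_add differentiable_sum)
qed auto

lemma continuous_on_real_polynomial_function: "real_polynomial_function p \<Longrightarrow> continuous_on A p"
  for p :: "'a::euclidean_space \<Rightarrow> real"
  by (simp add: continuous_on_polymonial_function real_polynomial_function_eq)

lemma borel_measurable_real_polynomial_function [measurable_dest]: "real_polynomial_function p \<Longrightarrow> p \<in> borel_measurable borel"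
  for p :: "'a::euclidean_space \<Rightarrow> real"
  by (intro borel_measurable_continuous_onI continuous_on_real_polynomial_function)

lemma real_polynomial_function_partial_deriv:
  fixes f :: "real^'n::finite \<Rightarrow> real"
  assumes "real_polynomial_function f"
  shows "real_polynomial_function (partial_deriv i f)"
  using assms
proof induction
  case (linear f)
  then have "partial_deriv i f = (\<lambda>x. f (axis i 1))" by (auto simp: partial_deriv_linear)
  then show ?case by auto
next
  case (const c)
  have "partial_deriv i (\<lambda>x. c) = (\<lambda>x. 0)" by auto
  then show ?case by auto
next
  case (add f g)
  then have "partial_deriv i (\<lambda>x. f x + g x) = (\<lambda>x. partial_deriv i f x + partial_deriv i g x)"
    by (intro ext partial_deriv_add differentiable_at_real_polynomial_function)
  then show ?case using add by auto
next
  case (mult f g)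
  then have "partial_deriv i (\<lambda>x. f x * g x) = (\<lambda>x. partial_deriv i f x * g x + f x * partial_deriv i g x)"
    by (intro ext partial_deriv_mult differentiable_at_real_polynomial_function)
  then show ?case using mult by auto
qed

text \<open>Structural induction takes the place of Schwarz's theorem: in the product case
  exchanging the indices merely exchanges the two mixed terms. Its use is in
  \<open>flux_swap\<close>.\<close>

lemma partial_deriv_commute:
  fixes f :: "real^'n::finite \<Rightarrow> real"
  assumes "real_polynomial_function f"
  shows "partial_deriv i (partial_deriv j f) x = partial_deriv j (partial_deriv i f) x"
  using assms
proof (induction arbitrary: x)
  case (linear f)
  then have "partial_deriv k f = (\<lambda>x. f (axis k 1))" for k by (auto simp: partial_deriv_linear)
  then show ?case by auto
next
  case (const c)
  have "partial_deriv k (\<lambda>x. c) = (\<lambda>x. 0)" for k :: 'n by auto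
  then show ?case by auto
next
  case (add f g)
  then have "partial_deriv k (\<lambda>x. f x + g x) = (\<lambda>x. partial_deriv k f x + partial_deriv k g x)" for k
    by (intro ext partial_deriv_add differentiable_at_real_polynomial_function)
  then show ?case using add
    by (simp add: partial_deriv_add differentiable_at_real_polynomial_function real_polynomial_function_partial_deriv)
next
  case (mult f g)
  then have *: "partial_deriv k (\<lambda>x. f x * g x) = (\<lambda>x. partial_deriv k f x * g x + f x * partial_deriv k g x)" for k
    by (intro ext partial_deriv_mult differentiable_at_real_polynomial_function)
  note p = mult(1,2)[THEN real_polynomial_function_partial_deriv] mult(1,2)
  have "partial_deriv k (\<lambda>x. partial_deriv l f x * g x + f x * partial_deriv l g x) x
      = partial_deriv k (partial_deriv l f) x * g x + partial_deriv l f x * partial_deriv k g x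
      + (partial_deriv k f x * partial_deriv l g x + f x * partial_deriv k (partial_deriv l g) x)" for k l
    by (simp add: partial_deriv_add partial_deriv_mult differentiable_at_real_polynomial_function p real_polynomial_function.intros)
  then show ?case by (simp add: * mult.IH)
qed

text \<open>On the line from \<open>y\<close> to \<open>x\<close> the function is a polynomial in
  one variable with infinitely many roots near parameter 0, so all its coefficients vanish;
  parameter 1 is the point \<open>x\<close>.\<close>

lemma real_polynomial_function_zero_on_open:
  fixes f :: "real^'n::finite \<Rightarrow> real"
  assumes f: "real_polynomial_function f" and U: "open U" "y \<in> U" and 0: "\<And>x. x \<in> U \<Longrightarrow> f x = 0"
  shows "f x = 0"
proof -
  let ?l = "\<lambda>t::real. y + t *\<^sub>R (x - y)"
  have "polynomial_function ?l"
    by (intro polynomial_function_add polynomial_function_const polynomial_function_mult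
          polynomial_function_bounded_linear) (auto intro: bounded_linear_scaleR_left)
  then have "real_polynomial_function (f \<circ> ?l)"
    by (rule real_polynomial_function_compose) (rule f)
  then obtain a n where a: "f \<circ> ?l = (\<lambda>t. \<Sum>i\<le>n. a i * t ^ i)"
    using real_polynomial_function_iff_sum by blast
  have "open (?l -` U)" by (intro open_vimage U) (auto intro!: continuous_intros)
  moreover have "0 \<in> ?l -` U" using U by simp
  ultimately have "infinite (?l -` U)"
    using finite_imp_not_open by blast
  moreover have "?l -` U \<subseteq> {t. (\<Sum>i\<le>n. a i * t ^ i) = 0}"
    using 0 by (auto simp flip: fun_cong[OF a] simp: o_def)
  ultimately have "infinite {t. (\<Sum>i\<le>n. a i * t ^ i) = 0}" using infinite_super by blast
  then have "\<forall>i\<le>n. a i = 0" using polyfun_finite_roots[of a n] by blast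
  then show ?thesis using fun_cong[OF a, of 1] by simp
qed

subsection \<open>Slicing Lebesgue measure along a coordinate axis\<close>

lemma measurable_vec_lambda [measurable (raw)]:
  fixes f :: "_ \<Rightarrow> 'n::finite \<Rightarrow> real"
  assumes "\<And>i. (\<lambda>x. f x i) \<in> borel_measurable M"
  shows "(\<lambda>x. \<chi> i. f x i) \<in> borel_measurable M"
proof (subst borel_measurable_euclidean_space, rule ballI)
  fix b :: "real^'n" assume "b \<in> Basis"
  then have "\<exists>j. b = axis j 1" unfolding Basis_vec_def by auto
  then obtain j where b: "b = axis j 1" ..
  show "(\<lambda>x. (\<chi> i. f x i) \<bullet> b) \<in> borel_measurable M"
    unfolding b inner_axis using assms[of j] by (simp only: vec_lambda_beta inner_real_def mult_1_right)
qed

lemma measurable_vec_nth [measurable (raw)]: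
  fixes f :: "_ \<Rightarrow> real^'n::finite"
  assumes "f \<in> borel_measurable M"
  shows "(\<lambda>x. f x $ i) \<in> borel_measurable M"
  using assms by (rule measurable_compose) (intro borel_measurable_continuous_onI linear_continuous_on bounded_linear_vec_nth)

text \<open>\<open>hyperplane_lborel\<close> is built from a product over index functions. Writing
  \<open>lborel\<close> on vectors in the same way makes the product form of Fubini applicable; both
  measures agree on boxes.\<close>

lemma lborel_cart_eq_PiM:
  "(lborel :: (real^'n::finite) measure) = distr (Pi\<^sub>M UNIV (\<lambda>_. lborel)) borel vec_lambda"
proof (rule lborel_eqI)
  interpret product_sigma_finite "\<lambda>_::'n. lborel :: real measure" ..
  have meas [measurable]: "vec_lambda \<in> Pi\<^sub>M UNIV (\<lambda>_::'n. lborel :: real measure) \<rightarrow>\<^sub>M borel"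
    by (rule measurable_vec_lambda) (simp add: measurable_component_singleton)
  fix l u :: "real^'n" assume lu: "\<And>b. b \<in> Basis \<Longrightarrow> l \<bullet> b \<le> u \<bullet> b"
  have lu': "l $ i \<le> u $ i" for i using lu[of "axis i 1"] by (simp add: inner_axis axis_in_Basis_iff)
  have "vec_lambda -` box l u \<inter> space (Pi\<^sub>M UNIV (\<lambda>_::'n. lborel :: real measure)) = Pi\<^sub>E UNIV (\<lambda>i. {l $ i <..< u $ i})"
    by (auto simp: space_PiM mem_box_cart PiE_iff Pi_iff)
  then have "emeasure (distr (Pi\<^sub>M UNIV (\<lambda>_. lborel)) borel vec_lambda) (box l u) = (\<Prod>i\<in>UNIV. ennreal (u $ i - l $ i))"
    using lu' by (simp add: emeasure_distr emeasure_PiM)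
  also have "\<dots> = (\<Prod>b\<in>Basis. (u - l) \<bullet> b)"
  proof -
    have "Basis = range (\<lambda>i. axis i 1 :: real^'n)" by (auto simp: Basis_vec_def)
    moreover have "inj (\<lambda>i. axis i 1 :: real^'n)" by (auto simp: inj_def axis_eq_axis)
    ultimately have "(\<Prod>b\<in>Basis. (u - l) \<bullet> b) = (\<Prod>i\<in>UNIV. (u - l) \<bullet> axis i 1)"
      by (metis (mono_tags, lifting) prod.reindex_cong)
    then have "(\<Prod>b\<in>Basis. (u - l) \<bullet> b) = (\<Prod>i\<in>UNIV. u $ i - l $ i)"
      by (simp add: inner_axis)
    then show ?thesis using lu' by (simp add: prod_ennreal)
  qed
  finally show "emeasure (distr (Pi\<^sub>M UNIV (\<lambda>_. lborel)) borel vec_lambda) (box l u) = (\<Prod>b\<in>Basis. (u - l) \<bullet> b)" .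
qed simp

lemma space_hyperplane_lborel [simp]: "space (hyperplane_lborel k) = UNIV"
  and sets_hyperplane_lborel [simp, measurable_cong]: "sets (hyperplane_lborel k) = sets borel"
  by (simp_all add: hyperplane_lborel_def)

lemma measurable_hyperplane_emb [measurable]:
  "(\<lambda>u. \<chi> i. if i = k then 0 else u i) \<in> Pi\<^sub>M (UNIV - {k}) (\<lambda>_. lborel) \<rightarrow>\<^sub>M (borel :: (real^'n::finite) measure)"
proof (rule measurable_vec_lambda)
  fix i show "(\<lambda>u. if i = k then 0 else u i :: real) \<in> borel_measurable (Pi\<^sub>M (UNIV - {k}) (\<lambda>_. lborel))"
    by (cases "i = k") (simp_all add: measurable_component_singleton)
qed

text \<open>Although the measure lives on the whole space, this allows geometric facts to be checked
  only for points with \<open>y $ k = 0\<close>.\<close>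

lemma AE_hyperplane_lborel:
  fixes k :: "'n::finite"
  shows "AE y in hyperplane_lborel k. y $ k = 0"
proof -
  have "{y :: real^'n. y $ k = 0} \<in> sets borel" by measurable
  then show ?thesis
    unfolding hyperplane_lborel_def
    by (subst AE_distr_iff[OF measurable_hyperplane_emb]) simp_all
qed

text \<open>Fubini with the single index \<open>k\<close> split off from the product: updating
  coordinate \<open>k\<close> to \<open>t\<close> is the same as shifting the embedded hyperplane
  point by \<open>t\<close> along the axis.\<close>

lemma nn_integral_lborel_slice:
  fixes F :: "real^'n::finite \<Rightarrow> ennreal"
  assumes [measurable]: "F \<in> borel_measurable borel"
  shows "(\<integral>\<^sup>+x. F x \<partial>lborel) = (\<integral>\<^sup>+y. (\<integral>\<^sup>+t. F (y + t *\<^sub>R axis k 1) \<partial>lborel) \<partial>hyperplane_lborel k)"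
proof -
  interpret product_sigma_finite "\<lambda>_::'n. lborel :: real measure" ..
  have ins: "insert k (UNIV - {k}) = UNIV" by auto
  have [measurable]: "vec_lambda \<in> Pi\<^sub>M UNIV (\<lambda>_::'n. lborel :: real measure) \<rightarrow>\<^sub>M borel"
    by (rule measurable_vec_lambda) (simp add: measurable_component_singleton)
  have eq: "vec_lambda (u(k := t)) = (\<chi> i. if i = k then 0 else u i) + t *\<^sub>R axis k 1" for u t
    by (auto simp: vec_eq_iff axis_def)
  have "(\<integral>\<^sup>+x. F x \<partial>lborel) = (\<integral>\<^sup>+u. F (vec_lambda u) \<partial>Pi\<^sub>M (insert k (UNIV - {k})) (\<lambda>_. lborel))"
    by (subst lborel_cart_eq_PiM) (simp add: nn_integral_distr ins)
  also have "\<dots> = (\<integral>\<^sup>+u. (\<integral>\<^sup>+t. F (vec_lambda (u(k := t))) \<partial>lborel) \<partial>Pi\<^sub>M (UNIV - {k}) (\<lambda>_. lborel))"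
    by (rule product_nn_integral_insert) (simp_all add: ins)
  finally show ?thesis
    unfolding hyperplane_lborel_def eq by (subst nn_integral_distr[OF measurable_hyperplane_emb]) simp_all
qed

lemma integral_lborel_slice:
  fixes F :: "real^'n::finite \<Rightarrow> real"
  assumes F: "integrable lborel F"
  shows "(\<integral>x. F x \<partial>lborel) = (\<integral>y. (\<integral>t. F (y + t *\<^sub>R axis k 1) \<partial>lborel) \<partial>hyperplane_lborel k)"
proof -
  interpret product_sigma_finite "\<lambda>_::'n. lborel :: real measure" ..
  have [measurable]: "F \<in> borel_measurable borel" using F by auto
  have ins: "insert k (UNIV - {k}) = UNIV" by auto
  have [measurable]: "vec_lambda \<in> Pi\<^sub>M UNIV (\<lambda>_::'n. lborel :: real measure) \<rightarrow>\<^sub>M borel"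
    by (rule measurable_vec_lambda) (simp add: measurable_component_singleton)
  have eq: "vec_lambda (u(k := t)) = (\<chi> i. if i = k then 0 else u i) + t *\<^sub>R axis k 1" for u t
    by (auto simp: vec_eq_iff axis_def)
  have int: "integrable (Pi\<^sub>M (insert k (UNIV - {k})) (\<lambda>_. lborel)) (\<lambda>u. F (vec_lambda u))"
    using F by (subst (asm) lborel_cart_eq_PiM) (simp add: integrable_distr_eq ins)
  have "(\<integral>x. F x \<partial>lborel) = (\<integral>u. F (vec_lambda u) \<partial>Pi\<^sub>M (insert k (UNIV - {k})) (\<lambda>_. lborel))"
    by (subst lborel_cart_eq_PiM) (simp add: integral_distr ins)
  also have "\<dots> = (\<integral>u. (\<integral>t. F (vec_lambda (u(k := t))) \<partial>lborel) \<partial>Pi\<^sub>M (UNIV - {k}) (\<lambda>_. lborel))"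
    using int by (intro product_integral_insert) simp_all
  finally show ?thesis
    unfolding hyperplane_lborel_def eq by (subst integral_distr[OF measurable_hyperplane_emb]) simp_all
qed

subsection \<open>Finite sums of measures and measures determined by polynomials\<close>

text \<open>It serves two purposes: \<open>weighted_area\<close> adds one density for each cap, and
  \<open>density_weighted_area\<close> turns an identity between differences into an equality of
  sums of positive measures.\<close>

definition sum_measure :: "'i set \<Rightarrow> ('i \<Rightarrow> 'a::topological_space measure) \<Rightarrow> 'a measure" where
  "sum_measure I N = measure_of UNIV (sets borel) (\<lambda>A. \<Sum>i\<in>I. emeasure (N i) A)"

lemma sets_sum_measure [simp, measurable_cong]: "sets (sum_measure I N) = sets borel"
  by (simp add: sum_measure_def sets_measure_of_conv sets.sigma_sets_eq[of borel, simplified])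

lemma space_sum_measure [simp]: "space (sum_measure I N) = UNIV"
  by (simp add: sum_measure_def space_measure_of_conv)

lemma emeasure_sum_measure:
  fixes N :: "'i \<Rightarrow> 'a::topological_space measure"
  assumes "\<And>i. i \<in> I \<Longrightarrow> sets (N i) = sets borel" and A: "A \<in> sets borel"
  shows "emeasure (sum_measure I N) A = (\<Sum>i\<in>I. emeasure (N i) A)"
proof (rule emeasure_measure_of[OF sum_measure_def])
  show "countably_additive (sets (sum_measure I N)) (\<lambda>A. \<Sum>i\<in>I. emeasure (N i) A)"
    unfolding countably_additive_def
  proof (intro allI impI)
    fix F :: "nat \<Rightarrow> 'a set"
    assume "range F \<subseteq> sets (sum_measure I N)" "disjoint_family F"
    then have "suminf (\<lambda>n. emeasure (N i) (F n)) = emeasure (N i) (\<Union>n. F n)" if "i \<in> I" for i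
      using assms(1)[OF that] by (intro suminf_emeasure) auto
    then show "suminf (\<lambda>n. \<Sum>i\<in>I. emeasure (N i) (F n)) = (\<Sum>i\<in>I. emeasure (N i) (\<Union>n. F n))"
      by (subst suminf_sum) auto
  qed
qed (auto simp: positive_def A)

lemma nn_integral_sum_measure:
  fixes N :: "'i \<Rightarrow> 'a::topological_space measure"
  assumes N: "\<And>i. i \<in> I \<Longrightarrow> sets (N i) = sets borel" and f: "f \<in> borel_measurable borel"
  shows "(\<integral>\<^sup>+x. f x \<partial>sum_measure I N) = (\<Sum>i\<in>I. \<integral>\<^sup>+x. f x \<partial>N i)"
  using f
proof induction
  case (cong f g)
  then have "f = g" by auto
  then show ?case using cong by simp
next
  case (set A)
  then show ?case using N by (simp add: emeasure_sum_measure)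
next
  case (mult u c)
  then have "u \<in> borel_measurable (sum_measure I N)" "\<And>i. i \<in> I \<Longrightarrow> u \<in> borel_measurable (N i)"
    using N by (auto cong: measurable_cong_sets)
  then show ?case using mult by (simp add: nn_integral_cmult sum_distrib_left)
next
  case (add u v)
  then have "u \<in> borel_measurable (sum_measure I N)" "v \<in> borel_measurable (sum_measure I N)"
    "\<And>i. i \<in> I \<Longrightarrow> u \<in> borel_measurable (N i)" "\<And>i. i \<in> I \<Longrightarrow> v \<in> borel_measurable (N i)"
    using N by (auto cong: measurable_cong_sets)
  then show ?case using add by (simp add: nn_integral_add sum.distrib)
next
  case (seq U)
  have U: "U n \<in> borel_measurable (sum_measure I N)" "i \<in> I \<Longrightarrow> U n \<in> borel_measurable (N i)" for n i
    using N seq by (auto cong: measurable_cong_sets)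
  have "(\<integral>\<^sup>+x. (SUP n. U n) x \<partial>sum_measure I N) = (SUP n. \<integral>\<^sup>+x. U n x \<partial>sum_measure I N)"
    unfolding SUP_apply by (rule nn_integral_monotone_convergence_SUP) (use seq U in auto)
  also have "\<dots> = (SUP n. \<Sum>i\<in>I. \<integral>\<^sup>+x. U n x \<partial>N i)" using seq by simp
  also have "\<dots> = (\<Sum>i\<in>I. SUP n. \<integral>\<^sup>+x. U n x \<partial>N i)"
    by (rule ennreal_SUP_sum) (use seq in \<open>auto simp: incseq_def le_fun_def intro!: nn_integral_mono\<close>)
  also have "\<dots> = (\<Sum>i\<in>I. \<integral>\<^sup>+x. (SUP n. U n) x \<partial>N i)"
    unfolding SUP_apply by (intro sum.cong refl nn_integral_monotone_convergence_SUP[symmetric]) (use seq U in auto)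
  finally show ?case .
qed

lemma
  fixes N :: "'i \<Rightarrow> 'a::topological_space measure" and f :: "'a \<Rightarrow> real"
  assumes I: "finite I" and N: "\<And>i. i \<in> I \<Longrightarrow> sets (N i) = sets borel"
    and f: "\<And>i. i \<in> I \<Longrightarrow> integrable (N i) f" "f \<in> borel_measurable borel"
  shows integrable_sum_measure: "integrable (sum_measure I N) f"
    and integral_sum_measure: "(\<integral>x. f x \<partial>sum_measure I N) = (\<Sum>i\<in>I. \<integral>x. f x \<partial>N i)"
proof -
  have [measurable]: "f \<in> borel_measurable borel" by fact
  \<comment> \<open>With \<open>s\<close> equal to 1 and -1 this bounds the positive and the
    negative part, so that \<open>enn2real\<close> commutes with the sum over
    \<open>I\<close>.\<close>
  have fin: "(\<integral>\<^sup>+x. ennreal (s * f x) \<partial>N i) < top" if "\<bar>s\<bar> = 1" "i \<in> I" for s i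
  proof -
    have "(\<integral>\<^sup>+x. ennreal (s * f x) \<partial>N i) \<le> (\<integral>\<^sup>+x. ennreal (norm (f x)) \<partial>N i)"
      using that by (intro nn_integral_mono ennreal_leI) (auto simp: abs_if split: if_splits)
    also have "\<dots> < top" using f(1)[OF that(2)] by (simp add: integrable_iff_bounded)
    finally show ?thesis .
  qed
  have "f \<in> borel_measurable (sum_measure I N)" by measurable
  then show int: "integrable (sum_measure I N) f"
    using f I by (auto simp: integrable_iff_bounded nn_integral_sum_measure N)
  show "(\<integral>x. f x \<partial>sum_measure I N) = (\<Sum>i\<in>I. \<integral>x. f x \<partial>N i)"
    using f(1) int fin[of 1] fin[of "-1"]
    by (simp add: real_lebesgue_integral_def nn_integral_sum_measure N enn2real_sum sum_subtractf)
qed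

lemma integrable_compact_support:
  fixes f :: "'a::euclidean_space \<Rightarrow> real"
  assumes "finite_measure N" "sets N = sets borel" "compact K" "emeasure N (- K) = 0"
    and f: "continuous_on K f" "f \<in> borel_measurable borel"
  shows "integrable N f"
proof -
  interpret finite_measure N by fact
  have "bounded (f ` K)" using assms by (intro compact_imp_bounded compact_continuous_image)
  then obtain B where B: "\<And>x. x \<in> K \<Longrightarrow> norm (f x) \<le> B" by (auto simp: bounded_iff)
  have "- K \<in> sets N" using assms(2,3) by (simp add: compact_imp_closed open_Compl)
  then have "AE x in N. x \<in> K" using assms(4) by (intro AE_I[of _ _ "- K"]) auto
  then have "AE x in N. norm (f x) \<le> B" by eventually_elim (rule B)
  moreover have "f \<in> borel_measurable N" using f(2) measurable_cong_sets[OF assms(2) refl] by blast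
  ultimately show ?thesis by (rule integrable_const_bound)
qed

text \<open>By Stone-Weierstrass on \<open>K\<close> the two measures agree on continuous functions.
  Indicators of closed sets are bounded limits of those, and the closed sets form an
  intersection-stable generator of the Borel sets.\<close>

lemma measure_eqI_real_polynomial:
  fixes N1 N2 :: "'a::euclidean_space measure"
  assumes N1: "finite_measure N1" "sets N1 = sets borel" "emeasure N1 (- K) = 0"
    and N2: "finite_measure N2" "sets N2 = sets borel" "emeasure N2 (- K) = 0"
    and K: "compact K"
    and eq: "\<And>p. real_polynomial_function p \<Longrightarrow> (\<integral>x. p x \<partial>N1) = (\<integral>x. p x \<partial>N2)"
  shows "N1 = N2"
proof -
  have approx: "\<bar>(\<integral>x. f x \<partial>N) - (\<integral>x. p x \<partial>N)\<bar> \<le> e * measure N UNIV"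
    if N: "finite_measure N" "sets N = sets borel" "emeasure N (- K) = 0"
      and f: "continuous_on UNIV f" and p: "continuous_on UNIV p" and e: "\<And>x. x \<in> K \<Longrightarrow> \<bar>f x - p x\<bar> < e"
    for N and f p :: "'a \<Rightarrow> real" and e
  proof -
    interpret finite_measure N by fact
    have meas: "f \<in> borel_measurable borel" "p \<in> borel_measurable borel"
      using f p by (auto intro: borel_measurable_continuous_onI)
    have int: "integrable N f" "integrable N p"
      using integrable_compact_support[OF N(1,2) K N(3)] f p meas by (auto intro: continuous_on_subset)
    have "- K \<in> sets N" using N(2) K by (simp add: compact_imp_closed open_Compl)
    then have ae: "AE x in N. x \<in> K" using N(3) by (intro AE_I[of _ _ "- K"]) auto
    have "\<bar>(\<integral>x. f x \<partial>N) - (\<integral>x. p x \<partial>N)\<bar> = \<bar>\<integral>x. f x - p x \<partial>N\<bar>" using int by simp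
    also have "\<dots> \<le> (\<integral>x. \<bar>f x - p x\<bar> \<partial>N)" by (rule integral_abs_bound)
    also have "\<dots> \<le> (\<integral>x. e \<partial>N)"
      using ae int e by (intro integral_mono_AE) (auto elim!: eventually_mono intro: less_imp_le)
    finally show ?thesis using sets_eq_imp_space_eq[OF N(2)] by (simp add: mult.commute)
  qed
  have cont: "(\<integral>x. f x \<partial>N1) = (\<integral>x. f x \<partial>N2)" if f: "continuous_on UNIV f" for f :: "'a \<Rightarrow> real"
  proof -
    define m where "m = measure N1 UNIV + measure N2 UNIV"
    have m: "m \<ge> 0" by (simp add: m_def)
    have "\<bar>(\<integral>x. f x \<partial>N1) - (\<integral>x. f x \<partial>N2)\<bar> \<le> 0 + e" if e: "e > 0" for e
    proof -
      \<comment> \<open>Both masses may be zero, hence \<open>m + 1\<close> rather than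
        \<open>m\<close> in the denominator.\<close>
      have "e / (m + 1) > 0" using e m by simp
      then obtain p where p: "real_polynomial_function p" "\<And>x. x \<in> K \<Longrightarrow> \<bar>f x - p x\<bar> < e / (m + 1)"
        using Stone_Weierstrass_real_polynomial_function[OF K continuous_on_subset[OF f subset_UNIV]] by metis
      have cp: "continuous_on UNIV p"
        using p(1) by (simp add: continuous_on_polymonial_function real_polynomial_function_eq)
      have "\<bar>(\<integral>x. f x \<partial>N1) - (\<integral>x. f x \<partial>N2)\<bar> \<le> e / (m + 1) * measure N1 UNIV + e / (m + 1) * measure N2 UNIV"
        using approx[OF N1 f cp p(2)] approx[OF N2 f cp p(2)] eq[OF p(1)] by linarith
      also have "\<dots> = e / (m + 1) * m" unfolding m_def by (rule distrib_left[symmetric])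
      also have "\<dots> \<le> e" using e m by (simp add: divide_le_eq distrib_left)
      finally show ?thesis by simp
    qed
    then have "\<bar>(\<integral>x. f x \<partial>N1) - (\<integral>x. f x \<partial>N2)\<bar> \<le> 0" by (rule field_le_epsilon)
    then show ?thesis by simp
  qed
  have closed: "emeasure N1 C = emeasure N2 C" if C: "closed C" for C
  \<comment> \<open>\<open>infdist\<close> to the empty set is 0 by convention, so the functions
    \<open>h j\<close> below would then be constantly 1.\<close>
  proof (cases "C = {}")
    case False
    \<comment> \<open>Tents that are 1 on \<open>C\<close> and vanish at distance
      \<open>1 / j\<close> from it.\<close>
    define h where "h j x = max 0 (1 - real j * infdist x C)" for j x
    have h: "continuous_on UNIV (h j)" for j unfolding h_def by (intro continuous_intros)
    have lim: "(\<lambda>j. h j x) \<longlonglongrightarrow> indicator C x" for x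
    proof (cases "x \<in> C")
      case True
      then show ?thesis by (simp add: h_def)
    next
      case nC: False
      then have "infdist x C > 0"
        using C False in_closed_iff_infdist_zero[of C x] infdist_nonneg[of x C] by linarith
      then obtain k where k: "1 < real k * infdist x C"
        using reals_Archimedean3 by blast
      have "h j x = 0" if "j \<ge> k" for j
      proof -
        have "real k * infdist x C \<le> real j * infdist x C" using that infdist_nonneg[of x C] by (intro mult_right_mono) auto
        then show ?thesis using k by (simp add: h_def)
      qed
      then have "eventually (\<lambda>j. h j x = 0) sequentially" by (auto simp: eventually_sequentially)
      then show ?thesis using nC by (simp add: tendsto_eventually)
    qed
    have limN: "(\<lambda>j. \<integral>x. h j x \<partial>N) \<longlonglongrightarrow> measure N C" if N: "finite_measure N" "sets N = sets borel" for N
    proof -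
      interpret finite_measure N by fact
      have [measurable_cong]: "sets N = sets borel" by fact
      have [measurable]: "h j \<in> borel_measurable borel" for j
        using h by (rule borel_measurable_continuous_onI)
      have [measurable]: "C \<in> sets borel" using C by auto
      have "(\<lambda>j. \<integral>x. h j x \<partial>N) \<longlonglongrightarrow> (\<integral>x. indicator C x \<partial>N)"
      proof (rule integral_dominated_convergence[where w = "\<lambda>_. 1"])
        show "AE x in N. norm (h j x) \<le> 1" for j
          by (auto simp: h_def infdist_nonneg)
      qed (use lim in auto)
      then show ?thesis using sets_eq_imp_space_eq[OF N(2)] by simp
    qed
    have "measure N1 C = measure N2 C"
      using LIMSEQ_unique[OF limN[OF N1(1,2)]] limN[OF N2(1,2)] cont[OF h] by simp
    then show ?thesis
      by (simp add: finite_measure.emeasure_eq_measure N1(1) N2(1))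
  qed simp
  have gen: "sets borel = sigma_sets UNIV (Collect closed :: 'a set set)"
    by (simp add: borel_eq_closed)
  show ?thesis
  proof (rule measure_eqI_generator_eq[where E = "Collect closed" and \<Omega> = UNIV and A = "\<lambda>_. UNIV"])
    show "Int_stable (Collect closed :: 'a set set)" by (auto simp: Int_stable_def)
    show "emeasure N1 UNIV \<noteq> \<infinity>" for i :: nat
      using finite_measure.emeasure_finite[OF N1(1)] by simp
  qed (use closed N1 N2 gen in auto)
qed

subsection \<open>The caps of the ellipsoid\<close>

lemma real_polynomial_function_coord [intro, simp]: "real_polynomial_function (\<lambda>x :: real^'n::finite. x $ i)"
  by (rule real_polynomial_function.intros) (rule bounded_linear_vec_nth)

lemma real_polynomial_function_quad: "real_polynomial_function (quad (\<beta> :: real^'n::finite))"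
  unfolding quad_def[abs_def]
  by (intro real_polynomial_function_sum real_polynomial_function_power real_polynomial_function.intros(2,4)
      real_polynomial_function_coord) auto

lemma continuous_on_quad: "continuous_on A (quad (\<beta> :: real^'n::finite))"
  unfolding quad_def[abs_def] by (intro continuous_intros)

lemma partial_deriv_quad [simp]: "partial_deriv i (quad \<beta>) x = 2 * \<beta> $ i * x $ i"
proof -
  have "(quad \<beta> has_derivative (\<lambda>h. \<Sum>j\<in>UNIV. \<beta> $ j * (2 * x $ j * h $ j))) (at x)"
    unfolding quad_def[abs_def]
    by (auto intro!: derivative_eq_intros sum.cong bounded_linear_imp_has_derivative[OF bounded_linear_vec_nth])
  then show ?thesis
    by (simp add: partial_deriv_eq axis_def if_distrib cong: if_cong)
qed

lemma gradient_quad: "gradient (quad \<beta>) x = (\<chi> i. 2 * \<beta> $ i * x $ i)"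
  by (simp add: gradient_def)

lemma open_ellipsoid: "open (ellipsoid \<beta>)"
  unfolding ellipsoid_def by (intro open_Collect_less continuous_on_quad continuous_on_const)

lemma closed_ellipsoid_cl: "closed (ellipsoid_cl \<beta>)"
  unfolding ellipsoid_cl_def by (intro closed_Collect_le continuous_on_quad continuous_on_const)

lemma closed_ellipsoid_bd: "closed (ellipsoid_bd \<beta>)"
  unfolding ellipsoid_bd_def by (intro closed_Collect_eq continuous_on_quad continuous_on_const)

definition quad_except :: "real^'n::finite \<Rightarrow> 'n \<Rightarrow> real^'n \<Rightarrow> real" where
  "quad_except \<beta> k y = (\<Sum>i\<in>UNIV - {k}. \<beta> $ i * (y $ i)\<^sup>2)"

text \<open>An open cylinder rather than a disc inside the hyperplane, because
  \<open>is_surface_measure\<close> takes chart domains that are open in the whole space.\<close>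

definition cap_dom :: "real^'n::finite \<Rightarrow> 'n \<Rightarrow> (real^'n) set" where
  "cap_dom \<beta> k = {y. quad_except \<beta> k y < 1}"

definition cap_height :: "real^'n::finite \<Rightarrow> 'n \<Rightarrow> real^'n \<Rightarrow> real" where
  "cap_height \<beta> k y = sqrt ((1 - quad_except \<beta> k y) / \<beta> $ k)"

text \<open>The Lebesgue measure of the coordinate hyperplane, transported to the upper (\<open>s = 1\<close>) or
  lower (\<open>s = -1\<close>) cap; in terms of the area it is \<open>\<bar>n\<^sub>k\<bar> dA\<close>.\<close>

definition cap_measure :: "real^'n::finite \<Rightarrow> 'n \<Rightarrow> real \<Rightarrow> (real^'n) measure" where
  "cap_measure \<beta> k s =
     distr (density (hyperplane_lborel k) (indicator (cap_dom \<beta> k))) borel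
       (graph_map k (\<lambda>y. s * cap_height \<beta> k y))"

lemma quad_split: "quad \<beta> x = quad_except \<beta> k x + \<beta> $ k * (x $ k)\<^sup>2"
  unfolding quad_def quad_except_def by (subst sum.remove[of UNIV k]) auto

lemma quad_except_shift [simp]: "quad_except \<beta> k (y + t *\<^sub>R axis k 1) = quad_except \<beta> k y"
  unfolding quad_except_def by (intro sum.cong) (auto simp: axis_def)

lemma quad_shift: "y $ k = 0 \<Longrightarrow> quad \<beta> (y + t *\<^sub>R axis k 1) = quad_except \<beta> k y + \<beta> $ k * t\<^sup>2"
  by (simp add: quad_split[of \<beta> _ k])

lemma continuous_on_quad_except: "continuous_on A (quad_except \<beta> k)"
  unfolding quad_except_def[abs_def] by (intro continuous_intros)

lemma open_cap_dom: "open (cap_dom \<beta> k)"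
  unfolding cap_dom_def by (intro open_Collect_less continuous_on_quad_except continuous_on_const)

lemma borel_sets_ellipsoid [measurable]:
  "ellipsoid \<beta> \<in> sets borel" "ellipsoid_bd \<beta> \<in> sets borel" "ellipsoid_cl \<beta> \<in> sets borel" "cap_dom \<beta> k \<in> sets borel"
  by (auto intro: borel_open borel_closed open_ellipsoid closed_ellipsoid_bd closed_ellipsoid_cl open_cap_dom)

lemma measurable_quad_except [measurable]: "quad_except \<beta> k \<in> borel_measurable borel"
  by (rule borel_measurable_continuous_onI) (rule continuous_on_quad_except)

lemma measurable_cap_height [measurable]: "cap_height \<beta> k \<in> borel_measurable borel"
  unfolding cap_height_def[abs_def] by measurable

lemma measurable_graph_map [measurable (raw)]:
  "\<phi> \<in> borel_measurable borel \<Longrightarrow> graph_map k \<phi> \<in> borel_measurable borel"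
  unfolding graph_map_def[abs_def]
  by (intro borel_measurable_add borel_measurable_scaleR borel_measurable_const) auto

lemma sets_cap_measure [simp, measurable_cong]: "sets (cap_measure \<beta> k s) = sets borel"
  by (simp add: cap_measure_def)

lemma space_cap_measure [simp]: "space (cap_measure \<beta> k s) = UNIV"
  by (simp add: cap_measure_def)

lemma nn_integral_cap_measure:
  assumes [measurable]: "f \<in> borel_measurable borel"
  shows "(\<integral>\<^sup>+x. f x \<partial>cap_measure \<beta> k s) =
    (\<integral>\<^sup>+y. indicator (cap_dom \<beta> k) y * f (graph_map k (\<lambda>y. s * cap_height \<beta> k y) y) \<partial>hyperplane_lborel k)"
  unfolding cap_measure_def by (subst nn_integral_distr) (simp_all add: nn_integral_density)

lemma AE_cap_measure:
  assumes "Measurable.pred borel P"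
    and "\<And>y. y $ k = 0 \<Longrightarrow> y \<in> cap_dom \<beta> k \<Longrightarrow> P (graph_map k (\<lambda>y. s * cap_height \<beta> k y) y)"
  shows "AE x in cap_measure \<beta> k s. P x"
proof -
  have [measurable]: "Measurable.pred borel P" by fact
  have "{x \<in> space borel. P x} \<in> sets borel" by measurable
  then show ?thesis
    unfolding cap_measure_def using AE_hyperplane_lborel[of k] assms(2)
    by (subst AE_distr_iff) (auto simp: AE_density indicator_def elim!: eventually_mono)
qed

lemma graph_map_nth: "y $ k = 0 \<Longrightarrow> graph_map k \<phi> y $ k = \<phi> y"
  "i \<noteq> k \<Longrightarrow> graph_map k \<phi> y $ i = y $ i"
  by (auto simp: graph_map_def axis_def)

locale positive_weights =
  fixes \<beta> :: "real^'n::finite"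
  assumes pos: "\<And>i. \<beta> $ i > 0"
begin

lemma quad_except_nonneg: "quad_except \<beta> k y \<ge> 0"
  unfolding quad_except_def by (intro sum_nonneg mult_nonneg_nonneg) (auto intro: less_imp_le pos)

text \<open>Every single term of the form is at most 1, so the square of a coordinate is at most
  \<open>1 / \<beta> $ i\<close>; the side \<open>1 + 1 / \<beta> $ i\<close> dominates the root
  without mentioning it.\<close>

lemma bounded_ellipsoid_cl: "bounded (ellipsoid_cl \<beta>)"
proof (rule bounded_subset)
  show "bounded (cbox (- (\<chi> i. 1 + 1 / \<beta> $ i)) (\<chi> i. 1 + 1 / \<beta> $ i))" by (rule bounded_cbox)
  show "ellipsoid_cl \<beta> \<subseteq> cbox (- (\<chi> i. 1 + 1 / \<beta> $ i)) (\<chi> i. 1 + 1 / \<beta> $ i)"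
  proof
    fix x assume "x \<in> ellipsoid_cl \<beta>"
    have "\<bar>x $ i\<bar> \<le> 1 + 1 / \<beta> $ i" for i
    proof -
      have "\<beta> $ i * (x $ i)\<^sup>2 \<le> 1"
        using \<open>x \<in> ellipsoid_cl \<beta>\<close> quad_split[of \<beta> x i] quad_except_nonneg[of i x] by (simp add: ellipsoid_cl_def)
      then have "\<bar>x $ i\<bar>\<^sup>2 \<le> 1 / \<beta> $ i" using pos[of i] by (simp add: field_simps)
      also have "\<dots> \<le> (1 + 1 / \<beta> $ i)\<^sup>2" using pos[of i] by (simp add: power2_eq_square field_simps)
      finally show ?thesis using pos[of i] by (intro power2_le_imp_le[of "\<bar>x $ i\<bar>"]) (simp_all add: less_imp_le)
    qed
    then have "- (1 + 1 / \<beta> $ i) \<le> x $ i \<and> x $ i \<le> 1 + 1 / \<beta> $ i" for i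
      by (metis abs_le_D1 abs_le_D2 minus_le_iff)
    then show "x \<in> cbox (- (\<chi> i. 1 + 1 / \<beta> $ i)) (\<chi> i. 1 + 1 / \<beta> $ i)"
      by (simp add: mem_box_cart)
  qed
qed

lemma compact_ellipsoid_cl: "compact (ellipsoid_cl \<beta>)"
  using bounded_ellipsoid_cl closed_ellipsoid_cl by (simp add: compact_eq_bounded_closed)

lemma ellipsoid_subset_cl: "ellipsoid \<beta> \<subseteq> ellipsoid_cl \<beta>" "ellipsoid_bd \<beta> \<subseteq> ellipsoid_cl \<beta>"
  by (auto simp: ellipsoid_def ellipsoid_bd_def ellipsoid_cl_def)

lemma compact_ellipsoid_bd: "compact (ellipsoid_bd \<beta>)"
  using bounded_subset[OF bounded_ellipsoid_cl ellipsoid_subset_cl(2)] closed_ellipsoid_bd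
  by (simp add: compact_eq_bounded_closed)

lemma zero_in_ellipsoid: "0 \<in> ellipsoid \<beta>"
  by (simp add: ellipsoid_def quad_def)

lemma cap_height_pos: "y \<in> cap_dom \<beta> k \<Longrightarrow> cap_height \<beta> k y > 0"
  using pos[of k] by (simp add: cap_dom_def cap_height_def)

lemma cap_height_sq: "y \<in> cap_dom \<beta> k \<Longrightarrow> \<beta> $ k * (cap_height \<beta> k y)\<^sup>2 = 1 - quad_except \<beta> k y"
  using pos[of k] by (simp add: cap_dom_def cap_height_def)

lemma graph_map_cap_in_bd:
  assumes "y $ k = 0" "y \<in> cap_dom \<beta> k" "\<bar>s\<bar> = 1"
  shows "graph_map k (\<lambda>y. s * cap_height \<beta> k y) y \<in> ellipsoid_bd \<beta>"
proof -
  have "s\<^sup>2 = 1" using assms(3) by (metis abs_power2 one_power2 power2_abs)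
  then show ?thesis
    using cap_height_sq[OF assms(2)]
    by (simp add: graph_map_def ellipsoid_bd_def quad_shift assms(1) power_mult_distrib)
qed

text \<open>Thickening by the unit interval in direction \<open>k\<close> turns the hyperplane
  measure into the Lebesgue measure of the bounded set \<open>?C\<close>.\<close>

lemma finite_cap_dom: "emeasure (hyperplane_lborel k) (cap_dom \<beta> k) < \<infinity>"
proof -
  let ?C = "{x. x \<in> cap_dom \<beta> k \<and> x $ k \<in> {0..1}}"
  obtain B where B: "\<And>x. x \<in> ellipsoid_cl \<beta> \<Longrightarrow> norm x \<le> B"
    using bounded_ellipsoid_cl by (auto simp: bounded_iff)
  have "bounded ?C"
  proof (rule boundedI)
    fix x assume x: "x \<in> ?C"
    \<comment> \<open>The projection to the hyperplane lies in the closed ellipsoid, because there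
      the form reduces to \<open>quad_except\<close>.\<close>
    let ?z = "x + (- (x $ k)) *\<^sub>R axis k 1"
    have "quad \<beta> ?z = quad_except \<beta> k x"
      by (subst quad_split[of _ _ k], subst quad_except_shift) (simp add: axis_def)
    then have "?z \<in> ellipsoid_cl \<beta>" using x by (simp add: ellipsoid_cl_def cap_dom_def)
    then have "norm ?z \<le> B" by (rule B)
    moreover have "norm x \<le> norm ?z + norm (x $ k *\<^sub>R axis k (1::real))"
      using norm_triangle_ineq[of ?z "x $ k *\<^sub>R axis k (1::real)"] by simp
    moreover have "norm (x $ k *\<^sub>R axis k (1::real)) \<le> 1" using x by simp
    ultimately show "norm x \<le> B + 1" by linarith
  qed
  then have "emeasure lborel ?C < \<infinity>" by (rule emeasure_bounded_finite)
  also have "emeasure lborel ?C = (\<integral>\<^sup>+x. indicator ?C x \<partial>lborel)"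
    by (subst nn_integral_indicator) auto
  also have "\<dots> = (\<integral>\<^sup>+y. (\<integral>\<^sup>+t. indicator ?C (y + t *\<^sub>R axis k 1) \<partial>lborel) \<partial>hyperplane_lborel k)"
    by (rule nn_integral_lborel_slice) measurable
  also have "\<dots> = (\<integral>\<^sup>+y. indicator (cap_dom \<beta> k) y \<partial>hyperplane_lborel k)"
  proof (rule nn_integral_cong_AE, use AE_hyperplane_lborel[of k] in eventually_elim)
    case (elim y)
    have "(\<integral>\<^sup>+t. indicator ?C (y + t *\<^sub>R axis k 1) \<partial>lborel)
        = (\<integral>\<^sup>+t. indicator (cap_dom \<beta> k) y * indicator {0..1::real} t \<partial>lborel)"
      using elim axis_nth[of k "1::real"] by (intro nn_integral_cong) (auto simp: indicator_def cap_dom_def)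
    then show ?case by (simp add: nn_integral_cmult)
  qed
  also have "\<dots> = emeasure (hyperplane_lborel k) (cap_dom \<beta> k)" by simp
  finally show ?thesis .
qed

lemma finite_measure_cap_measure: "finite_measure (cap_measure \<beta> k s)"
proof
  have "emeasure (cap_measure \<beta> k s) UNIV = (\<integral>\<^sup>+x. 1 \<partial>cap_measure \<beta> k s)" by simp
  also have "\<dots> = emeasure (hyperplane_lborel k) (cap_dom \<beta> k)"
    by (subst nn_integral_cap_measure) simp_all
  finally show "emeasure (cap_measure \<beta> k s) (space (cap_measure \<beta> k s)) \<noteq> \<infinity>"
    using finite_cap_dom[of k] by simp
qed

text \<open>The sign condition keeps the two caps of a direction apart, so restricting to an open
  half-space isolates one of them.\<close>

lemma AE_cap_measure_bd:
  assumes "\<bar>s\<bar> = 1"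
  shows "AE x in cap_measure \<beta> k s. x \<in> ellipsoid_bd \<beta> \<and> s * x $ k > 0"
proof (rule AE_cap_measure)
  fix y :: "real^'n" assume y: "y $ k = 0" "y \<in> cap_dom \<beta> k"
  have "s * s = 1" using assms by (metis abs_mult_self_eq mult_1)
  then have "s * graph_map k (\<lambda>y. s * cap_height \<beta> k y) y $ k = cap_height \<beta> k y"
    using y by (simp add: graph_map_nth flip: mult.assoc)
  then show "graph_map k (\<lambda>y. s * cap_height \<beta> k y) y \<in> ellipsoid_bd \<beta> \<and>
      s * graph_map k (\<lambda>y. s * cap_height \<beta> k y) y $ k > 0"
    using graph_map_cap_in_bd[OF y assms] cap_height_pos[OF y(2)] by simp
qed measurable

lemma null_cap_measure:
  assumes "\<bar>s\<bar> = 1"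
  shows "emeasure (cap_measure \<beta> k s) (- ellipsoid_bd \<beta>) = 0"
proof -
  have "AE x in cap_measure \<beta> k s. x \<in> ellipsoid_bd \<beta>"
    using AE_cap_measure_bd[OF assms] by eventually_elim simp
  then show ?thesis by (subst (asm) AE_iff_measurable[OF _ refl]) (auto simp: Compl_eq)
qed

lemma integrable_cap_measure:
  fixes f :: "real^'n \<Rightarrow> real"
  assumes "\<bar>s\<bar> = 1" "continuous_on (ellipsoid_bd \<beta>) f" "f \<in> borel_measurable borel"
  shows "integrable (cap_measure \<beta> k s) f"
  using integrable_compact_support[OF finite_measure_cap_measure sets_cap_measure compact_ellipsoid_bd null_cap_measure] assms
  by blast

lemma integrable_solid:
  assumes "continuous_on (ellipsoid_cl \<beta>) f"
  shows "integrable lborel (\<lambda>x. indicator (ellipsoid \<beta>) x * f x :: real)"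
proof -
  have "integrable lborel (\<lambda>x. indicator (ellipsoid_cl \<beta>) x *\<^sub>R f x)"
    by (intro borel_integrable_compact compact_ellipsoid_cl assms)
  then have "integrable lborel (\<lambda>x. indicator (ellipsoid \<beta>) x *\<^sub>R (indicator (ellipsoid_cl \<beta>) x *\<^sub>R f x))"
    by (rule integrable_mult_indicator[rotated]) simp
  moreover have "indicator (ellipsoid \<beta>) x *\<^sub>R (indicator (ellipsoid_cl \<beta>) x *\<^sub>R f x) = indicator (ellipsoid \<beta>) x * f x" for x
    using ellipsoid_subset_cl(1) by (auto simp: indicator_def)
  ultimately show ?thesis by (simp only:)
qed

text \<open>On each chord in direction \<open>k\<close> this is the fundamental theorem of calculus.
  Since \<open>F\<close> is controlled only on \<open>U\<close>, the indicator of the boundary is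
  what makes the integrand a Borel function on the whole space.\<close>

lemma integral_cap_measure_diff:
  fixes F :: "real^'n \<Rightarrow> real"
  assumes U: "open U" "ellipsoid_cl \<beta> \<subseteq> U"
    and F: "F differentiable_on U" "continuous_on U (partial_deriv k F)"
  shows "(\<integral>x. indicator (ellipsoid_bd \<beta>) x * F x \<partial>cap_measure \<beta> k 1)
       - (\<integral>x. indicator (ellipsoid_bd \<beta>) x * F x \<partial>cap_measure \<beta> k (-1))
       = (\<integral>x. indicator (ellipsoid \<beta>) x * partial_deriv k F x \<partial>lborel)"
proof -
  let ?G = "\<lambda>x. indicator (ellipsoid_bd \<beta>) x * F x"
  let ?g = "\<lambda>s. graph_map k (\<lambda>y. s * cap_height \<beta> k y)"
  let ?D = "\<lambda>x. indicator (ellipsoid \<beta>) x * partial_deriv k F x"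
  have contF: "continuous_on U F" using F(1) by (rule differentiable_imp_continuous_on)
  have "continuous_on (ellipsoid_bd \<beta>) F" using contF U(2) ellipsoid_subset_cl by (blast intro: continuous_on_subset)
  then have G [measurable]: "?G \<in> borel_measurable borel" and contG: "continuous_on (ellipsoid_bd \<beta>) ?G"
    using borel_measurable_continuous_on_indicator[of "ellipsoid_bd \<beta>" F]
    by (auto intro: continuous_on_cong[THEN iffD1, OF refl])
  have cap: "(\<integral>x. ?G x \<partial>cap_measure \<beta> k s) = (\<integral>y. indicator (cap_dom \<beta> k) y * ?G (?g s y) \<partial>hyperplane_lborel k)"
    and cap_int: "integrable (hyperplane_lborel k) (\<lambda>y. indicator (cap_dom \<beta> k) y * ?G (?g s y))"
    if s: "\<bar>s\<bar> = 1" for s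
  proof -
    have dens: "density (hyperplane_lborel k) (indicator (cap_dom \<beta> k))
      = density (hyperplane_lborel k) (\<lambda>y. ennreal (indicator (cap_dom \<beta> k) y))"
      by (simp add: ennreal_indicator)
    show "(\<integral>x. ?G x \<partial>cap_measure \<beta> k s) = (\<integral>y. indicator (cap_dom \<beta> k) y * ?G (?g s y) \<partial>hyperplane_lborel k)"
      unfolding cap_measure_def dens
      by (subst integral_distr) (simp_all add: integral_density)
    have "integrable (cap_measure \<beta> k s) ?G"
      by (rule integrable_cap_measure[OF s contG G])
    then show "integrable (hyperplane_lborel k) (\<lambda>y. indicator (cap_dom \<beta> k) y * ?G (?g s y))"
      unfolding cap_measure_def dens
      by (subst (asm) integrable_distr_eq) (simp_all add: integrable_density)
  qed
  have intD: "integrable lborel ?D"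
    using F(2) U(2) by (intro integrable_solid) (rule continuous_on_subset)
  have inner: "(\<integral>t. ?D (y + t *\<^sub>R axis k 1) \<partial>lborel)
      = indicator (cap_dom \<beta> k) y * ?G (?g 1 y) - indicator (cap_dom \<beta> k) y * ?G (?g (-1) y)"
    if y: "y $ k = 0" for y
  proof (cases "y \<in> cap_dom \<beta> k")
    case False
    then have "quad_except \<beta> k y + \<beta> $ k * t\<^sup>2 \<ge> 1" for t
      using pos[of k] by (simp add: cap_dom_def add_increasing2 less_imp_le)
    then have "y + t *\<^sub>R axis k 1 \<notin> ellipsoid \<beta>" for t
      using y by (simp add: ellipsoid_def quad_shift not_less)
    then show ?thesis using False by simp
  next
    case True
    define r where "r = cap_height \<beta> k y"
    have r: "r > 0" using cap_height_pos[OF True] by (simp add: r_def)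
    \<comment> \<open>Seen along the line, the ellipsoid is the interval of half-length
      \<open>r\<close>, the cap height.\<close>
    have q: "quad \<beta> (y + t *\<^sub>R axis k 1) = 1 - \<beta> $ k * (r\<^sup>2 - t\<^sup>2)" for t
      using cap_height_sq[OF True] by (simp add: quad_shift[OF y] r_def algebra_simps)
    have memE: "y + t *\<^sub>R axis k 1 \<in> ellipsoid \<beta> \<longleftrightarrow> t \<in> {- r <..< r}" for t
    proof -
      have "y + t *\<^sub>R axis k 1 \<in> ellipsoid \<beta> \<longleftrightarrow> t\<^sup>2 < r\<^sup>2"
        using pos[of k] by (simp add: ellipsoid_def q zero_less_mult_iff)
      also have "\<dots> \<longleftrightarrow> \<bar>t\<bar> < r" using r abs_le_square_iff[of r t] by (simp flip: not_le)
      finally show ?thesis by auto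
    qed
    have memcl: "y + t *\<^sub>R axis k 1 \<in> U" if "- r \<le> t" "t \<le> r" for t
    proof -
      have "t\<^sup>2 \<le> r\<^sup>2" using that r by (simp add: abs_le_square_iff[symmetric])
      then show ?thesis using pos[of k] U(2) by (intro subsetD[OF U(2)]) (simp add: ellipsoid_cl_def q)
    qed
    \<comment> \<open>The open chord is replaced by the closed interval of the fundamental theorem;
      the two endpoints are null.\<close>
    have "(\<integral>t. ?D (y + t *\<^sub>R axis k 1) \<partial>lborel)
        = (\<integral>t. partial_deriv k F (y + t *\<^sub>R axis k 1) * indicator {- r .. r} t \<partial>lborel)"
    proof (rule integral_cong_AE)
      show "(\<lambda>t. ?D (y + t *\<^sub>R axis k 1)) \<in> borel_measurable lborel"
        using borel_measurable_integrable[OF intD] by measurable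
      have "continuous_on {- r .. r} (\<lambda>t. partial_deriv k F (y + t *\<^sub>R axis k 1))"
        using memcl by (intro continuous_on_compose2[OF F(2), of _ "\<lambda>t. y + t *\<^sub>R axis k 1"]) (auto intro!: continuous_intros)
      then have "(\<lambda>t. indicator {- r .. r} t *\<^sub>R partial_deriv k F (y + t *\<^sub>R axis k 1)) \<in> borel_measurable borel"
        by (intro borel_measurable_continuous_on_indicator) auto
      then show "(\<lambda>t. partial_deriv k F (y + t *\<^sub>R axis k 1) * indicator {- r .. r} t) \<in> borel_measurable lborel"
        by (simp add: mult.commute)
      have "AE t in lborel. t \<noteq> r \<and> t \<noteq> - r"
        using AE_lborel_singleton[of r] AE_lborel_singleton[of "- r"] by eventually_elim auto
      then show "AE t in lborel. ?D (y + t *\<^sub>R axis k 1) = partial_deriv k F (y + t *\<^sub>R axis k 1) * indicator {- r .. r} t"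
        by eventually_elim (auto simp: indicator_def memE)
    qed
    also have "\<dots> = F (y + r *\<^sub>R axis k 1) - F (y + (- r) *\<^sub>R axis k 1)"
    proof (rule integral_FTC_Icc_real[where F = "\<lambda>t. F (y + t *\<^sub>R axis k 1)"])
      fix t assume t: "- r \<le> t" "t \<le> r"
      have "F differentiable (at (y + t *\<^sub>R axis k 1))"
        using F(1) U(1) memcl[OF t] by (metis differentiable_on_def at_within_open)
      then show "((\<lambda>t. F (y + t *\<^sub>R axis k 1)) has_real_derivative partial_deriv k F (y + t *\<^sub>R axis k 1)) (at t)"
        by (rule DERIV_partial_deriv)
      have "isCont (partial_deriv k F) (y + t *\<^sub>R axis k 1)"
        using F(2) U(1) memcl[OF t] by (simp add: continuous_on_eq_continuous_at)
      then show "isCont (\<lambda>t. partial_deriv k F (y + t *\<^sub>R axis k 1)) t"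
        by (rule isCont_o2[of t "\<lambda>t. y + t *\<^sub>R axis k 1", rotated]) (auto intro!: continuous_intros)
    qed (use r in simp)
    also have "\<dots> = ?G (?g 1 y) - ?G (?g (-1) y)"
      using graph_map_cap_in_bd[OF y True, of 1] graph_map_cap_in_bd[OF y True, of "-1"]
      by (simp add: graph_map_def r_def)
    finally show ?thesis using True by simp
  qed
  have "(\<integral>x. ?D x \<partial>lborel) = (\<integral>y. (\<integral>t. ?D (y + t *\<^sub>R axis k 1) \<partial>lborel) \<partial>hyperplane_lborel k)"
    by (rule integral_lborel_slice) (rule intD)
  also have "\<dots> = (\<integral>y. indicator (cap_dom \<beta> k) y * ?G (?g 1 y) - indicator (cap_dom \<beta> k) y * ?G (?g (-1) y) \<partial>hyperplane_lborel k)"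
  proof (rule integral_cong_AE)
    show "AE y in hyperplane_lborel k. (\<integral>t. ?D (y + t *\<^sub>R axis k 1) \<partial>lborel) =
        indicator (cap_dom \<beta> k) y * ?G (?g 1 y) - indicator (cap_dom \<beta> k) y * ?G (?g (-1) y)"
      using AE_hyperplane_lborel[of k] by eventually_elim (rule inner)
    have [measurable]: "?D \<in> borel_measurable borel" using borel_measurable_integrable[OF intD] by simp
    show "(\<lambda>y. \<integral>t. ?D (y + t *\<^sub>R axis k 1) \<partial>lborel) \<in> borel_measurable (hyperplane_lborel k)"
      by measurable
    show "(\<lambda>y. indicator (cap_dom \<beta> k) y * ?G (?g 1 y) - indicator (cap_dom \<beta> k) y * ?G (?g (-1) y)) \<in> borel_measurable (hyperplane_lborel k)"
      by measurable
  qed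
  also have "\<dots> = (\<integral>x. ?G x \<partial>cap_measure \<beta> k 1) - (\<integral>x. ?G x \<partial>cap_measure \<beta> k (-1))"
    using cap_int[of 1] cap_int[of "-1"] by (simp add: cap)
  finally show ?thesis by simp
qed

end

subsection \<open>Area weighted by the inverse gradient norm\<close>

context positive_weights
begin

definition solid_int :: "(real^'n \<Rightarrow> real) \<Rightarrow> real" where
  "solid_int p = (\<integral>x. indicator (ellipsoid \<beta>) x * p x \<partial>lborel)"

text \<open>Classically the integral of \<open>F\<close> times the k-th component of the outward
  normal over the boundary; in terms of the caps it makes sense before any area measure is
  available.\<close>

definition flux :: "'n \<Rightarrow> (real^'n \<Rightarrow> real) \<Rightarrow> real" where
  "flux k F = (\<integral>x. indicator (ellipsoid_bd \<beta>) x * F x \<partial>cap_measure \<beta> k 1)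
            - (\<integral>x. indicator (ellipsoid_bd \<beta>) x * F x \<partial>cap_measure \<beta> k (-1))"

text \<open>This is half the sum over \<open>k\<close> of x_k n_k dA, which equals dA / |\<nabla>q|
  because x . n = 2 / |\<nabla>q| on the boundary. On the cap of sign \<open>s\<close> the measure
  n_k dA is \<open>s\<close> times the cap measure, and \<open>s * x $ k\<close> is positive there,
  so all summands are positive measures.\<close>

definition weighted_area :: "(real^'n) measure" where
  "weighted_area = sum_measure (UNIV \<times> {1, -1})
     (\<lambda>(k, s). density (cap_measure \<beta> k s) (\<lambda>x. ennreal (s * x $ k / 2)))"

text \<open>The way in which the relation q = 1 enters: inside \<open>flux\<close> polynomials may
  be changed by multiples of q - 1.\<close>

lemma flux_cong: "(\<And>x. x \<in> ellipsoid_bd \<beta> \<Longrightarrow> F x = G x) \<Longrightarrow> flux k F = flux k G"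
  unfolding flux_def by (intro arg_cong2[where f = minus] Bochner_Integration.integral_cong) (auto simp: indicator_def)

lemma flux_eq_solid_int:
  assumes "real_polynomial_function p"
  shows "flux k p = solid_int (partial_deriv k p)"
  unfolding flux_def solid_int_def
  by (rule integral_cap_measure_diff[of UNIV])
    (auto intro!: continuous_on_real_polynomial_function real_polynomial_function_partial_deriv assms differentiable_at_imp_differentiable_on differentiable_at_real_polynomial_function)

lemma flux_0 [simp]: "flux k (\<lambda>x. 0) = 0"
  by (simp add: flux_def)

lemma integral_cap_indicator:
  fixes f :: "real^'n \<Rightarrow> real"
  assumes "\<bar>s\<bar> = 1" "f \<in> borel_measurable borel"
  shows "(\<integral>x. indicator (ellipsoid_bd \<beta>) x * f x \<partial>cap_measure \<beta> k s) = (\<integral>x. f x \<partial>cap_measure \<beta> k s)"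
proof (rule integral_cong_AE)
  have [measurable]: "f \<in> borel_measurable borel" by fact
  show "(\<lambda>x. indicator (ellipsoid_bd \<beta>) x * f x) \<in> borel_measurable (cap_measure \<beta> k s)"
    "f \<in> borel_measurable (cap_measure \<beta> k s)" by measurable
  show "AE x in cap_measure \<beta> k s. indicator (ellipsoid_bd \<beta>) x * f x = f x"
    using AE_cap_measure_bd[OF assms(1), of k] by eventually_elim simp
qed

lemma flux_sum:
  assumes "\<And>i. i \<in> I \<Longrightarrow> real_polynomial_function (F i)"
  shows "flux k (\<lambda>x. \<Sum>i\<in>I. F i x) = (\<Sum>i\<in>I. flux k (F i))"
proof -
  have "(\<integral>x. indicator (ellipsoid_bd \<beta>) x * (\<Sum>i\<in>I. F i x) \<partial>cap_measure \<beta> k s)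
     = (\<Sum>i\<in>I. \<integral>x. indicator (ellipsoid_bd \<beta>) x * F i x \<partial>cap_measure \<beta> k s)" if s: "\<bar>s\<bar> = 1" for s
  proof -
    have p: "real_polynomial_function (\<lambda>x. \<Sum>i\<in>I. F i x)"
      by (cases "finite I") (auto intro: real_polynomial_function_sum assms)
    have "(\<integral>x. indicator (ellipsoid_bd \<beta>) x * (\<Sum>i\<in>I. F i x) \<partial>cap_measure \<beta> k s)
        = (\<integral>x. (\<Sum>i\<in>I. F i x) \<partial>cap_measure \<beta> k s)"
      by (rule integral_cap_indicator[OF s borel_measurable_real_polynomial_function[OF p]])
    also have "\<dots> = (\<Sum>i\<in>I. \<integral>x. F i x \<partial>cap_measure \<beta> k s)"
      using assms by (intro Bochner_Integration.integral_sum integrable_cap_measure[OF s] continuous_on_real_polynomial_function borel_measurable_real_polynomial_function)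
    also have "\<dots> = (\<Sum>i\<in>I. \<integral>x. indicator (ellipsoid_bd \<beta>) x * F i x \<partial>cap_measure \<beta> k s)"
      using assms by (intro sum.cong refl integral_cap_indicator[OF s, symmetric] borel_measurable_real_polynomial_function)
    finally show ?thesis .
  qed
  from this[of 1] this[of "-1"] show ?thesis by (simp add: flux_def sum_subtractf)
qed

text \<open>By the symmetry of second derivatives, \<open>\<partial>\<^sub>k (\<beta>\<^sub>j x\<^sub>j v) - \<partial>\<^sub>j (\<beta>\<^sub>k x\<^sub>k v)\<close> is half of
  \<open>\<partial>\<^sub>k ((1 - q) \<partial>\<^sub>j v) - \<partial>\<^sub>j ((1 - q) \<partial>\<^sub>k v)\<close>, whose integral is zero because \<open>1 - q\<close> vanishes on the boundary.\<close>

lemma flux_swap: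
  assumes v: "real_polynomial_function v"
  shows "flux k (\<lambda>x. \<beta> $ j * x $ j * v x) = flux j (\<lambda>x. \<beta> $ k * x $ k * v x)"
proof (cases "j = k")
  case False
  note pp = real_polynomial_function_partial_deriv
  have q: "real_polynomial_function (\<lambda>x. 1 - quad \<beta> x)"
    by (intro real_polynomial_function_diff real_polynomial_function_quad real_polynomial_function.intros(2))
  have m: "real_polynomial_function (\<lambda>x. \<beta> $ i * x $ i * v x)" for i
    by (intro real_polynomial_function.intros(2,4) real_polynomial_function_coord v)
  have z: "real_polynomial_function (\<lambda>x. (1 - quad \<beta> x) * partial_deriv i v x)" for i
    by (intro real_polynomial_function.intros(4) q pp v)
  have d1: "partial_deriv a (\<lambda>x. \<beta> $ b * x $ b * v x) x = \<beta> $ b * x $ b * partial_deriv a v x" if "a \<noteq> b" for a b x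
  proof -
    have "partial_deriv a (\<lambda>x. \<beta> $ b * x $ b * v x) x = partial_deriv a (\<lambda>x. \<beta> $ b * x $ b) x * v x + \<beta> $ b * x $ b * partial_deriv a v x"
      by (intro partial_deriv_mult differentiable_at_real_polynomial_function v real_polynomial_function.intros(2,4) real_polynomial_function_coord)
    moreover have "partial_deriv a (\<lambda>x. \<beta> $ b * x $ b) x = 0"
      using that by (subst partial_deriv_cmult) (auto intro!: differentiable_at_real_polynomial_function)
    ultimately show ?thesis by simp
  qed
  have d2: "partial_deriv a (\<lambda>x. (1 - quad \<beta> x) * partial_deriv b v x) x
      = - 2 * \<beta> $ a * x $ a * partial_deriv b v x + (1 - quad \<beta> x) * partial_deriv a (partial_deriv b v) x" for a b x
  proof -
    have "partial_deriv a (\<lambda>x. 1 - quad \<beta> x) x = - 2 * \<beta> $ a * x $ a"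
      by (subst partial_deriv_diff) (auto intro!: differentiable_at_real_polynomial_function real_polynomial_function_quad)
    then show ?thesis
      by (subst partial_deriv_mult) (auto intro!: differentiable_at_real_polynomial_function q pp v)
  qed
  have zero: "flux a (\<lambda>x. (1 - quad \<beta> x) * partial_deriv b v x) = 0" for a b
    using flux_cong[of "\<lambda>x. (1 - quad \<beta> x) * partial_deriv b v x" "\<lambda>x. 0" a] by (simp add: ellipsoid_bd_def)
  have int: "integrable lborel (\<lambda>x. indicator (ellipsoid \<beta>) x * p x)" if "real_polynomial_function p" for p
    by (intro integrable_solid continuous_on_real_polynomial_function that)
  let ?A = "\<lambda>x. partial_deriv k (\<lambda>x. \<beta> $ j * x $ j * v x) x" and ?B = "\<lambda>x. partial_deriv j (\<lambda>x. \<beta> $ k * x $ k * v x) x"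
  let ?C = "\<lambda>x. partial_deriv k (\<lambda>x. (1 - quad \<beta> x) * partial_deriv j v x) x"
  let ?D = "\<lambda>x. partial_deriv j (\<lambda>x. (1 - quad \<beta> x) * partial_deriv k v x) x"
  have pw: "?A x - ?B x = (?C x - ?D x) / 2" for x
    unfolding d1[OF False] d1[OF False[symmetric]] d2 partial_deriv_commute[OF v, of k j]
    by (simp add: algebra_simps)
  have "solid_int ?A - solid_int ?B = (\<integral>x. indicator (ellipsoid \<beta>) x * ?A x - indicator (ellipsoid \<beta>) x * ?B x \<partial>lborel)"
    unfolding solid_int_def by (intro Bochner_Integration.integral_diff[symmetric] int pp m)
  also have "\<dots> = (\<integral>x. (indicator (ellipsoid \<beta>) x * ?C x - indicator (ellipsoid \<beta>) x * ?D x) / 2 \<partial>lborel)"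
    using pw by (intro Bochner_Integration.integral_cong refl) (simp flip: right_diff_distrib times_divide_eq_right)
  also have "\<dots> = (solid_int ?C - solid_int ?D) / 2"
    unfolding solid_int_def
    by (subst integral_divide_zero, subst Bochner_Integration.integral_diff) (intro int pp z refl)+
  also have "\<dots> = 0"
    using zero[of k j] zero[of j k] by (simp flip: flux_eq_solid_int[OF z])
  finally show ?thesis by (simp flip: flux_eq_solid_int[OF m])
qed simp

lemma sets_weighted_area [simp, measurable_cong]: "sets weighted_area = sets borel"
  and space_weighted_area [simp]: "space weighted_area = UNIV"
  by (simp_all add: weighted_area_def)

text \<open>The factor \<open>s\<close> in the density supplies the minus sign that the lower cap
  carries in \<open>flux\<close>.\<close>

lemma
  assumes f: "continuous_on (ellipsoid_bd \<beta>) f" and fm: "f \<in> borel_measurable borel"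
  shows integrable_weighted_area: "integrable weighted_area f"
    and integral_weighted_area: "(\<integral>x. f x \<partial>weighted_area) = (\<Sum>k\<in>UNIV. flux k (\<lambda>x. x $ k / 2 * f x))"
proof -
  have [measurable]: "f \<in> borel_measurable borel" by fact
  have nn: "AE x in cap_measure \<beta> k s. 0 \<le> s * x $ k / 2" if "\<bar>s\<bar> = 1" for k s
    using AE_cap_measure_bd[OF that, of k] by eventually_elim simp
  have m [measurable]: "(\<lambda>x :: real^'n. s * x $ k / 2) \<in> borel_measurable borel" for k s by measurable
  have int: "integrable (density (cap_measure \<beta> k s) (\<lambda>x. ennreal (s * x $ k / 2))) f"
    and eq: "(\<integral>x. f x \<partial>density (cap_measure \<beta> k s) (\<lambda>x. ennreal (s * x $ k / 2)))
      = s * (\<integral>x. indicator (ellipsoid_bd \<beta>) x * (x $ k / 2 * f x) \<partial>cap_measure \<beta> k s)"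
    if s: "\<bar>s\<bar> = 1" for k s
  proof -
    have "integrable (cap_measure \<beta> k s) (\<lambda>x. s * x $ k / 2 * f x)"
      by (intro integrable_cap_measure[OF s]) (auto intro!: continuous_intros f)
    then show "integrable (density (cap_measure \<beta> k s) (\<lambda>x. ennreal (s * x $ k / 2))) f"
      using nn[OF s] by (subst integrable_density) simp_all
    have "(\<integral>x. f x \<partial>density (cap_measure \<beta> k s) (\<lambda>x. ennreal (s * x $ k / 2)))
        = (\<integral>x. s * (x $ k / 2 * f x) \<partial>cap_measure \<beta> k s)"
      using nn[OF s] by (subst integral_density) (simp_all add: mult.assoc)
    also have "\<dots> = s * (\<integral>x. x $ k / 2 * f x \<partial>cap_measure \<beta> k s)" by (rule integral_mult_right_zero)
    also have "(\<integral>x. x $ k / 2 * f x \<partial>cap_measure \<beta> k s) = (\<integral>x. indicator (ellipsoid_bd \<beta>) x * (x $ k / 2 * f x) \<partial>cap_measure \<beta> k s)"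
      by (rule integral_cap_indicator[OF s, symmetric]) measurable
    finally show "(\<integral>x. f x \<partial>density (cap_measure \<beta> k s) (\<lambda>x. ennreal (s * x $ k / 2)))
      = s * (\<integral>x. indicator (ellipsoid_bd \<beta>) x * (x $ k / 2 * f x) \<partial>cap_measure \<beta> k s)" .
  qed
  show "integrable weighted_area f"
    unfolding weighted_area_def by (rule integrable_sum_measure) (use int[of 1] int[of "-1"] fm in auto)
  have "(\<integral>x. f x \<partial>weighted_area) = (\<Sum>p\<in>UNIV \<times> {1, -1}. \<integral>x. f x \<partial>(case p of (k, s) \<Rightarrow>
      density (cap_measure \<beta> k s) (\<lambda>x. ennreal (s * x $ k / 2))))"
    unfolding weighted_area_def by (rule integral_sum_measure) (use int[of 1] int[of "-1"] fm in auto)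
  also have "\<dots> = (\<Sum>k\<in>UNIV. \<Sum>s\<in>{1, -1}. \<integral>x. f x \<partial>density (cap_measure \<beta> k s) (\<lambda>x. ennreal (s * x $ k / 2)))"
    by (subst sum.cartesian_product) (auto intro!: sum.cong)
  also have "\<dots> = (\<Sum>k\<in>UNIV. flux k (\<lambda>x. x $ k / 2 * f x))"
    by (intro sum.cong refl) (simp add: flux_def eq[of 1, simplified] eq[of "-1", simplified])
  finally show "(\<integral>x. f x \<partial>weighted_area) = (\<Sum>k\<in>UNIV. flux k (\<lambda>x. x $ k / 2 * f x))" .
qed

text \<open>\<open>flux_swap\<close>, applied to \<open>x $ k * w x\<close>, moves each summand from
  direction \<open>k\<close> to direction \<open>j\<close>. There the coefficients add up to q,
  which is 1 on the boundary.\<close>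

lemma weighted_area_normal:
  assumes w: "real_polynomial_function w"
  shows "(\<integral>x. 2 * \<beta> $ j * x $ j * w x \<partial>weighted_area) = flux j w"
proof -
  have p: "real_polynomial_function (\<lambda>x. 2 * \<beta> $ j * x $ j * w x)"
    "real_polynomial_function (\<lambda>x. x $ k * w x)" "real_polynomial_function (\<lambda>x. \<beta> $ k * x $ k * (x $ k * w x))" for k
    by (intro real_polynomial_function.intros(2,4) real_polynomial_function_coord w)+
  have "(\<integral>x. 2 * \<beta> $ j * x $ j * w x \<partial>weighted_area) = (\<Sum>k\<in>UNIV. flux k (\<lambda>x. x $ k / 2 * (2 * \<beta> $ j * x $ j * w x)))"
    by (rule integral_weighted_area) (intro continuous_on_real_polynomial_function borel_measurable_real_polynomial_function p)+
  also have "\<dots> = (\<Sum>k\<in>UNIV. flux k (\<lambda>x. \<beta> $ j * x $ j * (x $ k * w x)))"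
    by (intro sum.cong flux_cong refl) simp
  also have "\<dots> = (\<Sum>k\<in>UNIV. flux j (\<lambda>x. \<beta> $ k * x $ k * (x $ k * w x)))"
    by (intro sum.cong flux_swap refl p)
  also have "\<dots> = flux j (\<lambda>x. \<Sum>k\<in>UNIV. \<beta> $ k * x $ k * (x $ k * w x))"
    by (rule flux_sum[symmetric]) (rule p)
  also have "\<dots> = flux j w"
  proof (rule flux_cong)
    fix x assume "x \<in> ellipsoid_bd \<beta>"
    have "(\<Sum>k\<in>UNIV. \<beta> $ k * x $ k * (x $ k * w x)) = quad \<beta> x * w x"
      by (simp add: quad_def sum_distrib_right power2_eq_square mult.assoc)
    then show "(\<Sum>k\<in>UNIV. \<beta> $ k * x $ k * (x $ k * w x)) = w x"
      using \<open>x \<in> ellipsoid_bd \<beta>\<close> by (simp add: ellipsoid_bd_def)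
  qed
  finally show ?thesis .
qed

lemma null_weighted_area: "emeasure weighted_area (- ellipsoid_bd \<beta>) = 0"
proof -
  have "emeasure (density (cap_measure \<beta> k s) (\<lambda>x. ennreal (s * x $ k / 2))) (- ellipsoid_bd \<beta>) = 0" if s: "\<bar>s\<bar> = 1" for k s
  proof -
    have "AE x in cap_measure \<beta> k s. x \<notin> - ellipsoid_bd \<beta>"
      using AE_cap_measure_bd[OF s, of k] by eventually_elim simp
    then have "AE x in density (cap_measure \<beta> k s) (\<lambda>x. ennreal (s * x $ k / 2)). x \<notin> - ellipsoid_bd \<beta>"
      by (subst AE_density) (auto elim!: eventually_mono)
    then show ?thesis by (subst (asm) AE_iff_measurable[OF _ refl]) (auto simp: Compl_eq)
  qed
  from this[of 1] this[of "-1"] show ?thesis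
    unfolding weighted_area_def by (subst emeasure_sum_measure) (auto simp: Compl_eq intro!: sum.neutral)
qed

text \<open>\<open>ennreal\<close> sends negative numbers to 0, so the density is the positive part
  of \<open>s * (2 * \<beta> $ j * x $ j)\<close>. \<open>weighted_area_normal\<close> gives only
  the difference of the two signs, tested on polynomials; moving the negative terms across yields an
  equality of positive measures, and a half-space then separates the signs.\<close>

lemma density_weighted_area:
  assumes s: "s = 1 \<or> s = -1"
  shows "density weighted_area (\<lambda>x. ennreal (s * (2 * \<beta> $ j * x $ j))) = cap_measure \<beta> j s"
proof -
  let ?d = "\<lambda>s. density weighted_area (\<lambda>x. ennreal (s * (2 * \<beta> $ j * x $ j)))"
  let ?m = "\<lambda>s x. max 0 (s * (2 * \<beta> $ j * x $ j)) :: real"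
  \<comment> \<open>The density of sign \<open>s\<close> plus the cap of the opposite sign: the two
    sides of the rearranged identity are \<open>?N 1\<close> and \<open>?N (- 1)\<close>.\<close>
  let ?N = "\<lambda>s. sum_measure UNIV (\<lambda>b. if b then ?d s else cap_measure \<beta> j (- s))"
  have d: "?d s = density weighted_area (\<lambda>x. ennreal (?m s x))" for s
    by (intro arg_cong[where f = "density weighted_area"] ext) (simp add: max_def ennreal_neg)
  have [measurable]: "?m s \<in> borel_measurable borel" for s by measurable
  have int: "integrable (?d s) f" "(\<integral>x. f x \<partial>?d s) = (\<integral>x. ?m s x * f x \<partial>weighted_area)" "integrable weighted_area (\<lambda>x. ?m s x * f x)"
    if f: "continuous_on UNIV f" for s and f :: "real^'n \<Rightarrow> real"
  proof -
    have [measurable]: "f \<in> borel_measurable borel" using f by (rule borel_measurable_continuous_onI)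
    show i: "integrable weighted_area (\<lambda>x. ?m s x * f x)"
      by (intro integrable_weighted_area continuous_intros continuous_on_subset[OF f]) auto
    then show "integrable (?d s) f" unfolding d by (subst integrable_density) auto
    show "(\<integral>x. f x \<partial>?d s) = (\<integral>x. ?m s x * f x \<partial>weighted_area)"
      unfolding d by (subst integral_density) auto
  qed
  have finN: "finite_measure (?N s)" if "s = 1 \<or> s = -1" for s
  proof -
    have "integrable (?N s) (\<lambda>_. 1 :: real)"
    proof (rule integrable_sum_measure)
      show "integrable (if b then ?d s else cap_measure \<beta> j (- s)) (\<lambda>_. 1 :: real)" for b
        using int(1)[of "\<lambda>_. 1" s] integrable_cap_measure[of "- s" "\<lambda>_. 1" j] that by auto
    qed auto
    then show ?thesis by (intro finite_measureI) (simp add: integrable_iff_bounded less_top)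
  qed
  have nullN: "emeasure (?N s) (- ellipsoid_bd \<beta>) = 0" if "s = 1 \<or> s = -1" for s
  proof -
    have "- ellipsoid_bd \<beta> \<in> null_sets weighted_area"
      using null_weighted_area by (auto simp: null_sets_def)
    then have "- ellipsoid_bd \<beta> \<in> null_sets (?d s)"
      using absolutely_continuousI_density[of "\<lambda>x. ennreal (s * (2 * \<beta> $ j * x $ j))" weighted_area]
      unfolding absolutely_continuous_def by (rule subsetD[rotated]) measurable
    then have "emeasure (?d s) (- ellipsoid_bd \<beta>) = 0" by (rule null_setsD1)
    moreover have "emeasure (cap_measure \<beta> j (- s)) (- ellipsoid_bd \<beta>) = 0" using that by (intro null_cap_measure) auto
    ultimately show ?thesis by (subst emeasure_sum_measure) (auto intro!: sum.neutral)
  qed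
  have "?N 1 = ?N (- 1)"
  proof (rule measure_eqI_real_polynomial[OF finN _ nullN finN _ nullN compact_ellipsoid_bd])
    fix p :: "real^'n \<Rightarrow> real" assume p: "real_polynomial_function p"
    have c: "continuous_on A p" for A using p by (rule continuous_on_real_polynomial_function)
    have N: "(\<integral>x. p x \<partial>?N s) = (\<integral>x. ?m s x * p x \<partial>weighted_area) + (\<integral>x. p x \<partial>cap_measure \<beta> j (- s))"
      if "s = 1 \<or> s = -1" for s
    proof -
      have "(\<integral>x. p x \<partial>?N s) = (\<Sum>b\<in>UNIV. \<integral>x. p x \<partial>(if b then ?d s else cap_measure \<beta> j (- s)))"
      proof (rule integral_sum_measure)
        show "integrable (if b then ?d s else cap_measure \<beta> j (- s)) p" for b
          using int(1)[OF c, of s] integrable_cap_measure[of "- s" p j, OF _ c borel_measurable_real_polynomial_function[OF p]] that by auto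
      qed (auto intro: borel_measurable_real_polynomial_function p)
      then show ?thesis by (simp add: UNIV_bool int(2)[OF c])
    qed
    have "(\<integral>x. ?m 1 x * p x \<partial>weighted_area) - (\<integral>x. ?m (- 1) x * p x \<partial>weighted_area)
        = (\<integral>x. ?m 1 x * p x - ?m (- 1) x * p x \<partial>weighted_area)"
      by (rule Bochner_Integration.integral_diff[symmetric]) (intro int c)+
    also have "\<dots> = (\<integral>x. 2 * \<beta> $ j * x $ j * p x \<partial>weighted_area)"
      by (intro Bochner_Integration.integral_cong refl) (auto simp: max_def)
    also have "\<dots> = (\<integral>x. p x \<partial>cap_measure \<beta> j 1) - (\<integral>x. p x \<partial>cap_measure \<beta> j (- 1))"
      unfolding weighted_area_normal[OF p] flux_def by (simp add: integral_cap_indicator borel_measurable_real_polynomial_function p)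
    finally show "(\<integral>x. p x \<partial>?N 1) = (\<integral>x. p x \<partial>?N (- 1))"
      by (simp add: N)
  qed auto
  \<comment> \<open>The equality is symmetric in the sign and therefore serves both values of
    \<open>s\<close>.\<close>
  then have N: "?N s = ?N (- s)" using s by (elim disjE) (simp_all only: minus_minus)
  show ?thesis
  proof (rule measure_eqI)
    fix A assume "A \<in> sets (?d s)"
    then have [measurable]: "A \<in> sets borel" by simp
    \<comment> \<open>On this half-space only the density survives in \<open>?N s\<close>, and only
      the cap of sign \<open>s\<close> in \<open>?N (- s)\<close>.\<close>
    let ?P = "{x :: real^'n. s * x $ j > 0}"
    have [measurable]: "?P \<in> sets borel" by measurable
    have off: "indicator ?P x * ennreal (s * (2 * \<beta> $ j * x $ j)) = ennreal (s * (2 * \<beta> $ j * x $ j))"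
      "indicator ?P x * ennreal (- s * (2 * \<beta> $ j * x $ j)) = 0" for x
    proof -
      have eq: "s * (2 * \<beta> $ j * x $ j) = 2 * \<beta> $ j * (s * x $ j)" by (simp add: algebra_simps)
      show "indicator ?P x * ennreal (s * (2 * \<beta> $ j * x $ j)) = ennreal (s * (2 * \<beta> $ j * x $ j))"
        unfolding eq using pos[of j] mult_nonneg_nonpos[of "2 * \<beta> $ j" "s * x $ j"]
        by (cases "s * x $ j > 0") (simp_all add: ennreal_neg not_less)
      show "indicator ?P x * ennreal (- s * (2 * \<beta> $ j * x $ j)) = 0"
        unfolding minus_mult_left[symmetric] eq using pos[of j]
        by (cases "s * x $ j > 0") (simp_all add: ennreal_neg)
    qed
    have "ennreal (s * (2 * \<beta> $ j * x $ j)) * indicator (A \<inter> ?P) x = ennreal (s * (2 * \<beta> $ j * x $ j)) * indicator A x" for x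
      using off(1)[of x] by (cases "x \<in> ?P") (simp_all add: indicator_inter_arith)
    then have d1: "emeasure (?d s) (A \<inter> ?P) = emeasure (?d s) A"
      by (simp add: emeasure_density)
    have z: "ennreal (- s * (2 * \<beta> $ j * x $ j)) * indicator (A \<inter> ?P) x = 0" for x
      using off(2)[of x] by (cases "x \<in> ?P") simp_all
    have d2: "emeasure (?d (- s)) (A \<inter> ?P) = 0"
      by (subst emeasure_density) (simp_all only: z nn_integral_const mult_zero_left, simp_all)
    have s1: "\<bar>s\<bar> = 1" "\<bar>- s\<bar> = 1" using s by auto
    have c1: "emeasure (cap_measure \<beta> j s) (A \<inter> ?P) = emeasure (cap_measure \<beta> j s) A"
    proof (rule emeasure_eq_AE)
      show "AE x in cap_measure \<beta> j s. x \<in> A \<inter> ?P \<longleftrightarrow> x \<in> A"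
        using AE_cap_measure_bd[OF s1(1), of j] by eventually_elim simp
    qed simp_all
    have "AE x in cap_measure \<beta> j (- s). x \<notin> A \<inter> ?P"
      using AE_cap_measure_bd[OF s1(2), of j] by eventually_elim auto
    then have c2: "emeasure (cap_measure \<beta> j (- s)) (A \<inter> ?P) = 0"
      by (subst (asm) AE_iff_measurable[OF _ refl]) (auto simp: Int_def)
    have e: "emeasure (?N s') (A \<inter> ?P) = emeasure (?d s') (A \<inter> ?P) + emeasure (cap_measure \<beta> j (- s')) (A \<inter> ?P)" for s'
      by (subst emeasure_sum_measure) (auto simp: UNIV_bool add.commute)
    show "emeasure (?d s) A = emeasure (cap_measure \<beta> j s) A"
      using e[of s] e[of "- s"] d1 d2 c1 c2 N by simp
  qed simp
qed

end

subsection \<open>The surface measure and the divergence theorem\<close>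

text \<open>With one weight set to zero it is again a quadratic form, so polynomiality and partial
  derivatives carry over from \<open>quad\<close>.\<close>

lemma quad_except_eq_quad: "quad_except \<beta> k = quad (\<chi> i. if i = k then 0 else \<beta> $ i)"
proof
  show "quad_except \<beta> k x = quad (\<chi> i. if i = k then 0 else \<beta> $ i) x" for x
    unfolding quad_except_def quad_def by (intro sum.mono_neutral_cong_left) auto
qed

lemma real_polynomial_function_quad_except: "real_polynomial_function (quad_except \<beta> k)"
  unfolding quad_except_eq_quad by (rule real_polynomial_function_quad)

lemma partial_deriv_quad_except [simp]:
  "partial_deriv i (quad_except \<beta> k) x = (if i = k then 0 else 2 * \<beta> $ i * x $ i)"
  unfolding quad_except_eq_quad by simp

text \<open>Constancy is asked only along the line in direction \<open>i\<close>. This matters for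
  charts, whose defining identity holds only on the hyperplane.\<close>

lemma partial_deriv_locally_const:
  fixes f :: "real^'n::finite \<Rightarrow> real"
  assumes "open W" "y \<in> W" and c: "\<And>t. y + t *\<^sub>R axis i 1 \<in> W \<Longrightarrow> f (y + t *\<^sub>R axis i 1) = c"
  shows "partial_deriv i f y = 0"
proof -
  have "open ((\<lambda>t. y + t *\<^sub>R axis i 1) -` W)"
    using \<open>open W\<close> by (rule open_vimage) (auto intro!: continuous_intros)
  moreover have "0 \<in> (\<lambda>t. y + t *\<^sub>R axis i 1) -` W" using \<open>y \<in> W\<close> by simp
  ultimately have "\<forall>\<^sub>F t in nhds 0. t \<in> (\<lambda>t. y + t *\<^sub>R axis i 1) -` W" by (rule eventually_nhds_in_open)
  then have "\<forall>\<^sub>F t in nhds 0. f (y + t *\<^sub>R axis i 1) = c"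
    by eventually_elim (simp add: c)
  then have "deriv (\<lambda>t. f (y + t *\<^sub>R axis i 1)) 0 = deriv (\<lambda>t. c) 0"
    by (intro deriv_cong_ev) auto
  then show ?thesis by (simp add: partial_deriv_def)
qed

context positive_weights
begin

text \<open>Implicit differentiation of the equation q = 1 along the graph expresses the tangential
  components of \<nabla>q through the derivatives of \<open>\<phi>\<close>. It also excludes the
  equator, so that an arbitrary chart coincides pointwise with one of the two caps.\<close>

lemma chart_geometry:
  assumes W: "open W" and \<phi>: "Ck_on 1 \<phi> W"
    and sub: "graph_map k \<phi> ` (W \<inter> {y. y $ k = 0}) \<subseteq> ellipsoid_bd \<beta>"
    and y: "y \<in> W" "y $ k = 0"
  shows "y \<in> cap_dom \<beta> k" "\<phi> y \<noteq> 0" "\<bar>\<phi> y\<bar> = cap_height \<beta> k y"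
    and "norm (gradient (quad \<beta>) (graph_map k \<phi> y))
       = 2 * \<beta> $ k * \<bar>\<phi> y\<bar> * sqrt (1 + (\<Sum>i\<in>UNIV - {k}. (partial_deriv i \<phi> y)\<^sup>2))"
proof -
  have eq1: "quad_except \<beta> k z + \<beta> $ k * (\<phi> z)\<^sup>2 = 1" if "z \<in> W" "z $ k = 0" for z
  proof -
    have "graph_map k \<phi> z \<in> ellipsoid_bd \<beta>" using sub that by blast
    then show ?thesis by (simp add: graph_map_def ellipsoid_bd_def quad_shift that)
  qed
  have "\<phi> differentiable_on W" using \<phi> by simp
  then have diff: "\<phi> differentiable (at y)"
    unfolding differentiable_on_def using y(1) at_within_open[OF y(1) W] by metis
  have d: "\<beta> $ i * y $ i = - (\<beta> $ k * \<phi> y * partial_deriv i \<phi> y)" if "i \<noteq> k" for i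
  proof -
    have "0 = partial_deriv i (\<lambda>z. quad_except \<beta> k z + \<beta> $ k * (\<phi> z * \<phi> z)) y"
    \<comment> \<open>As \<open>i\<close> differs from \<open>k\<close>, the line stays in the
      hyperplane, where \<open>eq1\<close> is available.\<close>
    proof (rule partial_deriv_locally_const[OF W y(1), symmetric])
      fix t assume "y + t *\<^sub>R axis i 1 \<in> W"
      moreover have "(y + t *\<^sub>R axis i 1) $ k = 0" using that y(2) by (simp add: axis_def)
      ultimately show "quad_except \<beta> k (y + t *\<^sub>R axis i 1)
          + \<beta> $ k * (\<phi> (y + t *\<^sub>R axis i 1) * \<phi> (y + t *\<^sub>R axis i 1)) = 1"
        using eq1 unfolding power2_eq_square by blast
    qed
    also have "\<dots> = 2 * \<beta> $ i * y $ i + \<beta> $ k * (2 * \<phi> y * partial_deriv i \<phi> y)"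
    proof -
      have Q: "quad_except \<beta> k differentiable (at y)"
        by (intro differentiable_at_real_polynomial_function real_polynomial_function_quad_except)
      have "partial_deriv i (\<lambda>z. \<beta> $ k * (\<phi> z * \<phi> z)) y = \<beta> $ k * partial_deriv i (\<lambda>z. \<phi> z * \<phi> z) y"
        by (rule partial_deriv_cmult) (intro differentiable_mult diff)
      also have "partial_deriv i (\<lambda>z. \<phi> z * \<phi> z) y = 2 * \<phi> y * partial_deriv i \<phi> y"
        by (subst partial_deriv_mult[OF diff diff]) simp
      finally show ?thesis
        using that by (subst partial_deriv_add[OF Q]) (simp_all add: diff differentiable_mult)
    qed
    finally show ?thesis by simp
  qed
  \<comment> \<open>If \<open>\<phi> y\<close> were 0, then \<open>d\<close> would make every other
    coordinate of \<open>y\<close> vanish too, and q would be 0 instead of 1 on the graph.\<close>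
  show nz: "\<phi> y \<noteq> 0"
  proof
    assume "\<phi> y = 0"
    then have "quad_except \<beta> k y = 0"
      unfolding quad_except_def using d pos by (intro sum.neutral) (auto simp: less_imp_neq[symmetric])
    then show False using eq1[OF y] \<open>\<phi> y = 0\<close> by simp
  qed
  then have "\<beta> $ k * (\<phi> y)\<^sup>2 > 0" using pos[of k] by simp
  then show dom: "y \<in> cap_dom \<beta> k" using eq1[OF y] by (simp add: cap_dom_def)
  have "\<beta> $ k * (\<phi> y)\<^sup>2 = \<beta> $ k * (cap_height \<beta> k y)\<^sup>2" using cap_height_sq[OF dom] eq1[OF y] by simp
  then have "(\<phi> y)\<^sup>2 = (cap_height \<beta> k y)\<^sup>2" using pos[of k] by simp
  then show "\<bar>\<phi> y\<bar> = cap_height \<beta> k y"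
    using cap_height_pos[OF dom] by (auto simp: power2_eq_iff)
  let ?g = "gradient (quad \<beta>) (graph_map k \<phi> y)"
  have "(norm ?g)\<^sup>2 = (\<Sum>i\<in>UNIV. (?g $ i)\<^sup>2)"
    by (simp add: norm_vec_def L2_set_def sum_nonneg)
  also have "\<dots> = (?g $ k)\<^sup>2 + (\<Sum>i\<in>UNIV - {k}. (?g $ i)\<^sup>2)"
    by (subst sum.remove[of UNIV k]) auto
  also have "(\<Sum>i\<in>UNIV - {k}. (?g $ i)\<^sup>2) = (\<Sum>i\<in>UNIV - {k}. (2 * \<beta> $ k * \<phi> y)\<^sup>2 * (partial_deriv i \<phi> y)\<^sup>2)"
  proof (rule sum.cong[OF refl])
    fix i assume "i \<in> UNIV - {k}"
    then have "?g $ i = - (2 * \<beta> $ k * \<phi> y * partial_deriv i \<phi> y)"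
      using d[of i] by (simp add: gradient_quad graph_map_nth mult.assoc)
    then show "(?g $ i)\<^sup>2 = (2 * \<beta> $ k * \<phi> y)\<^sup>2 * (partial_deriv i \<phi> y)\<^sup>2"
      by (simp add: power_mult_distrib)
  qed
  also have "(?g $ k)\<^sup>2 = (2 * \<beta> $ k * \<phi> y)\<^sup>2"
    using y(2) by (simp add: gradient_quad graph_map_nth)
  finally have n: "(norm ?g)\<^sup>2 = (2 * \<beta> $ k * \<phi> y)\<^sup>2 * (1 + (\<Sum>i\<in>UNIV - {k}. (partial_deriv i \<phi> y)\<^sup>2))"
    by (simp add: sum_distrib_left distrib_left)
  have "norm ?g = sqrt ((norm ?g)\<^sup>2)" by simp
  also have "\<dots> = \<bar>2 * \<beta> $ k * \<phi> y\<bar> * sqrt (1 + (\<Sum>i\<in>UNIV - {k}. (partial_deriv i \<phi> y)\<^sup>2))"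
    unfolding n by (simp add: real_sqrt_mult)
  finally show "norm ?g = 2 * \<beta> $ k * \<bar>\<phi> y\<bar> * sqrt (1 + (\<Sum>i\<in>UNIV - {k}. (partial_deriv i \<phi> y)\<^sup>2))"
    using pos[of k] by (simp add: abs_mult)
qed

lemma measurable_norm_gradient_quad [measurable]: "(\<lambda>x. norm (gradient (quad \<beta>) x)) \<in> borel_measurable borel"
  unfolding gradient_quad by measurable

text \<open>\<open>density_weighted_area\<close> read backwards: where \<open>s * x $ k\<close> is
  positive the density can be divided out, and elsewhere \<open>h\<close> vanishes.\<close>

lemma nn_integral_weighted_area_halfspace:
  assumes s: "s = 1 \<or> s = -1" and [measurable]: "h \<in> borel_measurable borel"
    and h: "\<And>x. \<not> s * x $ k > 0 \<Longrightarrow> h x = 0"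
  shows "(\<integral>\<^sup>+x. h x \<partial>weighted_area) = (\<integral>\<^sup>+x. h x / ennreal (s * (2 * \<beta> $ k * x $ k)) \<partial>cap_measure \<beta> k s)"
proof -
  have "(\<integral>\<^sup>+x. h x / ennreal (s * (2 * \<beta> $ k * x $ k)) \<partial>cap_measure \<beta> k s)
    = (\<integral>\<^sup>+x. ennreal (s * (2 * \<beta> $ k * x $ k)) * (h x / ennreal (s * (2 * \<beta> $ k * x $ k))) \<partial>weighted_area)"
    unfolding density_weighted_area[OF s, symmetric] by (rule nn_integral_density) measurable
  also have "\<dots> = (\<integral>\<^sup>+x. h x \<partial>weighted_area)"
  proof (rule nn_integral_cong)
    fix x
    have e: "s * (2 * \<beta> $ k * x $ k) = 2 * \<beta> $ k * (s * x $ k)" by simp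
    show "ennreal (s * (2 * \<beta> $ k * x $ k)) * (h x / ennreal (s * (2 * \<beta> $ k * x $ k))) = h x"
    proof (cases "s * x $ k > 0")
      case True
      then have "s * (2 * \<beta> $ k * x $ k) > 0" unfolding e using pos[of k] by simp
      then have "ennreal (s * (2 * \<beta> $ k * x $ k)) \<noteq> 0" by (simp add: ennreal_eq_0_iff)
      then show ?thesis
        unfolding ennreal_times_divide mult.commute[of "ennreal (s * (2 * \<beta> $ k * x $ k))" "h x"]
        by (rule mult_divide_eq_ennreal) simp
    qed (simp add: h)
  qed
  finally show ?thesis ..
qed

definition ellipsoid_area :: "(real^'n) measure" where
  "ellipsoid_area = density weighted_area (\<lambda>x. ennreal (norm (gradient (quad \<beta>) x)))"

text \<open>On a cap the area has density |\<nabla>q| / (2 \<beta>_k |x_k|) with respect to the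
  transported hyperplane measure, and by \<open>chart_geometry\<close> this is the area element of
  the chart.\<close>

lemma is_surface_measure_ellipsoid_area: "is_surface_measure (ellipsoid_bd \<beta>) ellipsoid_area"
  unfolding is_surface_measure_def
proof (intro conjI allI impI)
  show "space ellipsoid_area = UNIV" "sets ellipsoid_area = sets borel" by (simp_all add: ellipsoid_area_def)
  have "- ellipsoid_bd \<beta> \<in> null_sets weighted_area"
    using null_weighted_area by (auto simp: null_sets_def)
  then have "- ellipsoid_bd \<beta> \<in> null_sets ellipsoid_area"
    using absolutely_continuousI_density[of "\<lambda>x. ennreal (norm (gradient (quad \<beta>) x))" weighted_area]
    unfolding absolutely_continuous_def ellipsoid_area_def by (rule subsetD[rotated]) measurable
  then show "emeasure ellipsoid_area (- ellipsoid_bd \<beta>) = 0" by (rule null_setsD1)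
next
  fix k :: 'n and W \<phi> B
  assume W: "open W" and \<phi>: "Ck_on 1 \<phi> W"
    and sub: "graph_map k \<phi> ` (W \<inter> {y. y $ k = 0}) \<subseteq> ellipsoid_bd \<beta>"
    and B [measurable]: "B \<in> sets borel" and BW: "B \<subseteq> W \<inter> {y. y $ k = 0}"
  note chart = chart_geometry[OF W \<phi> sub]
  let ?gr = "graph_map k \<phi>" and ?J = "\<lambda>y. sqrt (1 + (\<Sum>i\<in>UNIV - {k}. (partial_deriv i \<phi> y)\<^sup>2))"
  let ?n = "\<lambda>x. norm (gradient (quad \<beta>) x)"
  \<comment> \<open>A chart may run through both caps, as its domain need not be connected; it is
    cut by the sign of \<open>\<phi>\<close>.\<close>
  define Bs where "Bs s = {y \<in> B. s * \<phi> y > 0}" for s :: real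
  define G where "G s = ?gr ` Bs s" for s
  have BsB: "Bs s \<subseteq> B" for s by (auto simp: Bs_def)
  have [measurable]: "W \<in> sets borel" using W by auto
  have "continuous_on W \<phi>" using \<phi> by (auto intro: differentiable_imp_continuous_on)
  then have [measurable]: "(\<lambda>y. indicator W y * \<phi> y) \<in> borel_measurable borel"
    using borel_measurable_continuous_on_indicator[of W \<phi>] by simp
  \<comment> \<open>\<open>\<phi>\<close> is continuous only on \<open>W\<close>; its product with
    the indicator is Borel everywhere.\<close>
  have Bs: "Bs s = {y \<in> B. s * (indicator W y * \<phi> y) > 0}" for s
    using BW by (auto simp: Bs_def indicator_def)
  have [measurable]: "Bs s \<in> sets borel" for s unfolding Bs by measurable
  \<comment> \<open>The image of a Borel set is rewritten as a preimage under the projection to the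
    hyperplane, which shows that it is Borel.\<close>
  have Geq: "G s = {x \<in> ellipsoid_bd \<beta>. s * x $ k > 0 \<and> x + (- (x $ k)) *\<^sub>R axis k 1 \<in> Bs s}" if s: "s = 1 \<or> s = -1" for s
  proof (intro equalityI subsetI)
    fix x assume "x \<in> G s"
    then obtain y where y: "y \<in> Bs s" "x = ?gr y" by (auto simp: G_def)
    then have yW: "y \<in> W" "y $ k = 0" "s * \<phi> y > 0" using BW by (auto simp: Bs_def)
    have "x $ k = \<phi> y" using y(2) yW by (simp add: graph_map_nth)
    moreover have "x + (- (\<phi> y)) *\<^sub>R axis k 1 = y" by (simp add: y(2) graph_map_def)
    moreover have "x \<in> ellipsoid_bd \<beta>" using sub yW y(2) by auto
    ultimately show "x \<in> {x \<in> ellipsoid_bd \<beta>. s * x $ k > 0 \<and> x + (- (x $ k)) *\<^sub>R axis k 1 \<in> Bs s}"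
      using y yW by simp
  next
    fix x assume "x \<in> {x \<in> ellipsoid_bd \<beta>. s * x $ k > 0 \<and> x + (- (x $ k)) *\<^sub>R axis k 1 \<in> Bs s}"
    then have x: "x \<in> ellipsoid_bd \<beta>" "s * x $ k > 0" and y: "x + (- (x $ k)) *\<^sub>R axis k 1 \<in> Bs s" by auto
    define y where "y = x + (- (x $ k)) *\<^sub>R axis k 1"
    have yW: "y \<in> W" "y $ k = 0" "s * \<phi> y > 0" using y BW by (auto simp: Bs_def y_def)
    have xy: "x = y + (x $ k) *\<^sub>R axis k 1" by (simp add: y_def)
    have "quad_except \<beta> k y + \<beta> $ k * (x $ k)\<^sup>2 = 1"
      using x(1) quad_shift[OF yW(2), of \<beta> "x $ k"] xy by (simp add: ellipsoid_bd_def)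
    moreover have "quad_except \<beta> k y + \<beta> $ k * (\<phi> y)\<^sup>2 = 1"
      using sub yW quad_shift[OF yW(2), of \<beta> "\<phi> y"] by (auto simp: ellipsoid_bd_def graph_map_def)
    ultimately have "\<beta> $ k * (x $ k)\<^sup>2 = \<beta> $ k * (\<phi> y)\<^sup>2" by linarith
    then have "(x $ k)\<^sup>2 = (\<phi> y)\<^sup>2" using pos[of k] by simp
    then have "x $ k = \<phi> y" using x(2) yW(3) s by (auto simp: power2_eq_iff)
    then have "x = ?gr y" using xy by (simp add: graph_map_def)
    then show "x \<in> G s" using y by (auto simp: G_def y_def)
  qed
  have Gm [measurable]: "G s \<in> sets borel" if "s = 1 \<or> s = -1" for s
    unfolding Geq[OF that] by measurable
  define K where "K s x = ennreal (?n x) * indicator (G s) x / ennreal (s * (2 * \<beta> $ k * x $ k))" for s x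
  define T where "T s y = indicator (cap_dom \<beta> k) y * K s (graph_map k (\<lambda>y. s * cap_height \<beta> k y) y)" for s y
  have T: "emeasure ellipsoid_area (G s) = (\<integral>\<^sup>+y. T s y \<partial>hyperplane_lborel k)" "T s \<in> borel_measurable borel"
    if s: "s = 1 \<or> s = -1" for s
  proof -
    note [measurable] = Gm[OF s]
    have [measurable]: "K s \<in> borel_measurable borel" unfolding K_def by measurable
    show "T s \<in> borel_measurable borel" unfolding T_def by measurable
    have "emeasure ellipsoid_area (G s) = (\<integral>\<^sup>+x. ennreal (?n x) * indicator (G s) x \<partial>weighted_area)"
      unfolding ellipsoid_area_def by (rule emeasure_density) measurable
    also have "\<dots> = (\<integral>\<^sup>+x. K s x \<partial>cap_measure \<beta> k s)"
      unfolding K_def by (rule nn_integral_weighted_area_halfspace[OF s]) (auto simp: Geq[OF s])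
    also have "\<dots> = (\<integral>\<^sup>+y. T s y \<partial>hyperplane_lborel k)"
      unfolding T_def by (rule nn_integral_cap_measure) measurable
    finally show "emeasure ellipsoid_area (G s) = (\<integral>\<^sup>+y. T s y \<partial>hyperplane_lborel k)" .
  qed
  have Teq: "T s y = ennreal (?J y) * indicator (Bs s) y" if s: "s = 1 \<or> s = -1" and y0: "y $ k = 0" for s y
  proof (cases "y \<in> Bs s")
    case True
    then have y: "y \<in> W" "s * \<phi> y > 0" using BW by (auto simp: Bs_def)
    note c = chart[OF y(1) y0]
    have \<phi>y: "s * cap_height \<beta> k y = \<phi> y" "s * \<phi> y = \<bar>\<phi> y\<bar>" unfolding c(3)[symmetric] using s y(2) by auto
    have gr: "graph_map k (\<lambda>y. s * cap_height \<beta> k y) y = ?gr y" by (simp add: graph_map_def \<phi>y)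
    have G: "?gr y \<in> G s" using True by (auto simp: G_def)
    have e: "s * (2 * \<beta> $ k * ?gr y $ k) = 2 * \<beta> $ k * \<bar>\<phi> y\<bar>"
      using \<phi>y(2) by (simp add: graph_map_nth y0 mult.left_commute)
    \<comment> \<open>Here the gradient norm, written as in the last part of
      \<open>chart_geometry\<close>, is divided by the density of the cap measure, and the area
      element remains.\<close>
    have "T s y = ennreal (2 * \<beta> $ k * \<bar>\<phi> y\<bar> * ?J y) / ennreal (2 * \<beta> $ k * \<bar>\<phi> y\<bar>)"
      unfolding T_def gr K_def e c(4) using c(1) G by simp
    also have "\<dots> = ennreal (?J y)"
      using c(2) pos[of k] by (subst divide_ennreal) (auto intro!: mult_nonneg_nonneg add_nonneg_nonneg sum_nonneg simp: less_imp_le)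
    finally show ?thesis using True by simp
  next
    case False
    have "graph_map k (\<lambda>y. s * cap_height \<beta> k y) y \<notin> G s"
    proof
      assume "graph_map k (\<lambda>y. s * cap_height \<beta> k y) y \<in> G s"
      then show False
        using False by (simp add: Geq[OF s] graph_map_nth y0) (simp add: graph_map_def)
    qed
    then show ?thesis using False by (simp add: T_def K_def)
  qed
  have nz: "\<phi> y \<noteq> 0" if "y \<in> B" for y using chart(2)[of y] that BW by blast
  have Bun: "B = Bs 1 \<union> Bs (-1)"
  proof (intro equalityI subsetI)
    fix y assume "y \<in> B"
    then show "y \<in> Bs 1 \<union> Bs (-1)" using nz[of y] by (simp add: Bs_def) linarith
  qed (use BsB in auto)
  have cover: "indicator B y = (indicator (Bs 1) y + indicator (Bs (-1)) y :: ennreal)" for y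
  proof -
    have "Bs 1 \<inter> Bs (-1) = {}" by (auto simp: Bs_def)
    then have "indicator (Bs 1 \<union> Bs (-1)) y = (indicator (Bs 1) y + indicator (Bs (-1)) y :: ennreal)"
      by (auto simp: indicator_def)
    then show ?thesis by (simp only: Bun[symmetric])
  qed
  have "G 1 \<inter> G (-1) = {}" by (auto simp: Geq)
  moreover have "?gr ` B = G 1 \<union> G (-1)"
  proof -
    show ?thesis unfolding G_def using Bun by (metis image_Un)
  qed
  ultimately have "emeasure ellipsoid_area (?gr ` B) = emeasure ellipsoid_area (G 1) + emeasure ellipsoid_area (G (-1))"
    by (simp add: plus_emeasure Gm ellipsoid_area_def)
  also have "\<dots> = (\<integral>\<^sup>+y. T 1 y + T (-1) y \<partial>hyperplane_lborel k)"
  proof -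
    have "T 1 \<in> borel_measurable (hyperplane_lborel k)" "T (-1) \<in> borel_measurable (hyperplane_lborel k)"
      using T(2)[of 1] T(2)[of "-1"] measurable_cong_sets[OF sets_hyperplane_lborel[of k] refl] by auto
    then show ?thesis by (simp add: T(1) nn_integral_add)
  qed
  also have "\<dots> = (\<integral>\<^sup>+y\<in>B. ennreal (?J y) \<partial>hyperplane_lborel k)"
  proof (rule nn_integral_cong_AE, use AE_hyperplane_lborel[of k] in eventually_elim)
    case (elim y)
    show ?case by (simp add: Teq elim cover distrib_left)
  qed
  finally show "emeasure ellipsoid_area (?gr ` B) = (\<integral>\<^sup>+y\<in>B. ennreal (?J y) \<partial>hyperplane_lborel k)" .
qed

section \<open>Uniqueness of the surface measure of the ellipsoid\<close>

lemma Ck_on_cap_height: "Ck_on 1 (\<lambda>y. s * cap_height \<beta> k y) (cap_dom \<beta> k)"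
proof -
  let ?d = "\<lambda>i y. s * (- partial_deriv i (quad_except \<beta> k) y / \<beta> $ k * inverse (cap_height \<beta> k y) / 2)"
  have der: "((\<lambda>y. s * cap_height \<beta> k y) has_derivative
      (\<lambda>h. s * (- Q' h / \<beta> $ k * inverse (cap_height \<beta> k y) / 2))) (at y)"
    if y: "y \<in> cap_dom \<beta> k" and Q': "(quad_except \<beta> k has_derivative Q') (at y)" for y Q'
    unfolding cap_height_def
    using y pos[of k] by (auto intro!: derivative_eq_intros Q' simp: cap_dom_def)
  have Q: "quad_except \<beta> k differentiable at y" for y by (intro differentiable_at_real_polynomial_function real_polynomial_function_quad_except)
  have pd: "partial_deriv i (\<lambda>y. s * cap_height \<beta> k y) y = ?d i y" if y: "y \<in> cap_dom \<beta> k" for i y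
  proof -
    obtain Q' where Q': "(quad_except \<beta> k has_derivative Q') (at y)" using Q by (auto simp: differentiable_def)
    show ?thesis unfolding partial_deriv_eq[OF der[OF y Q']] partial_deriv_eq[OF Q'] ..
  qed
  have "(\<lambda>y. s * cap_height \<beta> k y) differentiable_on cap_dom \<beta> k"
    using der Q by (meson differentiable_at_imp_differentiable_on differentiable_def)
  moreover have "continuous_on (cap_dom \<beta> k) (partial_deriv i (\<lambda>y. s * cap_height \<beta> k y))" for i
  proof -
    have "continuous_on (cap_dom \<beta> k) (cap_height \<beta> k)"
      unfolding cap_height_def[abs_def] using pos[of k] by (intro continuous_intros continuous_on_quad_except) auto
    moreover have "continuous_on (cap_dom \<beta> k) (partial_deriv i (quad_except \<beta> k))"
      by (intro continuous_on_real_polynomial_function real_polynomial_function_partial_deriv real_polynomial_function_quad_except)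
    moreover have "cap_height \<beta> k y \<noteq> 0" if "y \<in> cap_dom \<beta> k" for y
      using cap_height_pos[OF that] by simp
    ultimately have "continuous_on (cap_dom \<beta> k) (?d i)"
      using pos[of k] by (intro continuous_on_mult continuous_on_divide continuous_on_minus continuous_on_inverse continuous_on_const) auto
    then show ?thesis by (rule continuous_on_eq) (simp add: pd)
  qed
  ultimately show ?thesis by simp
qed

text \<open>The cap itself is an admissible chart and \<open>A\<close> is the image of a Borel set
  under it, so the defining property prescribes the value on \<open>A\<close>.\<close>

lemma is_surface_measure_cap_eq:
  assumes M1: "is_surface_measure (ellipsoid_bd \<beta>) M1" and M2: "is_surface_measure (ellipsoid_bd \<beta>) M2"
    and s: "s = 1 \<or> s = -1" and A: "A \<in> sets borel" "A \<subseteq> {x \<in> ellipsoid_bd \<beta>. s * x $ k > 0}"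
  shows "emeasure M1 A = emeasure M2 A"
proof -
  let ?gr = "graph_map k (\<lambda>y. s * cap_height \<beta> k y)"
  define B where "B = {y \<in> cap_dom \<beta> k. y $ k = 0 \<and> ?gr y \<in> A}"
  have [measurable]: "A \<in> sets borel" by fact
  have B: "B \<in> sets borel" unfolding B_def by measurable
  have BW: "B \<subseteq> cap_dom \<beta> k \<inter> {y. y $ k = 0}" by (auto simp: B_def)
  have sub: "?gr ` (cap_dom \<beta> k \<inter> {y. y $ k = 0}) \<subseteq> ellipsoid_bd \<beta>"
    using s by (auto intro!: graph_map_cap_in_bd)
  have "A = ?gr ` B"
  proof (intro equalityI subsetI)
    fix x assume x: "x \<in> A"
    then have xb: "quad \<beta> x = 1" "s * x $ k > 0" using A(2) by (auto simp: ellipsoid_bd_def)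
    define y where "y = x + (- (x $ k)) *\<^sub>R axis k 1"
    have y0: "y $ k = 0" by (simp add: y_def)
    have qy: "quad_except \<beta> k y = 1 - \<beta> $ k * (x $ k)\<^sup>2"
      using xb(1) quad_split[of \<beta> x k] by (simp add: y_def del: scaleR_minus_left)
    have "x $ k \<noteq> 0" using xb(2) by auto
    then have "\<beta> $ k * (x $ k)\<^sup>2 > 0" using pos[of k] by simp
    then have dom: "y \<in> cap_dom \<beta> k" using qy by (simp add: cap_dom_def)
    have "s * cap_height \<beta> k y = x $ k"
      unfolding cap_height_def qy using pos[of k] s xb(2) by auto
    then have "?gr y = x" by (simp add: graph_map_def y_def)
    then show "x \<in> ?gr ` B" using x dom y0 by (force simp: B_def)
  qed (auto simp: B_def)
  moreover have "emeasure M (?gr ` B) = (\<integral>\<^sup>+y\<in>B. ennreal (sqrt (1 + (\<Sum>i\<in>UNIV - {k}.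
      (partial_deriv i (\<lambda>y. s * cap_height \<beta> k y) y)\<^sup>2))) \<partial>hyperplane_lborel k)"
    if M: "is_surface_measure (ellipsoid_bd \<beta>) M" for M
    using M open_cap_dom Ck_on_cap_height sub B BW unfolding is_surface_measure_def by blast
  ultimately show ?thesis using M1 M2 by simp
qed

text \<open>A boundary point is not the origin, so some coordinate is nonzero and finitely many open
  caps cover the boundary; its complement is null for both measures.\<close>

lemma is_surface_measure_unique:
  assumes M1: "is_surface_measure (ellipsoid_bd \<beta>) M1" and M2: "is_surface_measure (ellipsoid_bd \<beta>) M2"
  shows "M1 = M2"
proof (rule measure_eqI)
  have sets: "sets M1 = sets borel" "sets M2 = sets borel"
    and null: "emeasure M1 (- ellipsoid_bd \<beta>) = 0" "emeasure M2 (- ellipsoid_bd \<beta>) = 0"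
    using M1 M2 by (auto simp: is_surface_measure_def)
  then show "sets M1 = sets M2" by simp
  let ?P = "\<lambda>(k, s). {x \<in> ellipsoid_bd \<beta>. s * x $ k > 0}"
  have Pm: "?P p \<in> sets borel" for p by (cases p) simp
  have cover: "emeasure M1 A = emeasure M2 A"
    if "finite I" "I \<subseteq> UNIV \<times> {1, -1}" "A \<in> sets borel" "A \<subseteq> (\<Union>p\<in>I. ?P p)" for I A
    using that
  \<comment> \<open>The caps overlap, so they are split off one at a time: \<open>A\<close> falls
    into the part in the current cap and the rest.\<close>
  proof (induction I arbitrary: A rule: finite_induct)
    case (insert p I)
    obtain k s where p: "p = (k, s)" "s = 1 \<or> s = -1" using insert.prems by (cases p) auto
    have "emeasure M1 (A \<inter> ?P p) = emeasure M2 (A \<inter> ?P p)"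
      using insert.prems Pm[of p] by (intro is_surface_measure_cap_eq[OF M1 M2 p(2), where k = k]) (auto simp: p(1))
    moreover have "emeasure M1 (A - ?P p) = emeasure M2 (A - ?P p)"
      using insert.prems Pm[of p] by (intro insert.IH) auto
    moreover have "emeasure M A = emeasure M (A \<inter> ?P p) + emeasure M (A - ?P p)" if "sets M = sets borel" for M
      using insert.prems Pm[of p] that by (subst plus_emeasure) (auto simp: Int_Diff_Un)
    ultimately show ?case using sets by simp
  qed simp
  fix A assume "A \<in> sets M1"
  then have A: "A \<in> sets borel" by (simp add: sets)
  have "ellipsoid_bd \<beta> \<subseteq> (\<Union>p\<in>UNIV \<times> {1, -1}. ?P p)"
  proof
    fix x assume x: "x \<in> ellipsoid_bd \<beta>"
    then have "x \<noteq> 0" by (auto simp: ellipsoid_bd_def quad_def)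
    then obtain k where "x $ k \<noteq> 0" by (auto simp: vec_eq_iff)
    then obtain s where "s = 1 \<or> s = -1" "s * x $ k > 0"
      by (cases "x $ k > 0") (auto intro: that[of 1] that[of "-1"])
    then show "x \<in> (\<Union>p\<in>UNIV \<times> {1, -1}. ?P p)" using x by (intro UN_I[of "(k, s)"]) auto
  qed
  then have "emeasure M1 (A \<inter> ellipsoid_bd \<beta>) = emeasure M2 (A \<inter> ellipsoid_bd \<beta>)"
    using A by (intro cover[of "UNIV \<times> {1, -1}"]) auto
  moreover have "emeasure M A = emeasure M (A \<inter> ellipsoid_bd \<beta>)"
    if "sets M = sets borel" "emeasure M (- ellipsoid_bd \<beta>) = 0" for M
  proof (rule emeasure_eq_AE)
    have "- ellipsoid_bd \<beta> \<in> null_sets M" using that by (auto simp: null_sets_def)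
    then show "AE x in M. x \<in> A \<longleftrightarrow> x \<in> A \<inter> ellipsoid_bd \<beta>"
      by (rule AE_I') auto
  qed (use A that in auto)
  ultimately show "emeasure M1 A = emeasure M2 A" using sets null by simp
qed

lemma surface_measure_ellipsoid: "surface_measure (ellipsoid_bd \<beta>) = ellipsoid_area"
  unfolding surface_measure_def
  by (rule the_equality) (use is_surface_measure_ellipsoid_area is_surface_measure_unique in auto)

lemma gradient_quad_nonzero:
  assumes "x \<in> ellipsoid_bd \<beta>"
  shows "norm (gradient (quad \<beta>) x) \<noteq> 0"
proof
  assume "norm (gradient (quad \<beta>) x) = 0"
  then have "x = 0" using pos by (auto simp: gradient_quad vec_eq_iff less_imp_neq[symmetric])
  then show False using assms by (simp add: ellipsoid_bd_def quad_def)
qed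

lemma surface_integral_eq:
  fixes f :: "real^'n \<Rightarrow> real"
  assumes [measurable]: "f \<in> borel_measurable borel"
  shows "(LINT x:ellipsoid_bd \<beta>|surface_measure (ellipsoid_bd \<beta>). f x / norm (gradient (quad \<beta>) x))
       = (\<integral>x. indicator (ellipsoid_bd \<beta>) x * f x \<partial>weighted_area)"
proof -
  have "(LINT x:ellipsoid_bd \<beta>|surface_measure (ellipsoid_bd \<beta>). f x / norm (gradient (quad \<beta>) x))
      = (\<integral>x. norm (gradient (quad \<beta>) x) *\<^sub>R (indicator (ellipsoid_bd \<beta>) x *\<^sub>R (f x / norm (gradient (quad \<beta>) x))) \<partial>weighted_area)"
    unfolding surface_measure_ellipsoid ellipsoid_area_def set_lebesgue_integral_def
    by (rule integral_density) auto
  also have "\<dots> = (\<integral>x. indicator (ellipsoid_bd \<beta>) x * f x \<partial>weighted_area)"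
    using gradient_quad_nonzero by (intro Bochner_Integration.integral_cong refl) (auto simp: indicator_def)
  finally show ?thesis .
qed

text \<open>\<open>density_weighted_area\<close> is an equality of measures, no longer tied to
  polynomial integrands. Splitting \<open>2 * \<beta> $ k * x $ k\<close> into positive and negative
  part therefore gives the two cap integrals of \<open>F k\<close> directly.\<close>

lemma divergence_theorem:
  fixes F :: "'n \<Rightarrow> real^'n \<Rightarrow> real"
  assumes U: "open U" "ellipsoid_cl \<beta> \<subseteq> U"
    and F: "\<And>k. F k differentiable_on U" "\<And>k. continuous_on U (partial_deriv k (F k))"
  shows "(\<integral>x. indicator (ellipsoid_bd \<beta>) x * (\<Sum>k\<in>UNIV. F k x * (2 * \<beta> $ k * x $ k)) \<partial>weighted_area)
       = (\<integral>x. indicator (ellipsoid \<beta>) x * (\<Sum>k\<in>UNIV. partial_deriv k (F k) x) \<partial>lborel)"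
proof -
  have contF: "continuous_on (ellipsoid_bd \<beta>) (F k)" for k
    using differentiable_imp_continuous_on[OF F(1)] U(2) ellipsoid_subset_cl by (blast intro: continuous_on_subset)
  \<comment> \<open>A globally Borel substitute for \<open>F k\<close>, equal to it on the boundary,
    off which all measures concerned vanish.\<close>
  define G where "G k x = indicator (ellipsoid_bd \<beta>) x * F k x" for k x
  have Gm [measurable]: "G k \<in> borel_measurable borel" for k
    using borel_measurable_continuous_on_indicator[OF borel_sets_ellipsoid(2) contF] by (simp add: G_def[abs_def])
  have Gc: "continuous_on (ellipsoid_bd \<beta>) (G k)" for k
    by (rule continuous_on_eq[OF contF[of k]]) (simp add: G_def)
  let ?m = "\<lambda>k s x. max 0 (s * (2 * \<beta> $ k * x $ k)) :: real"
  have int: "integrable weighted_area (\<lambda>x. G k x * (2 * \<beta> $ k * x $ k))" for k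
    by (intro integrable_weighted_area continuous_intros Gc) auto
  have intm: "integrable weighted_area (\<lambda>x. ?m k s x * G k x)" for k s
    by (intro integrable_weighted_area continuous_intros Gc) auto
  have cap: "(\<integral>x. ?m k s x * G k x \<partial>weighted_area) = (\<integral>x. G k x \<partial>cap_measure \<beta> k s)" if s: "s = 1 \<or> s = -1" for k s
  proof -
    have "cap_measure \<beta> k s = density weighted_area (\<lambda>x. ennreal (?m k s x))"
      unfolding density_weighted_area[OF s, symmetric]
      by (intro arg_cong[where f = "density weighted_area"] ext) (simp add: max_def ennreal_neg)
    then show ?thesis by (simp add: integral_density)
  qed
  have one: "(\<integral>x. G k x * (2 * \<beta> $ k * x $ k) \<partial>weighted_area) = (\<integral>x. indicator (ellipsoid \<beta>) x * partial_deriv k (F k) x \<partial>lborel)" for k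
  proof -
    have "(\<integral>x. G k x * (2 * \<beta> $ k * x $ k) \<partial>weighted_area) = (\<integral>x. ?m k 1 x * G k x - ?m k (-1) x * G k x \<partial>weighted_area)"
      by (intro Bochner_Integration.integral_cong refl) (auto simp: max_def)
    also have "\<dots> = (\<integral>x. G k x \<partial>cap_measure \<beta> k 1) - (\<integral>x. G k x \<partial>cap_measure \<beta> k (-1))"
      by (subst Bochner_Integration.integral_diff[OF intm intm]) (simp only: cap simp_thms)
    also have "\<dots> = (\<integral>x. indicator (ellipsoid \<beta>) x * partial_deriv k (F k) x \<partial>lborel)"
      unfolding G_def by (rule integral_cap_measure_diff[OF U F])
    finally show ?thesis .
  qed
  have "(\<integral>x. indicator (ellipsoid_bd \<beta>) x * (\<Sum>k\<in>UNIV. F k x * (2 * \<beta> $ k * x $ k)) \<partial>weighted_area)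
      = (\<integral>x. (\<Sum>k\<in>UNIV. G k x * (2 * \<beta> $ k * x $ k)) \<partial>weighted_area)"
    by (simp add: G_def sum_distrib_left mult.assoc)
  also have "\<dots> = (\<Sum>k\<in>UNIV. \<integral>x. indicator (ellipsoid \<beta>) x * partial_deriv k (F k) x \<partial>lborel)"
    by (subst Bochner_Integration.integral_sum[OF int]) (simp add: one)
  also have "\<dots> = (\<integral>x. (\<Sum>k\<in>UNIV. indicator (ellipsoid \<beta>) x * partial_deriv k (F k) x) \<partial>lborel)"
    by (rule Bochner_Integration.integral_sum[symmetric])
      (intro integrable_solid continuous_on_subset[OF F(2) U(2)])
  finally show ?thesis by (simp add: sum_distrib_left)
qed

end

subsection \<open>Polynomials of bounded degree\<close>

text \<open>\<open>T\<close> is linear only on \<open>V\<close>, as differential operators built on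
  \<open>deriv\<close> are in general linear only on differentiable functions. The image of a basis
  is independent and equally large, so a vector outside its span would give too many independent
  vectors in \<open>V\<close>.\<close>

lemma (in vector_space) injective_endomorphism_surjective:
  assumes V: "subspace V" and G: "finite G" "V \<subseteq> span G"
    and T: "\<And>x. x \<in> V \<Longrightarrow> T x \<in> V"
    and add: "\<And>x y. x \<in> V \<Longrightarrow> y \<in> V \<Longrightarrow> T (x + y) = T x + T y"
    and cmult: "\<And>c x. x \<in> V \<Longrightarrow> T (scale c x) = scale c (T x)"
    and inj: "\<And>x. x \<in> V \<Longrightarrow> T x = 0 \<Longrightarrow> x = 0"
    and y: "y \<in> V"
  shows "\<exists>x\<in>V. T x = y"
proof -
  obtain B where B: "B \<subseteq> V" "independent B" "V \<subseteq> span B" by (rule maximal_independent_subset)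
  have "B \<subseteq> span G" using B(1) G(2) by (rule subset_trans)
  then have finB: "finite B" using independent_span_bound[OF G(1) B(2)] by simp
  have T0: "T 0 = 0" using cmult[OF subspace_0[OF V], of 0] by simp
  have T_sum: "T (\<Sum>a\<in>A. scale (u a) a) = (\<Sum>a\<in>A. scale (u a) (T a))" if "finite A" "A \<subseteq> V" for A u
    using that
  proof induction
    case (insert a A)
    have "T (scale (u a) a + (\<Sum>a\<in>A. scale (u a) a)) = T (scale (u a) a) + T (\<Sum>a\<in>A. scale (u a) a)"
      using insert V by (intro add subspace_scale subspace_sum) auto
    then show ?case using insert by (simp add: cmult)
  qed (simp add: T0)
  have injT: "inj_on T B"
  proof (rule inj_onI)
    fix a b assume ab: "a \<in> B" "b \<in> B" "T a = T b"
    have abV: "a \<in> V" "b \<in> V" using ab B(1) by auto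
    have "T (a + scale (- 1) b) = T a + scale (- 1) (T b)"
      by (subst add) (simp_all only: abV cmult subspace_scale[OF V])
    then have "a + scale (- 1) b = 0"
      using ab(3) abV by (intro inj[OF subspace_add[OF V _ subspace_scale[OF V]]]) simp_all
    then show "a = b" by simp
  qed
  have ind: "independent (T ` B)"
  proof (rule independent_if_scalars_zero)
    fix u x assume z: "(\<Sum>x\<in>T ` B. scale (u x) x) = 0" and "x \<in> T ` B"
    then obtain b where b: "b \<in> B" "x = T b" by auto
    have "T (\<Sum>a\<in>B. scale (u (T a)) a) = 0"
      using z by (subst T_sum[OF finB B(1)]) (simp add: sum.reindex[OF injT])
    then have "(\<Sum>a\<in>B. scale (u (T a)) a) = 0"
      using B(1) by (intro inj[OF subspace_sum[OF V subspace_scale[OF V]]]) auto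
    then have "u (T b) = 0" by (rule independentD[OF B(2) finB order_refl]) (rule b(1))
    then show "u x = 0" by (simp add: b(2))
  qed (simp add: finB)
  have TB: "T ` B \<subseteq> V" using B(1) T by auto
  have "y \<in> span (T ` B)"
  proof (rule ccontr)
    assume ny: "y \<notin> span (T ` B)"
    then have "independent (insert y (T ` B))" using ind by (rule independent_insertI)
    moreover have "insert y (T ` B) \<subseteq> span B" using TB y B(3) by auto
    ultimately have "card (insert y (T ` B)) \<le> card B" using independent_span_bound[OF finB] by simp
    moreover have "y \<notin> T ` B" using ny span_base[of y "T ` B"] by auto
    ultimately show False using finB by (simp add: card_image[OF injT])
  qed
  then obtain u where "y = (\<Sum>x\<in>T ` B. scale (u x) x)" unfolding span_finite[OF finite_imageI[OF finB]] by auto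
  then have "y = T (\<Sum>a\<in>B. scale (u (T a)) a)"
    by (subst T_sum[OF finB B(1)]) (simp add: sum.reindex[OF injT])
  moreover have "(\<Sum>a\<in>B. scale (u (T a)) a) \<in> V" using B(1) V by (intro subspace_sum subspace_scale) auto
  ultimately show ?thesis by blast
qed

section \<open>Polynomial functions with exponents in a given set\<close>

definition monomial :: "('n::finite \<Rightarrow>\<^sub>0 nat) \<Rightarrow> real^'n \<Rightarrow> real" where
  "monomial a x = (\<Prod>i\<in>UNIV. (x $ i) ^ Poly_Mapping.lookup a i)"

text \<open>Degree at most \<open>m - r\<close>, phrased with addition to avoid truncated
  subtraction: for \<open>m < r\<close> the set is empty and the space below contains only
  zero.\<close>

definition exponents :: "nat \<Rightarrow> nat \<Rightarrow> ('n::finite \<Rightarrow>\<^sub>0 nat) set" where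
  "exponents r m = {a. (\<Sum>i\<in>UNIV. Poly_Mapping.lookup a i) + r \<le> m}"

text \<open>Functions rather than formal polynomials, because the differential operators act on
  functions; \<open>eval_mpoly_in_poly_space\<close> and \<open>poly_space_eq_eval_mpoly\<close>
  translate in both directions.\<close>

definition poly_space :: "('n::finite \<Rightarrow>\<^sub>0 nat) set \<Rightarrow> (real^'n \<Rightarrow> real) set" where
  "poly_space K = {u. \<exists>c. u = (\<lambda>x. \<Sum>a\<in>K. c a * monomial a x)}"

lemma finite_exponents: "finite (exponents r m :: ('n::finite \<Rightarrow>\<^sub>0 nat) set)"
proof (rule finite_imageD)
  have "Poly_Mapping.lookup a i \<le> m" if "a \<in> exponents r m" for a :: "'n \<Rightarrow>\<^sub>0 nat" and i
    using that member_le_sum[of i UNIV "Poly_Mapping.lookup a"] by (auto simp: exponents_def)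
  then have "Poly_Mapping.lookup ` (exponents r m :: ('n \<Rightarrow>\<^sub>0 nat) set) \<subseteq> Pi\<^sub>E UNIV (\<lambda>_. {..m})" by auto
  then show "finite (Poly_Mapping.lookup ` (exponents r m :: ('n \<Rightarrow>\<^sub>0 nat) set))"
    by (rule finite_subset) (intro finite_PiE, auto)
  show "inj_on Poly_Mapping.lookup (exponents r m :: ('n \<Rightarrow>\<^sub>0 nat) set)"
    by (auto intro!: inj_onI simp: Poly_Mapping.lookup_inject)
qed

lemma poly_space_0: "(\<lambda>x. 0) \<in> poly_space K"
  unfolding poly_space_def by (auto intro!: exI[of _ "\<lambda>_. 0"])

lemma poly_space_add: "u \<in> poly_space K \<Longrightarrow> v \<in> poly_space K \<Longrightarrow> (\<lambda>x. u x + v x) \<in> poly_space K"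
  unfolding poly_space_def
proof (clarify)
  fix c d show "\<exists>e. (\<lambda>x. (\<Sum>a\<in>K. c a * monomial a x) + (\<Sum>a\<in>K. d a * monomial a x)) = (\<lambda>x. \<Sum>a\<in>K. e a * monomial a x)"
    by (rule exI[of _ "\<lambda>a. c a + d a"]) (simp add: distrib_right sum.distrib)
qed

lemma poly_space_cmult: "u \<in> poly_space K \<Longrightarrow> (\<lambda>x. t * u x) \<in> poly_space K"
  unfolding poly_space_def
proof (clarify)
  fix c show "\<exists>e. (\<lambda>x. t * (\<Sum>a\<in>K. c a * monomial a x)) = (\<lambda>x. \<Sum>a\<in>K. e a * monomial a x)"
    by (rule exI[of _ "\<lambda>a. t * c a"]) (simp add: sum_distrib_left mult.assoc)
qed

lemma poly_space_sum: "(\<And>i. i \<in> I \<Longrightarrow> u i \<in> poly_space K) \<Longrightarrow> (\<lambda>x. \<Sum>i\<in>I. u i x) \<in> poly_space K"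
  by (induction I rule: infinite_finite_induct) (simp_all add: poly_space_0 poly_space_add)

lemma monomial_in_poly_space:
  assumes "finite K" "a \<in> K"
  shows "monomial a \<in> poly_space K"
proof -
  have "monomial a x = (\<Sum>b\<in>K. (if b = a then 1 else 0) * monomial b x)" for x
  proof -
    have "(\<Sum>b\<in>K. (if b = a then 1 else 0) * monomial b x) = (\<Sum>b\<in>K. if b = a then monomial a x else 0)"
      by (rule sum.cong) auto
    then show ?thesis using assms by simp
  qed
  then show ?thesis
    unfolding poly_space_def by (intro CollectI exI[of _ "\<lambda>b. if b = a then 1 else 0"] ext)
qed

lemma poly_space_subset:
  assumes "\<And>a. a \<in> K \<Longrightarrow> monomial a \<in> poly_space K'"
  shows "poly_space K \<subseteq> poly_space K'"
proof
  fix u assume "u \<in> poly_space K"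
  then obtain c where "u = (\<lambda>x. \<Sum>a\<in>K. c a * monomial a x)" by (auto simp: poly_space_def)
  moreover have "(\<lambda>x. \<Sum>a\<in>K. c a * monomial a x) \<in> poly_space K'"
    by (rule poly_space_sum, rule poly_space_cmult, rule assms)
  ultimately show "u \<in> poly_space K'" by simp
qed

lemma real_polynomial_function_monomial: "real_polynomial_function (monomial a)"
  unfolding monomial_def[abs_def]
  by (intro real_polynomial_function_prod real_polynomial_function_power real_polynomial_function_coord) auto

lemma real_polynomial_function_poly_space:
  assumes "u \<in> poly_space K" shows "real_polynomial_function u"
proof -
  obtain c where u: "u = (\<lambda>x. \<Sum>a\<in>K. c a * monomial a x)" using assms by (auto simp: poly_space_def)
  show ?thesis unfolding u
    by (cases "finite K") (auto intro!: real_polynomial_function_sum real_polynomial_function.intros(2,4) real_polynomial_function_monomial)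
qed

text \<open>If the exponent of \<open>x $ i\<close> is 0, the subtraction of exponents truncates and
  leaves \<open>a\<close> unchanged, but the numerical factor is then 0.\<close>

lemma partial_deriv_monomial:
  "partial_deriv i (monomial a) x = real (Poly_Mapping.lookup a i) * monomial (a - Poly_Mapping.single i 1) x"
  "x $ i * partial_deriv i (monomial a) x = real (Poly_Mapping.lookup a i) * monomial a x"
proof -
  define n where "n = Poly_Mapping.lookup a i"
  define R where "R x = (\<Prod>j\<in>UNIV - {i}. (x $ j) ^ Poly_Mapping.lookup a j)" for x :: "real^'a"
  have ma: "monomial a = (\<lambda>x. (x $ i) ^ n * R x)"
    unfolding monomial_def[abs_def] R_def n_def by (subst prod.remove[of UNIV i]) auto
  have mb: "monomial (a - Poly_Mapping.single i 1) x = (x $ i) ^ (n - 1) * R x"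
    unfolding monomial_def R_def n_def
    by (subst prod.remove[of UNIV i]) (auto simp: lookup_minus lookup_single intro!: prod.cong)
  have R: "real_polynomial_function R" "real_polynomial_function (\<lambda>x :: real^'a. (x $ i) ^ n)"
    unfolding R_def[abs_def] by (intro real_polynomial_function_prod real_polynomial_function_power real_polynomial_function_coord; simp)+
  have "partial_deriv i R x = 0"
    by (rule partial_deriv_locally_const[of UNIV x i R "R x"]) (auto simp: R_def axis_def intro!: prod.cong)
  moreover have "partial_deriv i (\<lambda>x :: real^'a. (x $ i) ^ n) x = real n * (x $ i) ^ (n - 1)"
  proof -
    have "((\<lambda>x :: real^'a. (x $ i) ^ n) has_derivative (\<lambda>h. real n * (x $ i) ^ (n - 1) * h $ i)) (at x)"
      by (auto intro!: derivative_eq_intros bounded_linear_imp_has_derivative[OF bounded_linear_vec_nth])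
    then show ?thesis by (simp add: partial_deriv_eq)
  qed
  ultimately have d: "partial_deriv i (monomial a) x = real n * (x $ i) ^ (n - 1) * R x"
    unfolding ma using R by (simp add: partial_deriv_mult differentiable_at_real_polynomial_function)
  show "partial_deriv i (monomial a) x = real (Poly_Mapping.lookup a i) * monomial (a - Poly_Mapping.single i 1) x"
    unfolding d mb n_def[symmetric] by simp
  show "x $ i * partial_deriv i (monomial a) x = real (Poly_Mapping.lookup a i) * monomial a x"
    unfolding d n_def[symmetric] unfolding ma by (cases n) auto
qed

lemma poly_space_partial_deriv:
  assumes "u \<in> poly_space (exponents r m)"
  shows "partial_deriv i u \<in> poly_space (exponents (Suc r) m)"
proof -
  obtain c where u: "u = (\<lambda>x. \<Sum>a\<in>exponents r m. c a * monomial a x)" using assms by (auto simp: poly_space_def)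
  have "partial_deriv i u = (\<lambda>x. \<Sum>a\<in>exponents r m. c a * (real (Poly_Mapping.lookup a i) * monomial (a - Poly_Mapping.single i 1) x))"
  proof
    fix x
    have "partial_deriv i u x = (\<Sum>a\<in>exponents r m. partial_deriv i (\<lambda>x. c a * monomial a x) x)"
      unfolding u by (intro partial_deriv_sum differentiable_at_real_polynomial_function real_polynomial_function.intros(2,4) real_polynomial_function_monomial)
    then show "partial_deriv i u x = (\<Sum>a\<in>exponents r m. c a * (real (Poly_Mapping.lookup a i) * monomial (a - Poly_Mapping.single i 1) x))"
      by (simp add: partial_deriv_cmult differentiable_at_real_polynomial_function real_polynomial_function_monomial partial_deriv_monomial(1))
  qed
  also have "\<dots> \<in> poly_space (exponents (Suc r) m)"
  proof (rule poly_space_sum, rule poly_space_cmult)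
    fix a :: "'a \<Rightarrow>\<^sub>0 nat" assume a: "a \<in> exponents r m"
    show "(\<lambda>x. real (Poly_Mapping.lookup a i) * monomial (a - Poly_Mapping.single i 1) x) \<in> poly_space (exponents (Suc r) m)"
    proof (cases "Poly_Mapping.lookup a i = 0")
      case False
      have "(\<Sum>j\<in>UNIV. Poly_Mapping.lookup (a - Poly_Mapping.single i 1) j) + 1 = (\<Sum>j\<in>UNIV. Poly_Mapping.lookup a j)"
        using False by (subst (1 2) sum.remove[of UNIV i]) (auto simp: lookup_minus lookup_single intro!: sum.cong)
      then have "a - Poly_Mapping.single i 1 \<in> exponents (Suc r) m" using a by (simp add: exponents_def)
      then show ?thesis by (intro poly_space_cmult monomial_in_poly_space finite_exponents)
    qed (simp add: poly_space_0)
  qed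
  finally show ?thesis .
qed

lemma poly_space_coord_mult:
  assumes "u \<in> poly_space (exponents (Suc r) m)"
  shows "(\<lambda>x. x $ i * u x) \<in> poly_space (exponents r m)"
proof -
  obtain c where u: "u = (\<lambda>x. \<Sum>a\<in>exponents (Suc r) m. c a * monomial a x)" using assms by (auto simp: poly_space_def)
  have mon: "x $ i * monomial a x = monomial (a + Poly_Mapping.single i 1) x" for a x
    unfolding monomial_def
    by (subst (1 2) prod.remove[of UNIV i]) (auto simp: lookup_add lookup_single intro!: prod.cong)
  have "(\<lambda>x. x $ i * u x) = (\<lambda>x. \<Sum>a\<in>exponents (Suc r) m. c a * monomial (a + Poly_Mapping.single i 1) x)"
    by (simp add: u sum_distrib_left mult.left_commute[of _ "c _"] mon)
  also have "\<dots> \<in> poly_space (exponents r m)"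
  proof (intro poly_space_sum poly_space_cmult monomial_in_poly_space finite_exponents)
    fix a :: "'a \<Rightarrow>\<^sub>0 nat" assume a: "a \<in> exponents (Suc r) m"
    have "(\<Sum>j\<in>UNIV. Poly_Mapping.lookup (a + Poly_Mapping.single i 1) j) = (\<Sum>j\<in>UNIV. Poly_Mapping.lookup a j) + 1"
      by (subst (1 2) sum.remove[of UNIV i]) (auto simp: lookup_add lookup_single intro!: sum.cong)
    then show "a + Poly_Mapping.single i 1 \<in> exponents r m" using a by (simp add: exponents_def)
  qed
  finally show ?thesis .
qed

text \<open>Monomials are eigenfunctions of this operator, so it preserves the span of any finite
  set of them.\<close>

lemma poly_space_euler:
  assumes "u \<in> poly_space K" "finite K"
  shows "(\<lambda>x. x $ i * partial_deriv i u x) \<in> poly_space K"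
proof -
  obtain c where u: "u = (\<lambda>x. \<Sum>a\<in>K. c a * monomial a x)" using assms by (auto simp: poly_space_def)
  have "(\<lambda>x. x $ i * partial_deriv i u x) = (\<lambda>x. \<Sum>a\<in>K. c a * (real (Poly_Mapping.lookup a i) * monomial a x))"
  proof
    fix x
    have "partial_deriv i u x = (\<Sum>a\<in>K. partial_deriv i (\<lambda>x. c a * monomial a x) x)"
      unfolding u by (intro partial_deriv_sum differentiable_at_real_polynomial_function real_polynomial_function.intros(2,4) real_polynomial_function_monomial)
    also have "\<dots> = (\<Sum>a\<in>K. c a * partial_deriv i (monomial a) x)"
      by (simp add: partial_deriv_cmult differentiable_at_real_polynomial_function real_polynomial_function_monomial)
    finally show "x $ i * partial_deriv i u x = (\<Sum>a\<in>K. c a * (real (Poly_Mapping.lookup a i) * monomial a x))"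
      by (simp add: sum_distrib_left mult.left_commute[of _ "c _"] partial_deriv_monomial(2))
  qed
  also have "\<dots> \<in> poly_space K"
    by (intro poly_space_sum poly_space_cmult monomial_in_poly_space assms(2))
  finally show ?thesis .
qed

lemma poly_space_const: "(\<lambda>x. t) \<in> poly_space (exponents 0 m)"
proof -
  have "(\<lambda>x. t * monomial 0 x) \<in> poly_space (exponents 0 m)"
    by (intro poly_space_cmult monomial_in_poly_space finite_exponents) (simp add: exponents_def)
  then show ?thesis by (simp add: monomial_def)
qed

lemma poly_space_exponents_mono: "r' \<le> r \<Longrightarrow> poly_space (exponents r m) \<subseteq> poly_space (exponents r' m)"
  by (intro poly_space_subset monomial_in_poly_space finite_exponents) (auto simp: exponents_def)

lemma eval_mpoly_in_poly_space:
  assumes "finite K" "Poly_Mapping.keys p \<subseteq> K"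
  shows "eval_mpoly p \<in> poly_space K"
proof -
  have "eval_mpoly p x = (\<Sum>a\<in>Poly_Mapping.keys p. Poly_Mapping.lookup p a * monomial a x)" for x
    by (simp add: eval_mpoly_def monomial_def)
  then have "eval_mpoly p = (\<lambda>x. \<Sum>a\<in>Poly_Mapping.keys p. Poly_Mapping.lookup p a * monomial a x)" by blast
  then show ?thesis
    using assms by (auto intro!: poly_space_sum poly_space_cmult monomial_in_poly_space)
qed

lemma poly_space_eq_eval_mpoly:
  assumes "u \<in> poly_space K" "finite K"
  obtains p where "Poly_Mapping.keys p \<subseteq> K" "eval_mpoly p = u"
proof -
  obtain c where u: "u = (\<lambda>x. \<Sum>a\<in>K. c a * monomial a x)" using assms by (auto simp: poly_space_def)
  define p where "p = Abs_poly_mapping (\<lambda>a. if a \<in> K then c a else 0)"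
  have "finite {a. (if a \<in> K then c a else 0) \<noteq> 0}" by (rule finite_subset[OF _ assms(2)]) auto
  then have lp: "Poly_Mapping.lookup p a = (if a \<in> K then c a else 0)" for a by (simp add: p_def)
  have keys: "Poly_Mapping.keys p \<subseteq> K" by (auto simp: in_keys_iff lp split: if_splits)
  have "eval_mpoly p x = u x" for x
  proof -
    have "eval_mpoly p x = (\<Sum>a\<in>Poly_Mapping.keys p. Poly_Mapping.lookup p a * monomial a x)"
      by (simp add: eval_mpoly_def monomial_def)
    also have "\<dots> = (\<Sum>a\<in>K. Poly_Mapping.lookup p a * monomial a x)"
      using keys assms(2) by (intro sum.mono_neutral_left) (auto simp: in_keys_iff)
    finally show ?thesis by (simp add: u lp)
  qed
  then show ?thesis using that keys by blast
qed

text \<open>Degree minus infinity for the zero polynomial corresponds to an empty set of keys, so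
  there is no exception, not even for \<open>m < r\<close>.\<close>

lemma mdegree_le_iff: "mdegree p + ereal (real r) \<le> ereal (real m) \<longleftrightarrow> Poly_Mapping.keys p \<subseteq> exponents r m"
proof (cases "p = 0")
  case True
  then show ?thesis by (simp add: mdegree_def)
next
  case False
  define d where "d = (\<lambda>a :: 'a \<Rightarrow>\<^sub>0 nat. \<Sum>i\<in>UNIV. Poly_Mapping.lookup a i)"
  have fin: "finite (d ` Poly_Mapping.keys p)" by simp
  have "d ` Poly_Mapping.keys p \<noteq> {}" using False by simp
  then have "Max (d ` Poly_Mapping.keys p) \<in> d ` Poly_Mapping.keys p" by (rule Max_in[OF fin])
  then obtain b where b: "b \<in> Poly_Mapping.keys p" "Max (d ` Poly_Mapping.keys p) = d b" by auto
  have le: "d a \<le> d b" if "a \<in> Poly_Mapping.keys p" for a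
    using Max_ge[OF fin imageI[OF that]] b(2) by simp
  have "mdegree p = ereal (real (d b))" using False b(2) by (simp add: mdegree_def d_def)
  then have "mdegree p + ereal (real r) \<le> ereal (real m) \<longleftrightarrow> d b + r \<le> m"
    by (simp flip: of_nat_add)
  also have "\<dots> \<longleftrightarrow> (\<forall>a\<in>Poly_Mapping.keys p. d a + r \<le> m)"
    using b(1) le by (meson add_le_mono1 order_trans)
  finally show ?thesis by (auto simp: exponents_def d_def)
qed

lemma Ck_on_real_polynomial_function:
  "real_polynomial_function p \<Longrightarrow> Ck_on k p U" for p :: "real^'n::finite \<Rightarrow> real"
proof (induction k arbitrary: p)
  case 0
  then show ?case by (simp add: continuous_on_polymonial_function real_polynomial_function_eq)
next
  case (Suc k)
  then show ?case
    by (simp add: real_polynomial_function_partial_deriv differentiable_at_imp_differentiable_on differentiable_at_real_polynomial_function)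
qed

lemma real_polynomial_function_eval_mpoly: "real_polynomial_function (eval_mpoly p)"
  by (rule real_polynomial_function_poly_space[OF eval_mpoly_in_poly_space[of "Poly_Mapping.keys p"]]) auto

lemma partial_derivs_zero_imp_const:
  fixes h :: "real^'n::finite \<Rightarrow> real"
  assumes h: "\<And>x. h differentiable at x" and z: "\<And>i x. partial_deriv i h x = 0"
  shows "h x = h 0"
proof -
  have "(h has_derivative (\<lambda>v. 0)) (at x)" for x
  proof -
    obtain h' where h': "(h has_derivative h') (at x)" using h by (auto simp: differentiable_def)
    then have l: "linear h'" by (rule has_derivative_linear)
    have "h' v = 0" for v
    proof -
      have "h' v = h' (\<Sum>i\<in>UNIV. (v $ i) *\<^sub>R axis i 1)"
        using basis_expansion[of v] by (simp add: scalar_mult_eq_scaleR)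
      also have "\<dots> = (\<Sum>i\<in>UNIV. (v $ i) *\<^sub>R h' (axis i 1))"
        using l by (simp add: linear_sum linear_scale)
      also have "\<dots> = 0" using z partial_deriv_eq[OF h'] by simp
      finally show ?thesis .
    qed
    then have "h' = (\<lambda>v. 0)" by auto
    then show ?thesis using h' by simp
  qed
  then show ?thesis by (metis has_derivative_zero_unique_connected UNIV_I connected_UNIV open_UNIV)
qed

text \<open>Scaling is given explicitly for the \<open>vector_space\<close> locale; addition is the
  pointwise one of \<open>Function_Algebras\<close>, taken in both components.\<close>

definition pair_scale :: "real \<Rightarrow> ('x \<Rightarrow> real) \<times> ('x \<Rightarrow> real) \<Rightarrow> ('x \<Rightarrow> real) \<times> ('x \<Rightarrow> real)" where
  "pair_scale t p = (\<lambda>x. t * fst p x, \<lambda>x. t * snd p x)"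

interpretation pair_space: vector_space pair_scale
  by unfold_locales (auto simp: pair_scale_def algebra_simps fun_eq_iff)

subsection \<open>The Neumann problem\<close>

lemma gradient_inner_gradient_quad:
  "gradient h x \<bullet> gradient (quad \<beta>) x = (\<Sum>k\<in>UNIV. partial_deriv k h x * (2 * \<beta> $ k * x $ k))"
  by (simp add: inner_vec_def gradient_quad) (simp add: gradient_def)

lemma finite_spanning_set_pair:
  fixes K L :: "('n::finite \<Rightarrow>\<^sub>0 nat) set"
  assumes "finite K" "finite L"
  obtains G where "finite G" "poly_space K \<times> poly_space L \<subseteq> pair_space.span G"
proof
  let ?G = "(\<lambda>a. (monomial a, \<lambda>x. 0)) ` K \<union> (\<lambda>a. (\<lambda>x. 0, monomial a)) ` L"
  show "finite ?G" using assms by simp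
  show "poly_space K \<times> poly_space L \<subseteq> pair_space.span ?G"
  proof clarify
    fix u v assume "u \<in> poly_space K" "v \<in> poly_space L"
    then obtain c d where u: "u = (\<lambda>x. \<Sum>a\<in>K. c a * monomial a x)" and v: "v = (\<lambda>x. \<Sum>a\<in>L. d a * monomial a x)"
      unfolding poly_space_def by blast
    have "(u, v) = (\<Sum>a\<in>K. pair_scale (c a) (monomial a, \<lambda>x. 0)) + (\<Sum>a\<in>L. pair_scale (d a) (\<lambda>x. 0, monomial a))"
    proof (rule prod_eqI)
      have 1: "fst (sum F A) x = (\<Sum>a\<in>A. fst (F a) x)" "snd (sum F A) x = (\<Sum>a\<in>A. snd (F a) x)"
        for A x and F :: "_ \<Rightarrow> (real^'n \<Rightarrow> real) \<times> (real^'n \<Rightarrow> real)"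
        by (induction A rule: infinite_finite_induct) auto
      show "fst (u, v) = fst ((\<Sum>a\<in>K. pair_scale (c a) (monomial a, \<lambda>x. 0)) + (\<Sum>a\<in>L. pair_scale (d a) (\<lambda>x. 0, monomial a)))"
        "snd (u, v) = snd ((\<Sum>a\<in>K. pair_scale (c a) (monomial a, \<lambda>x. 0)) + (\<Sum>a\<in>L. pair_scale (d a) (\<lambda>x. 0, monomial a)))"
        by (auto simp: 1 u v pair_scale_def)
    qed
    also have "\<dots> \<in> pair_space.span ?G"
      by (rule pair_space.span_add; rule pair_space.span_sum; rule pair_space.span_scale; rule pair_space.span_base) auto
    finally show "(u, v) \<in> pair_space.span ?G" .
  qed
qed

context positive_weights
begin

section \<open>Green's identities and the kernel of the Neumann problem\<close>

definition bd_int :: "(real^'n \<Rightarrow> real) \<Rightarrow> real" where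
  "bd_int f = (\<integral>x. indicator (ellipsoid_bd \<beta>) x * f x \<partial>weighted_area)"

lemma bd_int_cong: "(\<And>x. x \<in> ellipsoid_bd \<beta> \<Longrightarrow> f x = g x) \<Longrightarrow> bd_int f = bd_int g"
  unfolding bd_int_def by (intro Bochner_Integration.integral_cong) (auto simp: indicator_def)

lemma integrable_bd:
  assumes "real_polynomial_function f"
  shows "integrable weighted_area (\<lambda>x. indicator (ellipsoid_bd \<beta>) x * f x)"
proof -
  have [measurable]: "f \<in> borel_measurable borel" using assms by (rule borel_measurable_real_polynomial_function)
  show ?thesis
    using continuous_on_eq[OF continuous_on_real_polynomial_function[OF assms, of "ellipsoid_bd \<beta>"], of "\<lambda>x. indicator (ellipsoid_bd \<beta>) x * f x"]
    by (intro integrable_weighted_area) auto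
qed

lemma bd_int_add: "real_polynomial_function f \<Longrightarrow> real_polynomial_function g \<Longrightarrow> bd_int (\<lambda>x. f x + g x) = bd_int f + bd_int g"
  unfolding bd_int_def by (simp add: distrib_left integrable_bd)

lemma bd_int_cmult: "bd_int (\<lambda>x. c * f x) = c * bd_int f"
  unfolding bd_int_def by (simp add: mult.left_commute)

text \<open>Green's first identity: the divergence theorem for \<open>u\<close> times the gradient
  of \<open>h\<close>. Against \<open>weighted_area\<close> the normal derivative becomes the
  polynomial \<nabla>h . \<nabla>q.\<close>

lemma green_identity:
  assumes h: "real_polynomial_function h" and u: "real_polynomial_function u"
  shows "bd_int (\<lambda>x. u x * (gradient h x \<bullet> gradient (quad \<beta>) x))
       = solid_int (\<lambda>x. u x * laplacian h x + (\<Sum>k\<in>UNIV. partial_deriv k u x * partial_deriv k h x))"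
proof -
  note p = real_polynomial_function_partial_deriv
  have F: "real_polynomial_function (\<lambda>x. u x * partial_deriv k h x)" for k
    by (intro real_polynomial_function.intros(4) u p h)
  have "(\<integral>x. indicator (ellipsoid_bd \<beta>) x * (\<Sum>k\<in>UNIV. u x * partial_deriv k h x * (2 * \<beta> $ k * x $ k)) \<partial>weighted_area)
    = (\<integral>x. indicator (ellipsoid \<beta>) x * (\<Sum>k\<in>UNIV. partial_deriv k (\<lambda>x. u x * partial_deriv k h x) x) \<partial>lborel)"
    by (rule divergence_theorem[of UNIV])
      (auto intro!: continuous_on_real_polynomial_function p F differentiable_at_imp_differentiable_on differentiable_at_real_polynomial_function)
  moreover have "partial_deriv k (\<lambda>x. u x * partial_deriv k h x) x
      = partial_deriv k u x * partial_deriv k h x + u x * partial_deriv k (partial_deriv k h) x" for k x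
    by (intro partial_deriv_mult differentiable_at_real_polynomial_function u p h)
  ultimately show ?thesis
    unfolding bd_int_def solid_int_def gradient_inner_gradient_quad laplacian_def
    by (simp add: sum_distrib_left sum.distrib mult.assoc add.commute)
qed

lemma green_flux:
  assumes h: "real_polynomial_function h"
  shows "bd_int (\<lambda>x. gradient h x \<bullet> gradient (quad \<beta>) x) = solid_int (laplacian h)"
  using green_identity[OF h real_polynomial_function.intros(2)[of 1]] by simp

text \<open>By continuity the points of the ellipsoid where \<open>p\<close> is nonzero form an open
  set; the vanishing integral makes it null, hence empty.\<close>

lemma solid_int_eq_0_imp:
  assumes p: "continuous_on UNIV p" "\<And>x. p x \<ge> 0" and 0: "solid_int p = 0" and x: "x \<in> ellipsoid \<beta>"
  shows "p x = 0"
proof (rule ccontr)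
  assume "p x \<noteq> 0"
  define U where "U = ellipsoid \<beta> \<inter> p -` (- {0})"
  have "open U"
    unfolding U_def by (intro open_Int open_ellipsoid open_vimage p) auto
  moreover have "x \<in> U" using x \<open>p x \<noteq> 0\<close> by (simp add: U_def)
  ultimately have "\<not> negligible U" using open_not_negligible by blast
  have "integrable lborel (\<lambda>x. indicator (ellipsoid \<beta>) x * p x)"
    by (intro integrable_solid continuous_on_subset[OF p(1)]) auto
  then have "AE x in lborel. indicator (ellipsoid \<beta>) x * p x = 0"
    using 0 p(2) unfolding solid_int_def by (subst integral_nonneg_eq_0_iff_AE[symmetric]) auto
  then have "AE x in lborel. x \<notin> U"
    by eventually_elim (auto simp: U_def)
  then have "U \<in> null_sets lborel"
    using \<open>open U\<close> by (subst AE_iff_null_sets) auto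
  then have "negligible U" by (simp add: negligible_iff_null_sets null_sets_completionI)
  then show False using \<open>\<not> negligible U\<close> by simp
qed

text \<open>For the field F(x) = x the divergence theorem says that twice this integral is the
  dimension times the volume of the ellipsoid.\<close>

lemma bd_int_1_nonzero: "bd_int (\<lambda>x. 1) \<noteq> 0"
proof
  assume 0: "bd_int (\<lambda>x. 1) = 0"
  have "(\<integral>x. indicator (ellipsoid_bd \<beta>) x * (\<Sum>k\<in>UNIV. x $ k * (2 * \<beta> $ k * x $ k)) \<partial>weighted_area)
    = (\<integral>x. indicator (ellipsoid \<beta>) x * (\<Sum>k\<in>UNIV. partial_deriv k (\<lambda>x. x $ k) x) \<partial>lborel)"
    by (rule divergence_theorem[of UNIV])
      (auto intro!: continuous_on_real_polynomial_function real_polynomial_function_partial_deriv differentiable_at_imp_differentiable_on differentiable_at_real_polynomial_function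
        simp del: partial_deriv_coord)
  moreover have "bd_int (\<lambda>x. \<Sum>k\<in>UNIV. x $ k * (2 * \<beta> $ k * x $ k)) = bd_int (\<lambda>x. 2 * 1)"
  proof (rule bd_int_cong)
    fix x assume "x \<in> ellipsoid_bd \<beta>"
    have "(\<Sum>k\<in>UNIV. x $ k * (2 * \<beta> $ k * x $ k)) = 2 * quad \<beta> x"
      unfolding quad_def sum_distrib_left by (intro sum.cong) (auto simp: power2_eq_square)
    then show "(\<Sum>k\<in>UNIV. x $ k * (2 * \<beta> $ k * x $ k)) = 2 * 1"
      using \<open>x \<in> ellipsoid_bd \<beta>\<close> by (simp add: ellipsoid_bd_def)
  qed
  ultimately have "solid_int (\<lambda>x. real CARD('n)) = 0"
    using 0 unfolding bd_int_cmult by (simp add: bd_int_def solid_int_def)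
  then have "real CARD('n) = 0"
    by (rule solid_int_eq_0_imp[OF continuous_on_const _ _ zero_in_ellipsoid, rotated]) simp
  then show False by simp
qed

lemma zero_on_ellipsoid_imp_zero:
  "real_polynomial_function p \<Longrightarrow> (\<And>x. x \<in> ellipsoid \<beta> \<Longrightarrow> p x = 0) \<Longrightarrow> p x = 0"
  using real_polynomial_function_zero_on_open[OF _ open_ellipsoid zero_in_ellipsoid] by blast

text \<open>Energy argument: Green's identity with \<open>u = h\<close> makes the integral of
  |\<nabla>h|^2 zero. So the gradient vanishes on the ellipsoid and, being polynomial,
  everywhere.\<close>

lemma neumann_kernel:
  assumes h: "real_polynomial_function h" and "\<And>x. laplacian h x = 0"
    and "\<And>x. x \<in> ellipsoid_bd \<beta> \<Longrightarrow> gradient h x \<bullet> gradient (quad \<beta>) x = 0"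
  shows "h x = h 0"
proof (rule partial_derivs_zero_imp_const)
  note p = real_polynomial_function_partial_deriv[OF h]
  show "h differentiable at x" for x using h by (rule differentiable_at_real_polynomial_function)
  let ?S = "\<lambda>x. \<Sum>k\<in>UNIV. partial_deriv k h x * partial_deriv k h x"
  have "bd_int (\<lambda>x. h x * (gradient h x \<bullet> gradient (quad \<beta>) x)) = bd_int (\<lambda>x. 0)"
    using assms(3) by (intro bd_int_cong) simp
  then have "solid_int ?S = 0" unfolding green_identity[OF h h] using assms(2) by (simp add: bd_int_def)
  moreover have "continuous_on UNIV ?S"
    by (intro continuous_on_sum continuous_on_mult continuous_on_real_polynomial_function p)
  ultimately have "?S x = 0" if "x \<in> ellipsoid \<beta>" for x
    using that by (intro solid_int_eq_0_imp[of ?S]) (auto intro: sum_nonneg)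
  then have "partial_deriv i h x = 0" if "x \<in> ellipsoid \<beta>" for i x
    using that by (simp add: sum_nonneg_eq_0_iff)
  then show "partial_deriv i h x = 0" for i x by (rule zero_on_ellipsoid_imp_zero[OF p])
qed

text \<open>With \<open>r\<close> an auxiliary polynomial of degree at most \<open>m - 2\<close>, the operator
  \<open>(r, h) \<mapsto> (\<Delta>h, \<nabla>h \<bullet> \<nabla>q + (q - 1) r + h 0)\<close> maps a finite-dimensional space into itself, and the term
  \<open>h 0\<close> makes it injective; the compatibility condition then forces \<open>h 0 = 0\<close>.\<close>

lemma neumann_solvable:
  assumes f: "f \<in> poly_space (exponents 0 m)" and g: "g \<in> poly_space (exponents 2 m)"
    and fg: "bd_int f = solid_int g"
  shows "\<exists>h\<in>poly_space (exponents 0 m). (\<forall>x. laplacian h x = g x) \<and>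
    (\<forall>x\<in>ellipsoid_bd \<beta>. gradient h x \<bullet> gradient (quad \<beta>) x = f x)"
proof -
  note pp = real_polynomial_function_partial_deriv
  define V :: "((real^'n \<Rightarrow> real) \<times> (real^'n \<Rightarrow> real)) set"
    where "V = poly_space (exponents 2 m) \<times> poly_space (exponents 0 m)"
  \<comment> \<open>The equation for f is imposed only where q = 1, and \<open>r\<close> stands for
    the unknown multiple of q - 1. Its degree bound is that of the Laplacian of \<open>h\<close>,
    which makes domain and range the same space.\<close>
  define T :: "(real^'n \<Rightarrow> real) \<times> (real^'n \<Rightarrow> real) \<Rightarrow> (real^'n \<Rightarrow> real) \<times> (real^'n \<Rightarrow> real)"
    where "T = (\<lambda>(r, h). (laplacian h, \<lambda>x. gradient h x \<bullet> gradient (quad \<beta>) x + (quad \<beta> x - 1) * r x + h 0))"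
  have Vp: "real_polynomial_function r" "real_polynomial_function h" if "(r, h) \<in> V" for r h
    using that by (auto simp: V_def intro: real_polynomial_function_poly_space)
  have pd_add: "partial_deriv i (\<lambda>x. u x + v x) = (\<lambda>x. partial_deriv i u x + partial_deriv i v x)"
    and pd_cmult: "partial_deriv i (\<lambda>x. c * u x) = (\<lambda>x. c * partial_deriv i u x)"
    if "real_polynomial_function u" "real_polynomial_function v" for i u v c
    using that by (auto intro!: ext partial_deriv_add partial_deriv_cmult differentiable_at_real_polynomial_function)
  have subV: "pair_space.subspace V"
    by (rule pair_space.subspaceI)
      (auto simp: V_def pair_scale_def zero_prod_def zero_fun_def plus_fun_def
        intro: poly_space_0 poly_space_add poly_space_cmult)
  obtain G where G: "finite G" "V \<subseteq> pair_space.span G"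
    using finite_spanning_set_pair[OF finite_exponents finite_exponents] unfolding V_def by metis
  have TV: "T p \<in> V" if "p \<in> V" for p
  proof -
    obtain r h where p: "p = (r, h)" by (cases p)
    have r: "r \<in> poly_space (exponents 2 m)" and h: "h \<in> poly_space (exponents 0 m)" using that by (auto simp: V_def p)
    have "laplacian h = (\<lambda>x. \<Sum>i\<in>UNIV. partial_deriv i (partial_deriv i h) x)" by (auto simp: laplacian_def)
    moreover have "partial_deriv i (partial_deriv i h) \<in> poly_space (exponents 2 m)" for i
      using poly_space_partial_deriv[OF poly_space_partial_deriv[OF h]] by (simp add: numeral_2_eq_2)
    ultimately have 1: "laplacian h \<in> poly_space (exponents 2 m)" by (simp add: poly_space_sum)
    \<comment> \<open>Written with the operators x_i \<partial>_i and with two coordinate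
      multiplications of \<open>r\<close>, the second component visibly has degree at most
      \<open>m\<close>.\<close>
    have e: "(\<lambda>x. gradient h x \<bullet> gradient (quad \<beta>) x + (quad \<beta> x - 1) * r x + h 0)
      = (\<lambda>x. (\<Sum>i\<in>UNIV. 2 * \<beta> $ i * (x $ i * partial_deriv i h x)) + (\<Sum>i\<in>UNIV. \<beta> $ i * (x $ i * (x $ i * r x)))
          + (- 1) * r x + h 0)"
    proof
      fix x
      have "quad \<beta> x * r x = (\<Sum>i\<in>UNIV. \<beta> $ i * (x $ i * (x $ i * r x)))"
        by (simp add: quad_def sum_distrib_right power2_eq_square mult.assoc)
      moreover have "gradient h x \<bullet> gradient (quad \<beta>) x = (\<Sum>i\<in>UNIV. 2 * \<beta> $ i * (x $ i * partial_deriv i h x))"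
        unfolding gradient_inner_gradient_quad by (intro sum.cong) auto
      ultimately show "gradient h x \<bullet> gradient (quad \<beta>) x + (quad \<beta> x - 1) * r x + h 0
        = (\<Sum>i\<in>UNIV. 2 * \<beta> $ i * (x $ i * partial_deriv i h x)) + (\<Sum>i\<in>UNIV. \<beta> $ i * (x $ i * (x $ i * r x)))
          + (- 1) * r x + h 0"
        by (simp add: left_diff_distrib)
    qed
    have r2: "(\<lambda>x. x $ i * (x $ i * r x)) \<in> poly_space (exponents 0 m)" for i
      by (intro poly_space_coord_mult) (use r in \<open>simp add: numeral_2_eq_2\<close>)
    have r0: "r \<in> poly_space (exponents 0 m)" using r poly_space_exponents_mono[of 0 2 m] by auto
    have "(\<lambda>x. gradient h x \<bullet> gradient (quad \<beta>) x + (quad \<beta> x - 1) * r x + h 0) \<in> poly_space (exponents 0 m)"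
      unfolding e by (rule poly_space_add[OF poly_space_add[OF poly_space_add[OF
          poly_space_sum[OF poly_space_cmult[OF poly_space_euler[OF h finite_exponents]]]
          poly_space_sum[OF poly_space_cmult[OF r2]]] poly_space_cmult[OF r0]] poly_space_const])
    with 1 show ?thesis by (simp add: T_def V_def p)
  qed
  have Tadd: "T (p + p') = T p + T p'" if "p \<in> V" "p' \<in> V" for p p'
  proof -
    obtain r h r' h' where p: "p = (r, h)" "p' = (r', h')" by (cases p; cases p')
    have h: "real_polynomial_function h" "real_polynomial_function h'" using that Vp by (auto simp: p)
    show ?thesis
      by (simp add: T_def p plus_fun_def laplacian_def gradient_inner_gradient_quad pd_add[OF h] pd_add[OF pp[OF h(1)] pp[OF h(2)]]
          sum.distrib distrib_left distrib_right fun_eq_iff)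
  qed
  have Tcmult: "T (pair_scale c p) = pair_scale c (T p)" if "p \<in> V" for c p
  proof -
    obtain r h where p: "p = (r, h)" by (cases p)
    have h: "real_polynomial_function h" using that Vp by (auto simp: p)
    show ?thesis
      by (simp add: T_def p pair_scale_def laplacian_def gradient_inner_gradient_quad pd_cmult[OF h h] pd_cmult[OF pp[OF h] pp[OF h]]
          sum_distrib_left distrib_left fun_eq_iff mult.assoc mult.left_commute[of _ c])
  qed
  \<comment> \<open>Integrated over the boundary, the term with q - 1 drops out and Green's identity
    turns the gradient term into \<open>solid_int g'\<close>; what remains is \<open>h 0\<close>
    times the nonzero total mass of the boundary.\<close>
  have const: "h 0 = 0"
    if V: "(r, h) \<in> V" and T: "T (r, h) = (g', f')" and eq: "bd_int f' = solid_int g'" for r h g' f'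
  proof -
    have h: "real_polynomial_function h" using Vp[OF V] by simp
    have grad: "real_polynomial_function (\<lambda>x. gradient h x \<bullet> gradient (quad \<beta>) x)"
      unfolding gradient_inner_gradient_quad
      by (intro real_polynomial_function_sum real_polynomial_function.intros(2,4) real_polynomial_function_coord pp h) simp
    have "bd_int f' = bd_int (\<lambda>x. gradient h x \<bullet> gradient (quad \<beta>) x + h 0)"
      using T by (intro bd_int_cong) (auto simp: T_def ellipsoid_bd_def)
    also have "\<dots> = bd_int (\<lambda>x. gradient h x \<bullet> gradient (quad \<beta>) x) + bd_int (\<lambda>x. h 0 * 1)"
      using bd_int_add[OF grad real_polynomial_function.intros(2)[of "h 0"]] by simp
    also have "\<dots> = solid_int g' + h 0 * bd_int (\<lambda>x. 1)"
      using T by (simp only: green_flux[OF h] bd_int_cmult) (simp add: T_def)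
    finally show ?thesis using eq bd_int_1_nonzero by simp
  qed
  have inj: "p = 0" if p: "p \<in> V" and T0: "T p = 0" for p
  proof -
    obtain r h where rh: "p = (r, h)" by (cases p)
    have T: "T (r, h) = ((\<lambda>x. 0), (\<lambda>x. 0))" using T0 by (simp add: rh zero_prod_def zero_fun_def)
    have V: "(r, h) \<in> V" using p rh by simp
    have h0: "h 0 = 0" by (rule const[OF V T]) (simp add: bd_int_def solid_int_def)
    have lap: "laplacian h x = 0" for x using T by (auto simp: T_def dest: fun_cong)
    have bd: "gradient h x \<bullet> gradient (quad \<beta>) x + (quad \<beta> x - 1) * r x = 0" for x
      using T h0 by (auto simp: T_def dest: fun_cong)
    have "gradient h x \<bullet> gradient (quad \<beta>) x = 0" if "x \<in> ellipsoid_bd \<beta>" for x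
      using bd[of x] that by (simp add: ellipsoid_bd_def)
    then have "h x = h 0" for x by (rule neumann_kernel[OF Vp(2)[OF V] lap])
    then have h: "h = (\<lambda>x. 0)" using h0 by auto
    have "gradient h x = 0" for x by (simp add: h gradient_def vec_eq_iff)
    then have rz: "(quad \<beta> x - 1) * r x = 0" for x using bd[of x] by simp
    have "r x = 0" if "x \<in> ellipsoid \<beta>" for x using rz[of x] that by (auto simp: ellipsoid_def)
    then have "r x = 0" for x by (rule zero_on_ellipsoid_imp_zero[OF Vp(1)[OF V]])
    then show ?thesis using h by (simp add: rh zero_prod_def zero_fun_def fun_eq_iff)
  qed
  have "(g, f) \<in> V" using f g by (simp add: V_def)
  then obtain p where p: "p \<in> V" "T p = (g, f)"
    using pair_space.injective_endomorphism_surjective[OF subV G TV Tadd Tcmult inj] by blast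
  obtain r h where rh: "p = (r, h)" by (cases p)
  have "h 0 = 0" using const[of r h g f] p fg by (simp add: rh)
  then have "laplacian h = g" "\<And>x. x \<in> ellipsoid_bd \<beta> \<Longrightarrow> gradient h x \<bullet> gradient (quad \<beta>) x = f x"
    using p(2) by (auto simp: rh T_def ellipsoid_bd_def)
  moreover have "h \<in> poly_space (exponents 0 m)" using p(1) by (simp add: rh V_def)
  ultimately show ?thesis by blast
qed

section \<open>Translation into the three conditions of the theorem\<close>

lemma compatibility_condition_iff:
  "(LINT x:ellipsoid_bd \<beta>|surface_measure (ellipsoid_bd \<beta>). eval_mpoly f x / norm (gradient (quad \<beta>) x))
      = (LINT x:ellipsoid \<beta>|lborel. eval_mpoly g x)
    \<longleftrightarrow> bd_int (eval_mpoly f) = solid_int (eval_mpoly g)"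
  unfolding surface_integral_eq[OF borel_measurable_real_polynomial_function[OF real_polynomial_function_eval_mpoly]] bd_int_def solid_int_def
  by (simp add: set_lebesgue_integral_def)

lemma normal_deriv_eq: "normal_deriv \<beta> h x = (gradient h x \<bullet> gradient (quad \<beta>) x) / norm (gradient (quad \<beta>) x)"
  by (simp add: normal_deriv_def outward_normal_def divide_inverse)

lemma mdegree_bound:
  fixes f g :: "'n mpoly"
  assumes "f \<noteq> 0 \<or> g \<noteq> 0"
  obtains m where "max (mdegree f) (2 + mdegree g) = ereal (real m)"
proof -
  have d: "\<exists>k. mdegree p = ereal (real k)" if "p \<noteq> 0" for p :: "'n mpoly"
    using that by (simp add: mdegree_def)
  have z: "mdegree (0 :: 'n mpoly) = - \<infinity>" by (simp add: mdegree_def)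
  have two: "(2 :: ereal) + ereal (real k) = ereal (real (k + 2))" "(2 :: ereal) + - \<infinity> = - \<infinity>" for k
    by (simp_all add: numeral_eq_ereal)
  consider "f = 0" "g \<noteq> 0" | "f \<noteq> 0" "g = 0" | "f \<noteq> 0" "g \<noteq> 0" using assms by blast
  then show ?thesis
  proof cases
    case 1
    then obtain k where "mdegree g = ereal (real k)" using d by blast
    then have "max (mdegree f) (2 + mdegree g) = ereal (real (k + 2))" unfolding 1(1) z by (simp add: two max_def)
    then show ?thesis by (rule that)
  next
    case 2
    then obtain k where "mdegree f = ereal (real k)" using d by blast
    then have "max (mdegree f) (2 + mdegree g) = ereal (real k)" unfolding 2(2) z by (simp add: two max_def)
    then show ?thesis by (rule that)
  next
    case 3
    then obtain k l where kl: "mdegree f = ereal (real k)" "mdegree g = ereal (real l)" using d by blast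
    have "max (mdegree f) (2 + mdegree g) = ereal (real (max k (l + 2)))"
      unfolding kl two by (simp add: max_def)
    then show ?thesis by (rule that)
  qed
qed

lemma compatible_imp_polynomial_solution:
  assumes fg: "bd_int (eval_mpoly f) = solid_int (eval_mpoly g)"
  shows "\<exists>h :: 'n mpoly. mdegree h \<le> max (mdegree f) (2 + mdegree g) \<and>
        (\<forall>x. laplacian (eval_mpoly h) x = eval_mpoly g x) \<and>
        (\<forall>x\<in>ellipsoid_bd \<beta>. gradient (eval_mpoly h) x \<bullet> gradient (quad \<beta>) x = eval_mpoly f x)"
\<comment> \<open>If both are zero the degree bound is minus infinity and no natural number
  \<open>m\<close> represents it; only the zero polynomial is then allowed as
  \<open>h\<close>.\<close>
proof (cases "f = 0 \<and> g = 0")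
  case True
  have e: "eval_mpoly (0 :: 'n mpoly) = (\<lambda>x. 0)" by (auto simp: eval_mpoly_def)
  have pd: "partial_deriv i (\<lambda>x :: real^'n. 0) = (\<lambda>x. 0)" for i by auto
  have "mdegree (0 :: 'n mpoly) = - \<infinity>" by (simp add: mdegree_def)
  then show ?thesis
    using True by (intro exI[of _ 0]) (simp add: e laplacian_def gradient_inner_gradient_quad pd)
next
  case False
  then obtain m where m: "max (mdegree f) (2 + mdegree g) = ereal (real m)"
    using mdegree_bound[of f g] by blast
  have "Poly_Mapping.keys f \<subseteq> exponents 0 m"
    using m mdegree_le_iff[of f 0 m] by (metis add.right_neutral max.cobounded1 of_nat_0 zero_ereal_def)
  moreover have "Poly_Mapping.keys g \<subseteq> exponents 2 m"
    using m mdegree_le_iff[of g 2 m] by (metis add.commute max.cobounded2 numeral_eq_ereal of_nat_numeral)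
  ultimately obtain h where h: "h \<in> poly_space (exponents 0 m)" "\<forall>x. laplacian h x = eval_mpoly g x"
    "\<forall>x\<in>ellipsoid_bd \<beta>. gradient h x \<bullet> gradient (quad \<beta>) x = eval_mpoly f x"
    using neumann_solvable[OF _ _ fg, of m] by (metis eval_mpoly_in_poly_space finite_exponents)
  obtain p where p: "Poly_Mapping.keys p \<subseteq> exponents 0 m" "eval_mpoly p = h"
    by (rule poly_space_eq_eval_mpoly[OF h(1) finite_exponents])
  have "mdegree p \<le> ereal (real m)"
    using p(1) mdegree_le_iff[of p 0 m] by (metis add.right_neutral of_nat_0 zero_ereal_def)
  then show ?thesis using h p(2) m by auto
qed

lemma polynomial_solution_imp_smooth_solution:
  assumes "\<And>x. laplacian (eval_mpoly h) x = eval_mpoly g x"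
    and "\<And>x. x \<in> ellipsoid_bd \<beta> \<Longrightarrow> gradient (eval_mpoly h) x \<bullet> gradient (quad \<beta>) x = eval_mpoly f x"
  shows "\<exists>h :: real^'n \<Rightarrow> real. smooth_on_nhd h (ellipsoid_cl \<beta>) \<and>
        (\<forall>x\<in>ellipsoid_cl \<beta>. laplacian h x = eval_mpoly g x) \<and>
        (\<forall>x\<in>ellipsoid_bd \<beta>. normal_deriv \<beta> h x = eval_mpoly f x / norm (gradient (quad \<beta>) x))"
  using assms
  by (intro exI[of _ "eval_mpoly h"]) (auto simp: smooth_on_nhd_def normal_deriv_eq
      intro!: exI[of _ UNIV] Ck_on_real_polynomial_function real_polynomial_function_eval_mpoly)

text \<open>The divergence theorem for the gradient of \<open>h\<close> on the neighbourhood of the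
  closed ellipsoid; the nonzero gradient norm cancels from the boundary condition.\<close>

lemma smooth_solution_imp_compatible:
  fixes f g :: "real^'n \<Rightarrow> real"
  assumes h: "smooth_on_nhd h (ellipsoid_cl \<beta>)"
    and lap: "\<And>x. x \<in> ellipsoid_cl \<beta> \<Longrightarrow> laplacian h x = g x"
    and nd: "\<And>x. x \<in> ellipsoid_bd \<beta> \<Longrightarrow> normal_deriv \<beta> h x = f x / norm (gradient (quad \<beta>) x)"
  shows "bd_int f = solid_int g"
proof -
  obtain U where U: "open U" "ellipsoid_cl \<beta> \<subseteq> U" and Ck: "\<And>k. Ck_on k h U"
    using h by (auto simp: smooth_on_nhd_def)
  \<comment> \<open>Order two provides differentiable first and continuous second derivatives, as
    the divergence theorem requires of the gradient field.\<close>
  have "Ck_on (Suc (Suc 0)) h U" by (rule Ck)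
  then have F: "partial_deriv k h differentiable_on U" "continuous_on U (partial_deriv k (partial_deriv k h))" for k
    by auto
  have "bd_int f = bd_int (\<lambda>x. \<Sum>k\<in>UNIV. partial_deriv k h x * (2 * \<beta> $ k * x $ k))"
  proof (rule bd_int_cong)
    fix x assume x: "x \<in> ellipsoid_bd \<beta>"
    show "f x = (\<Sum>k\<in>UNIV. partial_deriv k h x * (2 * \<beta> $ k * x $ k))"
      using nd[OF x] gradient_quad_nonzero[OF x] by (simp add: normal_deriv_eq gradient_inner_gradient_quad)
  qed
  also have "\<dots> = (\<integral>x. indicator (ellipsoid \<beta>) x * (\<Sum>k\<in>UNIV. partial_deriv k (partial_deriv k h) x) \<partial>lborel)"
    unfolding bd_int_def by (rule divergence_theorem[OF U F])
  also have "\<dots> = solid_int g"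
    unfolding solid_int_def using lap ellipsoid_subset_cl(1)
    by (intro Bochner_Integration.integral_cong) (auto simp: indicator_def laplacian_def)
  finally show ?thesis .
qed

end

theorem theorem2p9:
  fixes \<beta> :: "real^'n::finite" and f g :: "'n mpoly"
  assumes "CARD('n) \<ge> 2" and "\<And>i. \<beta> $ i > 0"
  defines "a \<equiv>
    (LINT x:ellipsoid_bd \<beta>|surface_measure (ellipsoid_bd \<beta>).
        eval_mpoly f x / norm (gradient (quad \<beta>) x))
      = (LINT x:ellipsoid \<beta>|lborel. eval_mpoly g x)"
  defines "b \<equiv>
    (\<exists>h :: 'n mpoly. mdegree h \<le> max (mdegree f) (2 + mdegree g) \<and>
        (\<forall>x. laplacian (eval_mpoly h) x = eval_mpoly g x) \<and>
        (\<forall>x\<in>ellipsoid_bd \<beta>. gradient (eval_mpoly h) x \<bullet> gradient (quad \<beta>) x = eval_mpoly f x))"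
  defines "c \<equiv>
    (\<exists>h :: real^'n \<Rightarrow> real. smooth_on_nhd h (ellipsoid_cl \<beta>) \<and>
        (\<forall>x\<in>ellipsoid_cl \<beta>. laplacian h x = eval_mpoly g x) \<and>
        (\<forall>x\<in>ellipsoid_bd \<beta>.
           normal_deriv \<beta> h x = eval_mpoly f x / norm (gradient (quad \<beta>) x)))"
  shows "(a \<longleftrightarrow> b) \<and> (b \<longleftrightarrow> c)"
proof -
  interpret positive_weights \<beta> by standard (rule assms(2))
  have "a \<Longrightarrow> b"
    unfolding a_def b_def compatibility_condition_iff by (rule compatible_imp_polynomial_solution)
  moreover have "b \<Longrightarrow> c"
    unfolding b_def c_def by (elim exE conjE, rule polynomial_solution_imp_smooth_solution) blast+
  moreover have "c \<Longrightarrow> a"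
    unfolding a_def c_def compatibility_condition_iff by (elim exE conjE, rule smooth_solution_imp_compatible) blast+
  ultimately show ?thesis by blast
qed

end
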